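(* Let $R$ be a Gorenstein finitely generated graded algebra over a field of positive characteristic $p$, and assume that the Krull dimension of $R$ is at least $2$. Let $\mathfrak{a}\subset R$ be a homogeneous ideal which is primary to $R_+$. Then $\tau(\mathfrak{a})=T_{\mathfrak{a}}$.
   Context: Graded means $R=\bigoplus_{n\ge 0}R_n$ with $R_0$ equal to the base field, and $R_+=\bigoplus_{n>0}R_n$ is the unique maximal homogeneous ideal. $q=p^e$ denotes a power of $p$; $R^o$ is the set of elements of $R$ not in any minimal prime; $I^{[q]}$ is the ideal generated by all $i^q$, $i\in I$. For ideals $\mathfrak{a},I\subseteq R$ and $x\in R$: - $x\in I^{*\mathfrak{a}}$ if there is $c\in R^o$ with $c\,\mathfrak{a}^q x^q\subseteq I^{[q]}$ for all $q=p^e\gg 0$; - $x\in {}^{\mathfrak{a}}I^*$ if there is $c\in R^o$ with $c\,\mathfrak{a}^q x^q\subseteq \mathfrak{a}^q I^{[q]}$ for all $q=p^e\gg 0$. The test ideals are $\tau(\mathfrak{a})=\bigcap_I (I:I^{*\mathfrak{a}})$ and $T_{\mathfrak{a}}=\bigcap_I (I:{}^{\mathfrak{a}}I^* )$, each intersection ranging over all ideals $I\subseteq R$. *)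

theory Defs
  imports "HOL-Algebra.Algebra" "HOL-Library.Extended_Nat"
begin

section \<open>Commutative algebra\<close>

definition krull_dim :: "('a, 'b) ring_scheme \<Rightarrow> enat" where
  "krull_dim R = (SUP n \<in> {n. \<exists>P. (\<forall>i\<le>n. primeideal (P i) R) \<and> (\<forall>i<n. P i \<subset> P (Suc i))}. enat n)"

definition minimal_primes :: "('a, 'b) ring_scheme \<Rightarrow> 'a set set" where
  "minimal_primes R = {P. primeideal P R \<and> (\<forall>Q. primeideal Q R \<and> Q \<subseteq> P \<longrightarrow> Q = P)}"

definition ideal_colon :: "('a, 'b) ring_scheme \<Rightarrow> 'a set \<Rightarrow> 'a set \<Rightarrow> 'a set" where
  "ideal_colon R I J = {r \<in> carrier R. \<forall>x\<in>J. r \<otimes>\<^bsub>R\<^esub> x \<in> I}"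

definition radical :: "('a, 'b) ring_scheme \<Rightarrow> 'a set \<Rightarrow> 'a set" where
  "radical R I = {x \<in> carrier R. \<exists>n::nat. x [^]\<^bsub>R\<^esub> n \<in> I}"

definition primary_ideal :: "('a, 'b) ring_scheme \<Rightarrow> 'a set \<Rightarrow> bool" where
  "primary_ideal R I \<longleftrightarrow> ideal I R \<and> I \<noteq> carrier R \<and>
     (\<forall>x\<in>carrier R. \<forall>y\<in>carrier R. x \<otimes>\<^bsub>R\<^esub> y \<in> I \<longrightarrow> x \<in> I \<or> y \<in> radical R I)"

definition primary_to :: "('a, 'b) ring_scheme \<Rightarrow> 'a set \<Rightarrow> 'a set \<Rightarrow> bool" where
  "primary_to R I P \<longleftrightarrow> primary_ideal R I \<and> radical R I = P"

definition ring_char :: "('a, 'b) ring_scheme \<Rightarrow> nat" where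
  "ring_char R = (if \<exists>n>0. add_pow R (n::nat) \<one>\<^bsub>R\<^esub> = \<zero>\<^bsub>R\<^esub>
                  then LEAST n. 0 < n \<and> add_pow R (n::nat) \<one>\<^bsub>R\<^esub> = \<zero>\<^bsub>R\<^esub> else 0)"


subsection \<open>Localization\<close>

definition frac_rel :: "('a, 'b) ring_scheme \<Rightarrow> 'a set \<Rightarrow> (('a \<times> 'a) \<times> ('a \<times> 'a)) set" where
  "frac_rel R S = {((a, s), (b, t)). a \<in> carrier R \<and> s \<in> S \<and> b \<in> carrier R \<and> t \<in> S \<and>
     (\<exists>u\<in>S. u \<otimes>\<^bsub>R\<^esub> (a \<otimes>\<^bsub>R\<^esub> t) = u \<otimes>\<^bsub>R\<^esub> (b \<otimes>\<^bsub>R\<^esub> s))}"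

definition localization :: "('a, 'b) ring_scheme \<Rightarrow> 'a set \<Rightarrow> ('a \<times> 'a) set ring" where
  "localization R S =
     \<lparr>carrier = (carrier R \<times> S) // frac_rel R S,
      monoid.mult = (\<lambda>A B. \<Union>x\<in>A. \<Union>y\<in>B. frac_rel R S `` {(fst x \<otimes>\<^bsub>R\<^esub> fst y, snd x \<otimes>\<^bsub>R\<^esub> snd y)}),
      one = frac_rel R S `` {(\<one>\<^bsub>R\<^esub>, \<one>\<^bsub>R\<^esub>)},
      ring.zero = frac_rel R S `` {(\<zero>\<^bsub>R\<^esub>, \<one>\<^bsub>R\<^esub>)},
      add = (\<lambda>A B. \<Union>x\<in>A. \<Union>y\<in>B.
               frac_rel R S `` {((fst x \<otimes>\<^bsub>R\<^esub> snd y) \<oplus>\<^bsub>R\<^esub> (fst y \<otimes>\<^bsub>R\<^esub> snd x), snd x \<otimes>\<^bsub>R\<^esub> snd y)})\<rparr>"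

definition localization_at :: "('a, 'b) ring_scheme \<Rightarrow> 'a set \<Rightarrow> ('a \<times> 'a) set ring" where
  "localization_at R P = localization R (carrier R - P)"


subsection \<open>Injective dimension and Gorenstein rings\<close>

definition mod_hom ::
    "('r, 'c) ring_scheme \<Rightarrow> ('r, 'm, 'd) module_scheme \<Rightarrow> ('r, 'n, 'e) module_scheme \<Rightarrow> ('m \<Rightarrow> 'n) set" where
  "mod_hom R M N = {h \<in> carrier M \<rightarrow> carrier N.
     (\<forall>x\<in>carrier M. \<forall>y\<in>carrier M. h (x \<oplus>\<^bsub>M\<^esub> y) = h x \<oplus>\<^bsub>N\<^esub> h y) \<and>
     (\<forall>r\<in>carrier R. \<forall>x\<in>carrier M. h (r \<odot>\<^bsub>M\<^esub> x) = r \<odot>\<^bsub>N\<^esub> h x)}"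

definition mod_ker ::
    "('r, 'm, 'd) module_scheme \<Rightarrow> ('r, 'n, 'e) module_scheme \<Rightarrow> ('m \<Rightarrow> 'n) \<Rightarrow> 'm set" where
  "mod_ker M N h = {x \<in> carrier M. h x = \<zero>\<^bsub>N\<^esub>}"

definition self_module :: "('r, 'c) ring_scheme \<Rightarrow> ('r, 'r) module" where
  "self_module R = \<lparr>carrier = carrier R, monoid.mult = monoid.mult R, one = one R,
     ring.zero = ring.zero R, add = add R, smult = monoid.mult R\<rparr>"

text \<open>The test modules \<open>M\<close>, \<open>N\<close> range over the modules carried by the type \<open>'m\<close>. By Baer's
  criterion this is injectivity in the category of all modules as soon as \<open>'r\<close> embeds into \<open>'m\<close>,
  as it does in \<open>inj_dim\<close> below.\<close>

definition injective_module :: "('r, 'c) ring_scheme \<Rightarrow> ('r, 'm) module \<Rightarrow> bool" where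
  "injective_module R E \<longleftrightarrow> module R E \<and>
     (\<forall>(M::('r, 'm) module) (N::('r, 'm) module) f g.
        module R M \<and> module R N \<and> f \<in> mod_hom R M N \<and> inj_on f (carrier M) \<and> g \<in> mod_hom R M E \<longrightarrow>
        (\<exists>h\<in>mod_hom R N E. \<forall>x\<in>carrier M. h (f x) = g x))"

definition injective_resolution ::
    "('r, 'c) ring_scheme \<Rightarrow> ('r, 'a, 'd) module_scheme \<Rightarrow>
     (nat \<Rightarrow> ('r, 'm) module) \<Rightarrow> ('a \<Rightarrow> 'm) \<Rightarrow> (nat \<Rightarrow> 'm \<Rightarrow> 'm) \<Rightarrow> bool" where
  "injective_resolution R M E \<epsilon> d \<longleftrightarrow>
     (\<forall>i. injective_module R (E i)) \<and>
     \<epsilon> \<in> mod_hom R M (E 0) \<and> inj_on \<epsilon> (carrier M) \<and>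
     (\<forall>i. d i \<in> mod_hom R (E i) (E (Suc i))) \<and>
     \<epsilon> ` carrier M = mod_ker (E 0) (E 1) (d 0) \<and>
     (\<forall>i. d i ` carrier (E i) = mod_ker (E (Suc i)) (E (Suc (Suc i))) (d (Suc i)))"

text \<open>The resolving modules are taken on the type \<open>('r \<times> 'a \<times> nat) set\<close>. This loses nothing: with
  \<open>\<kappa>\<close> the cardinality of \<open>'r \<times> 'a \<times> nat\<close>, a module with at most \<open>2 ^ \<kappa>\<close> elements embeds into an
  injective module (the additive maps from \<open>R\<close> to its divisible hull) with at most \<open>2 ^ \<kappa>\<close>
  elements. The value is \<open>\<infinity>\<close> if there is no finite injective resolution.\<close>

definition inj_dim :: "('r, 'c) ring_scheme \<Rightarrow> ('r, 'a, 'd) module_scheme \<Rightarrow> enat" where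
  "inj_dim R M = Inf {enat n | n.
     \<exists>(E :: nat \<Rightarrow> ('r, ('r \<times> 'a \<times> nat) set) module) \<epsilon> d.
       injective_resolution R M E \<epsilon> d \<and> (\<forall>i>n. carrier (E i) = {\<zero>\<^bsub>E i\<^esub>})}"

definition local_ring :: "('a, 'b) ring_scheme \<Rightarrow> bool" where
  "local_ring R \<longleftrightarrow> cring R \<and> (\<exists>!\<mm>. maximalideal \<mm> R)"

definition gorenstein_local_ring :: "('a, 'b) ring_scheme \<Rightarrow> bool" where
  "gorenstein_local_ring R \<longleftrightarrow> local_ring R \<and> noetherian_ring R \<and> inj_dim R (self_module R) < \<infinity>"

definition gorenstein_ring :: "('a, 'b) ring_scheme \<Rightarrow> bool" where
  "gorenstein_ring R \<longleftrightarrow> cring R \<and> noetherian_ring R \<and>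
     (\<forall>\<mm>. maximalideal \<mm> R \<longrightarrow> gorenstein_local_ring (localization_at R \<mm>))"


section \<open>Graded algebras\<close>

definition is_grading :: "('a, 'b) ring_scheme \<Rightarrow> (nat \<Rightarrow> 'a set) \<Rightarrow> bool" where
  "is_grading R G \<longleftrightarrow>
     (\<forall>n. additive_subgroup (G n) R) \<and>
     (\<forall>m n. \<forall>x\<in>G m. \<forall>y\<in>G n. x \<otimes>\<^bsub>R\<^esub> y \<in> G (m + n)) \<and>
     (\<forall>x\<in>carrier R. \<exists>!f. (\<forall>n. f n \<in> G n) \<and> finite {n. f n \<noteq> \<zero>\<^bsub>R\<^esub>} \<and>
        x = (\<Oplus>\<^bsub>R\<^esub>n\<in>{n. f n \<noteq> \<zero>\<^bsub>R\<^esub>}. f n))"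

text \<open>The base field is the degree-zero component \<open>G 0\<close>.\<close>

definition fg_graded_algebra :: "('a, 'b) ring_scheme \<Rightarrow> (nat \<Rightarrow> 'a set) \<Rightarrow> bool" where
  "fg_graded_algebra R G \<longleftrightarrow> cring R \<and> is_grading R G \<and> subfield (G 0) R \<and>
     (\<exists>S. finite S \<and> S \<subseteq> carrier R \<and> generate_ring R (G 0 \<union> S) = carrier R)"

definition irrelevant_ideal :: "('a, 'b) ring_scheme \<Rightarrow> (nat \<Rightarrow> 'a set) \<Rightarrow> 'a set" where
  "irrelevant_ideal R G = {(\<Oplus>\<^bsub>R\<^esub>n\<in>N. f n) | N f. finite N \<and> 0 \<notin> N \<and> (\<forall>n\<in>N. f n \<in> G n)}"

definition homogeneous_ideal :: "('a, 'b) ring_scheme \<Rightarrow> (nat \<Rightarrow> 'a set) \<Rightarrow> 'a set \<Rightarrow> bool" where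
  "homogeneous_ideal R G I \<longleftrightarrow> ideal I R \<and> (\<exists>S. S \<subseteq> (\<Union>n. G n) \<and> I = Idl\<^bsub>R\<^esub> S)"


section \<open>Tight closures with respect to an ideal and their test ideals\<close>

definition ring_o :: "('a, 'b) ring_scheme \<Rightarrow> 'a set" where
  "ring_o R = carrier R - \<Union> (minimal_primes R)"

definition frobenius_power :: "('a, 'b) ring_scheme \<Rightarrow> 'a set \<Rightarrow> nat \<Rightarrow> 'a set" where
  "frobenius_power R I q = Idl\<^bsub>R\<^esub> {i [^]\<^bsub>R\<^esub> q | i. i \<in> I}"

abbreviation ideal_power :: "('a, 'b) ring_scheme \<Rightarrow> 'a set \<Rightarrow> nat \<Rightarrow> 'a set" where
  "ideal_power R \<aa> n \<equiv> \<aa> [^]\<^bsub>ideals_set R\<^esub> n"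

text \<open>\<open>tc_right R p \<aa> I\<close> is \<open>I\<close> with the exponent \<open>*\<aa>\<close> on the right; \<open>tc_left R p \<aa> I\<close> is \<open>I\<close> with
  exponents \<open>\<aa>\<close> on the left and \<open>*\<close> on the right.\<close>

definition tc_right :: "('a, 'b) ring_scheme \<Rightarrow> nat \<Rightarrow> 'a set \<Rightarrow> 'a set \<Rightarrow> 'a set" where
  "tc_right R p \<aa> I = {x \<in> carrier R. \<exists>c\<in>ring_o R. \<forall>\<^sub>F e in sequentially.
     \<forall>y\<in>ideal_power R \<aa> (p ^ e).
       c \<otimes>\<^bsub>R\<^esub> y \<otimes>\<^bsub>R\<^esub> x [^]\<^bsub>R\<^esub> (p ^ e) \<in> frobenius_power R I (p ^ e)}"

definition tc_left :: "('a, 'b) ring_scheme \<Rightarrow> nat \<Rightarrow> 'a set \<Rightarrow> 'a set \<Rightarrow> 'a set" where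
  "tc_left R p \<aa> I = {x \<in> carrier R. \<exists>c\<in>ring_o R. \<forall>\<^sub>F e in sequentially.
     \<forall>y\<in>ideal_power R \<aa> (p ^ e).
       c \<otimes>\<^bsub>R\<^esub> y \<otimes>\<^bsub>R\<^esub> x [^]\<^bsub>R\<^esub> (p ^ e) \<in> ideal_power R \<aa> (p ^ e) \<cdot>\<^bsub>R\<^esub> frobenius_power R I (p ^ e)}"

definition test_ideal_tau :: "('a, 'b) ring_scheme \<Rightarrow> nat \<Rightarrow> 'a set \<Rightarrow> 'a set" where
  "test_ideal_tau R p \<aa> = (\<Inter>I\<in>{I. ideal I R}. ideal_colon R I (tc_right R p \<aa> I))"

definition test_ideal_T :: "('a, 'b) ring_scheme \<Rightarrow> nat \<Rightarrow> 'a set \<Rightarrow> 'a set" where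
  "test_ideal_T R p \<aa> = (\<Inter>I\<in>{I. ideal I R}. ideal_colon R I (tc_left R p \<aa> I))"

end

theory Submission
  imports Defs
begin

text \<open>Write \<open>\<mm> = R\<^sub>+\<close>. Only \<open>T \<subseteq> \<tau>\<close> is not formal. Let \<open>c \<in> T\<close>, \<open>z \<in> I\<^sup>*\<^sup>\<aa>\<close>, and suppose that \<open>I\<close> is
  maximal among the ideals not containing \<open>y = c z\<close>; then \<open>I\<close> is primary to the maximal ideal \<open>I : y\<close>.
  If this is not \<open>\<mm>\<close>, then \<open>I\<close> and \<open>\<aa>\<close> are comaximal, hence \<open>I\<^sup>[\<^sup>q\<^sup>] \<inter> \<aa>\<^sup>q = \<aa>\<^sup>q I\<^sup>[\<^sup>q\<^sup>]\<close> and both closures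
  of \<open>I\<close> agree. If it is \<open>\<mm>\<close>, duality over the Gorenstein ring embeds \<open>R/I\<close> by multiplication with some
  \<open>u\<close> into \<open>R/J\<close>, where \<open>J\<close> is generated by a maximal homogeneous regular sequence inside \<open>I\<close>. As
  \<open>dim R \<ge> 2\<close>, passing to powers of two members of the sequence makes the order of \<open>u\<close> exceed the degrees
  of the generators of \<open>J\<close> by any prescribed amount. Then \<open>(u z)\<^sup>q\<close> has such high order that its
  multiples in \<open>J\<^sup>[\<^sup>q\<^sup>]\<close> lie in \<open>\<aa>\<^sup>q J\<^sup>[\<^sup>q\<^sup>]\<close>; so \<open>u z\<close> lies in the smaller closure of \<open>J\<close> and \<open>u y \<in> J\<close>, a
  contradiction.

  The duality is read off the groups \<open>Ext\<^sup>i(R/I, R\<^sub>\<mm>)\<close>, computed on a finite injective resolution of \<open>R\<^sub>\<mm>\<close>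
  by means of the sequences \<open>0 \<rightarrow> R/(I : f) \<rightarrow> R/I \<rightarrow> R/(I + f) \<rightarrow> 0\<close>.\<close>

section \<open>Ideals of Noetherian rings\<close>

text \<open>Two members of the sequence are needed because of a count of degrees. Let
  \<open>f\<close>, \<open>g\<close> have degrees \<open>a\<close>, \<open>b\<close>. Replacing
  \<open>f\<close> alone by \<open>f^(r+1)\<close> multiplies \<open>u\<close> by
  \<open>f^r\<close>, whose order \<open>r a\<close> stays below the new generator degree
  \<open>(r+1) a\<close>; with both elements the order \<open>r a + t b\<close> outgrows
  \<open>(r+1) a\<close> as well as \<open>(t+1) b\<close>. The amount to be gained is a constant
  \<open>K\<close> with \<open>R_(>=qK)\<close> inside the \<open>q\<close>-th power of the given
  ideal for every \<open>q\<close>: it enters linearly in \<open>q\<close>, as do the order of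
  \<open>(u z)^q\<close> and the generator degrees of the Frobenius power.

  The Gorenstein condition is local, the degree argument graded. The bridge is that homogeneous
  ideals are saturated with respect to the complement of \<open>R_+\<close>: the sequence is chosen
  homogeneous although \<open>I\<close> need not be, and denominators can then be cancelled modulo
  \<open>J\<close>. The dimension enters by contraposition: a maximal sequence with fewer than two
  members would place some \<open>R_(>=N)\<close> in a principal ideal, and then \<open>R\<close>
  has no chain of three primes.\<close>

definition (in ring) adjoin :: "'a set \<Rightarrow> 'a \<Rightarrow> 'a set" where
  "adjoin I x = {i \<oplus> r \<otimes> x | i r. i \<in> I \<and> r \<in> carrier R}"

definition (in ring) colon :: "'a set \<Rightarrow> 'a \<Rightarrow> 'a set" where
  "colon I x = {r \<in> carrier R. r \<otimes> x \<in> I}"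

context cring
begin

lemma adjoinI: "i \<in> I \<Longrightarrow> r \<in> carrier R \<Longrightarrow> i \<oplus> r \<otimes> x \<in> adjoin I x"
  unfolding adjoin_def by blast

lemma adjoinE:
  assumes "y \<in> adjoin I x"
  obtains i r where "i \<in> I" "r \<in> carrier R" "y = i \<oplus> r \<otimes> x"
  using assms unfolding adjoin_def by blast

lemma ideal_carr: "ideal I R \<Longrightarrow> x \<in> I \<Longrightarrow> x \<in> carrier R"
  by (rule ideal.Icarr)

lemma ideal_zero: "ideal I R \<Longrightarrow> \<zero> \<in> I"
  by (simp add: additive_subgroup.zero_closed ideal.axioms(1))

lemma ideal_add: "ideal I R \<Longrightarrow> x \<in> I \<Longrightarrow> y \<in> I \<Longrightarrow> x \<oplus> y \<in> I"
  by (simp add: additive_subgroup.a_closed ideal.axioms(1))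

lemma ideal_neg: "ideal I R \<Longrightarrow> x \<in> I \<Longrightarrow> \<ominus> x \<in> I"
  by (simp add: additive_subgroup.a_inv_closed ideal.axioms(1))

lemma ideal_diff: "ideal I R \<Longrightarrow> x \<in> I \<Longrightarrow> y \<in> I \<Longrightarrow> x \<ominus> y \<in> I"
  by (simp add: ideal_add ideal_neg a_minus_def)

lemma ideal_subset: "ideal I R \<Longrightarrow> I \<subseteq> carrier R"
  by (simp add: additive_subgroup.a_subset ideal.axioms(1))

lemma ideal_cancel_left:
  assumes "ideal I R" "x \<in> I" "x \<oplus> y \<in> I" "y \<in> carrier R"
  shows "y \<in> I"
proof -
  have "x \<in> carrier R" by (rule ideal_carr[OF assms(1,2)])
  then have "(x \<oplus> y) \<ominus> x = y" using assms(4) by algebra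
  then show ?thesis using ideal_diff[OF assms(1,3,2)] by simp
qed

lemma idealI_cring:
  assumes "I \<subseteq> carrier R" "\<zero> \<in> I" "\<And>x y. x \<in> I \<Longrightarrow> y \<in> I \<Longrightarrow> x \<oplus> y \<in> I"
    and "\<And>r x. r \<in> carrier R \<Longrightarrow> x \<in> I \<Longrightarrow> r \<otimes> x \<in> I"
  shows "ideal I R"
proof (rule idealI[OF ring_axioms])
  show "subgroup I (add_monoid R)"
  proof (rule add.subgroupI)
    fix x assume "x \<in> I"
    then show "\<ominus> x \<in> I" using assms(4)[of "\<ominus> \<one>" x] assms(1) by (simp add: subset_iff l_minus)
  qed (use assms in auto)
  show "\<And>a x. a \<in> I \<Longrightarrow> x \<in> carrier R \<Longrightarrow> x \<otimes> a \<in> I" using assms(4) by blast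
  show "\<And>a x. a \<in> I \<Longrightarrow> x \<in> carrier R \<Longrightarrow> a \<otimes> x \<in> I"
    using assms(1,4) by (metis m_comm subsetD)
qed

lemma adjoin_ideal:
  assumes I: "ideal I R" and x: "x \<in> carrier R"
  shows "ideal (adjoin I x) R"
proof (rule idealI_cring)
  have Ic: "\<And>i. i \<in> I \<Longrightarrow> i \<in> carrier R" using ideal_carr[OF I] .
  show "adjoin I x \<subseteq> carrier R" using Ic x by (auto simp: adjoin_def)
  show "\<zero> \<in> adjoin I x" using adjoinI[OF ideal_zero[OF I] zero_closed, of x] x by simp
  fix y assume y: "y \<in> adjoin I x"
  then obtain i r where ir: "i \<in> I" "r \<in> carrier R" "y = i \<oplus> r \<otimes> x" by (rule adjoinE)
  { fix z assume "z \<in> adjoin I x"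
    then obtain j s where js: "j \<in> I" "s \<in> carrier R" "z = j \<oplus> s \<otimes> x" by (rule adjoinE)
    have "y \<oplus> z = (i \<oplus> j) \<oplus> (r \<oplus> s) \<otimes> x" unfolding ir(3) js(3) using ir(2) js(2) x Ic[OF ir(1)] Ic[OF js(1)] by algebra
    then show "y \<oplus> z \<in> adjoin I x" using adjoinI[OF ideal_add[OF I ir(1) js(1)]] ir js by simp }
  fix s assume s: "s \<in> carrier R"
  have "s \<otimes> y = s \<otimes> i \<oplus> (s \<otimes> r) \<otimes> x"
      unfolding ir(3) using ir(2) s x Ic[OF ir(1)] by algebra
  then show "s \<otimes> y \<in> adjoin I x" using adjoinI[OF ideal.I_l_closed[OF I ir(1) s]] ir s by simp
qed

lemma adjoin_incl: "ideal I R \<Longrightarrow> x \<in> carrier R \<Longrightarrow> I \<subseteq> adjoin I x"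
  using adjoinI[OF _ zero_closed, of _ I x] ideal_carr[of I] by force

lemma adjoin_mem: "ideal I R \<Longrightarrow> x \<in> carrier R \<Longrightarrow> x \<in> adjoin I x"
  using adjoinI[OF ideal_zero one_closed, of I x] by simp

lemma adjoin_mult_mem:
  "ideal I R \<Longrightarrow> x \<in> carrier R \<Longrightarrow> r \<in> carrier R \<Longrightarrow> r \<otimes> x \<in> adjoin I x"
  using adjoinI[OF ideal_zero, of I r x] by simp

lemma adjoin_least: "ideal K R \<Longrightarrow> I \<subseteq> K \<Longrightarrow> x \<in> K \<Longrightarrow> adjoin I x \<subseteq> K"
  by (auto elim!: adjoinE intro!: ideal_add ideal.I_l_closed)

lemma adjoin_strict: "ideal I R \<Longrightarrow> x \<in> carrier R \<Longrightarrow> x \<notin> I \<Longrightarrow> I \<subset> adjoin I x"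
  using adjoin_incl adjoin_mem by blast

lemma adjoin_genideal:
  assumes "H \<subseteq> carrier R" "x \<in> carrier R"
  shows "adjoin (Idl H) x = Idl (insert x H)"
proof
  have sub: "insert x H \<subseteq> carrier R" using assms by auto
  show "adjoin (Idl H) x \<subseteq> Idl (insert x H)"
    using adjoin_least[OF genideal_ideal[OF sub]] genideal_self[OF sub]
      genideal_minimal[OF genideal_ideal[OF sub], of H] by auto
  show "Idl (insert x H) \<subseteq> adjoin (Idl H) x"
    using genideal_minimal[OF adjoin_ideal[OF genideal_ideal[OF assms(1)] assms(2)], of "insert x H"]
      adjoin_mem[OF genideal_ideal[OF assms(1)] assms(2)]
      adjoin_incl[OF genideal_ideal[OF assms(1)] assms(2)] genideal_self[OF assms(1)] by auto
qed

lemma colon_ideal: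
  assumes I: "ideal I R" and x: "x \<in> carrier R"
  shows "ideal (colon I x) R"
proof (rule idealI_cring)
  show "\<zero> \<in> colon I x" using ideal_zero[OF I] x by (simp add: colon_def)
  show "\<And>a b. a \<in> colon I x \<Longrightarrow> b \<in> colon I x \<Longrightarrow> a \<oplus> b \<in> colon I x"
    using x by (auto simp: colon_def l_distr intro: ideal_add[OF I])
  show "\<And>r a. r \<in> carrier R \<Longrightarrow> a \<in> colon I x \<Longrightarrow> r \<otimes> a \<in> colon I x"
    using x by (auto simp: colon_def m_assoc intro: ideal.I_l_closed[OF I])
qed (auto simp: colon_def)

lemma colon_incl: "ideal I R \<Longrightarrow> x \<in> carrier R \<Longrightarrow> I \<subseteq> colon I x"
  by (auto simp: colon_def ideal_carr intro: ideal.I_r_closed)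

lemma colon_eq_carrier: "ideal I R \<Longrightarrow> x \<in> I \<Longrightarrow> colon I x = carrier R"
  by (auto simp: colon_def intro: ideal.I_l_closed)

lemma mem_if_colon_eq:
  "colon I x = I \<Longrightarrow> z \<in> carrier R \<Longrightarrow> z \<otimes> x \<in> I \<Longrightarrow> z \<in> I"
  by (auto simp: colon_def)

lemma colon_eqI:
  assumes "ideal I R" "x \<in> carrier R" "\<And>z. z \<in> carrier R \<Longrightarrow> z \<otimes> x \<in> I \<Longrightarrow> z \<in> I"
  shows "colon I x = I"
  using assms colon_incl[OF assms(1,2)] by (auto simp: colon_def)

lemma colon_pow_eq:
  assumes I: "ideal I R" and x: "x \<in> carrier R" and c: "colon I x = I"
  shows "colon I (x [^] (k::nat)) = I"
proof (rule colon_eqI[OF I])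
  show "x [^] k \<in> carrier R" using x by simp
  show "z \<otimes> x [^] k \<in> I \<Longrightarrow> z \<in> I" if "z \<in> carrier R" for z
    using that
  proof (induction k arbitrary: z)
    case (Suc k)
    have "(z \<otimes> x [^] k) \<otimes> x \<in> I" using Suc.prems x by (simp add: m_assoc)
    then have "z \<otimes> x [^] k \<in> I" using mem_if_colon_eq[OF c] Suc.prems(2) x by simp
    then show ?case using Suc.IH Suc.prems(2) by blast
  qed simp
qed

lemma one_minus_pow_mem:
  assumes I: "ideal I R" and t: "t \<in> carrier R" "\<one> \<ominus> t \<in> I"
  shows "\<one> \<ominus> t [^] (k::nat) \<in> I"
proof (induction k)
  case 0
  then show ?case using ideal_zero[OF I] by (simp add: a_minus_def r_neg)
next
  case (Suc k)
  have tk: "t [^] k \<in> carrier R" using t by simp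
  have "\<one> \<ominus> t [^] Suc k = (\<one> \<ominus> t) \<oplus> t \<otimes> (\<one> \<ominus> t [^] k)"
    unfolding nat_pow_Suc using t(1) tk by algebra
  then show ?case using ideal_add[OF I t(2) ideal.I_l_closed[OF I Suc t(1)]] by simp
qed

text \<open>Turns a power of \<open>1 - t\<close> lying in an ideal into invertibility of
  \<open>t\<close> modulo that ideal; with \<open>one_minus_pow_mem\<close> it replaces computing in
  the quotient ring.\<close>

lemma one_minus_pow_eq:
  assumes t: "t \<in> carrier R"
  shows "\<exists>w\<in>carrier R. (\<one> \<ominus> t) [^] (k::nat) = \<one> \<ominus> t \<otimes> w"
proof (induction k)
  case 0
  then show ?case using t by (intro bexI[of _ \<zero>]) (auto simp: a_minus_def)
next
  case (Suc k)
  then obtain w where w: "w \<in> carrier R" "(\<one> \<ominus> t) [^] k = \<one> \<ominus> t \<otimes> w" by blast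
  have "(\<one> \<ominus> t) [^] Suc k = \<one> \<ominus> t \<otimes> (\<one> \<oplus> w \<ominus> t \<otimes> w)"
    unfolding nat_pow_Suc w(2) using t w(1) by algebra
  then show ?case using t w(1) by (intro bexI[of _ "\<one> \<oplus> w \<ominus> t \<otimes> w"]) auto
qed

text \<open>Such an \<open>s\<close> represents a nonzero socle element of \<open>R/I\<close>:
  \<open>I : s\<close> contains \<open>M\<close> and misses 1. Multiplication by \<open>s\<close>
  thus embeds \<open>R/M\<close> into \<open>R/I\<close>.\<close>

lemma colon_eq_maximalideal:
  assumes M: "maximalideal M R" and I: "ideal I R" and s: "s \<in> carrier R" "s \<notin> I"
    and Ms: "\<And>x. x \<in> M \<Longrightarrow> x \<otimes> s \<in> I"
  shows "colon I s = M"
proof -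
  have "M \<subseteq> colon I s"
    using Ms ideal_carr[OF maximalideal.axioms(1)[OF M]] by (auto simp: colon_def)
  moreover have "\<one> \<notin> colon I s" using s by (simp add: colon_def)
  then have "colon I s \<noteq> carrier R" using one_closed by blast
  ultimately show ?thesis
    using maximalideal.I_maximal[OF M colon_ideal[OF I s(1)]] by (simp add: colon_def subset_iff)
qed

end

locale noetherian_cring = noetherian_ring R + cring R for R (structure)
begin

text \<open>Zorn's lemma on the ideals violating \<open>P\<close>: a nonempty chain of ideals
  contains its own union, so a maximal violating ideal exists, and \<open>step\<close> refutes
  it.\<close>

lemma noetherian_induct [consumes 1, case_names step]:
  assumes "ideal I R"
    and step: "\<And>I. ideal I R \<Longrightarrow> (\<And>K. ideal K R \<Longrightarrow> I \<subset> K \<Longrightarrow> P K) \<Longrightarrow> P I"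
  shows "P I"
proof (rule ccontr)
  assume nP: "\<not> P I"
  define \<F> where "\<F> = {K. ideal K R \<and> \<not> P K}"
  have "\<exists>M\<in>\<F>. \<forall>N\<in>\<F>. M \<subseteq> N \<longrightarrow> N = M"
  proof (rule subset_Zorn_nonempty)
    show "\<F> \<noteq> {}" using nP assms(1) by (auto simp: \<F>_def)
    fix C assume C: "C \<noteq> {}" "subset.chain \<F> C"
    then have "subset.chain {K. ideal K R} C" unfolding subset.chain_def \<F>_def by auto
    then have "\<Union> C \<in> C" using ideal_chain_is_trivial[OF C(1)] by blast
    then show "\<Union> C \<in> \<F>" using C(2) unfolding subset.chain_def by auto
  qed
  then obtain M where "ideal M R" "\<not> P M" "\<And>N. ideal N R \<Longrightarrow> \<not> P N \<Longrightarrow> M \<subseteq> N \<Longrightarrow> N = M"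
    unfolding \<F>_def by auto
  then show False using step[of M] by blast
qed

lemma noetherian_maximal:
  assumes "ideal I R" "P I"
  obtains M where "ideal M R" "I \<subseteq> M" "P M" "\<And>K. ideal K R \<Longrightarrow> M \<subset> K \<Longrightarrow> \<not> P K"
proof -
  have "P I \<longrightarrow> (\<exists>M. ideal M R \<and> I \<subseteq> M \<and> P M \<and> (\<forall>K. ideal K R \<longrightarrow> M \<subset> K \<longrightarrow> \<not> P K))"
    using assms(1)
  proof (induction rule: noetherian_induct)
    case (step I)
    show ?case
    proof
      assume PI: "P I"
      show "\<exists>M. ideal M R \<and> I \<subseteq> M \<and> P M \<and> (\<forall>K. ideal K R \<longrightarrow> M \<subset> K \<longrightarrow> \<not> P K)"
      proof (cases "\<exists>K. ideal K R \<and> I \<subset> K \<and> P K")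
        case True
        then obtain K where K: "ideal K R" "I \<subset> K" "P K" by blast
        with step(2)[OF K(1,2)] show ?thesis by (meson order_trans psubset_imp_subset)
      qed (use PI step(1) in blast)
    qed
  qed
  then show thesis using that assms(2) by blast
qed

lemma ascending_chain_stable:
  assumes I: "\<And>n::nat. ideal (F n) R" and mono: "\<And>n. F n \<subseteq> F (Suc n)"
  shows "\<exists>N. \<forall>n\<ge>N. F n = F N"
proof -
  have mono': "F i \<subseteq> F j" if "i \<le> j" for i j using that mono lift_Suc_mono_le by metis
  have "\<forall>n. K = F n \<longrightarrow> (\<exists>N. \<forall>n\<ge>N. F n = F N)" if "ideal K R" for K
    using that
  proof (induction rule: noetherian_induct)
    case (step K)
    show ?case
    proof (intro allI impI)
      fix n assume n: "K = F n"
      show "\<exists>N. \<forall>n\<ge>N. F n = F N"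
      proof (cases "\<forall>m\<ge>n. F m = F n")
        case False
        then obtain m where "m \<ge> n" "F m \<noteq> F n" by blast
        then have "K \<subset> F m" using n mono' by blast
        then show ?thesis using step I by blast
      qed blast
    qed
  qed
  then show ?thesis using I by blast
qed

text \<open>With \<open>(I : f\<^sup>k)\<close> stable and \<open>f\<^sup>k \<notin> I\<close>, maximality gives \<open>y = i + r f\<^sup>k\<close>; from \<open>f y \<in> I\<close> one
  gets \<open>r f\<^sup>k\<^sup>+\<^sup>1 \<in> I\<close>, hence \<open>r f\<^sup>k \<in> I\<close> and \<open>y \<in> I\<close>.\<close>

lemma pow_mem_if_maximal_avoiding:
  assumes I: "ideal I R" and y: "y \<in> carrier R" "y \<notin> I"
    and max: "\<And>K. ideal K R \<Longrightarrow> I \<subset> K \<Longrightarrow> y \<in> K"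
    and f: "f \<in> carrier R" "f \<otimes> y \<in> I"
  shows "\<exists>k::nat. f [^] k \<in> I"
proof -
  have "\<exists>N::nat. \<forall>n\<ge>N. colon I (f [^] n) = colon I (f [^] N)"
  proof (rule ascending_chain_stable[where F = "\<lambda>n. colon I (f [^] n)"])
    show "\<And>n. ideal (colon I (f [^] (n::nat))) R" using colon_ideal[OF I] f(1) by simp
    show "colon I (f [^] (n::nat)) \<subseteq> colon I (f [^] Suc n)" for n
    proof
      fix z assume "z \<in> colon I (f [^] n)"
      then have z: "z \<in> carrier R" "z \<otimes> f [^] n \<in> I" by (auto simp: colon_def)
      have "z \<otimes> f [^] Suc n = (z \<otimes> f [^] n) \<otimes> f" using z f by (simp add: m_assoc)
      then show "z \<in> colon I (f [^] Suc n)" using z ideal.I_r_closed[OF I z(2) f(1)]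
        by (simp add: colon_def)
    qed
  qed
  then obtain k where k: "colon I (f [^] Suc k) = colon I (f [^] k)" by (metis le_Suc_eq order_refl)
  have fk: "f [^] k \<in> carrier R" using f by simp
  have "f [^] k \<in> I"
  proof (rule ccontr)
    assume "f [^] k \<notin> I"
    then have "y \<in> adjoin I (f [^] k)"
      using max[OF adjoin_ideal[OF I fk] adjoin_strict[OF I fk]] by blast
    then obtain i r where ir: "i \<in> I" "r \<in> carrier R" "y = i \<oplus> r \<otimes> f [^] k" by (rule adjoinE)
    have i: "i \<in> carrier R" using ideal_carr[OF I ir(1)] .
    have "f \<otimes> y = f \<otimes> i \<oplus> r \<otimes> f [^] Suc k"
      unfolding ir(3) nat_pow_Suc using i ir(2) f(1) fk by algebra
    then have "r \<otimes> f [^] Suc k \<in> I"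
      using f ideal_cancel_left[OF I ideal.I_l_closed[OF I ir(1) f(1)]] ir(2) by simp
    then have "r \<in> colon I (f [^] k)" using k ir(2) by (auto simp: colon_def)
    then show False using y ir ideal_add[OF I] by (auto simp: colon_def)
  qed
  then show ?thesis by blast
qed

section \<open>Associated primes\<close>

definition assoc_primes :: "'a set \<Rightarrow> 'a set set" where
  "assoc_primes I = {P. primeideal P R \<and> (\<exists>g\<in>carrier R. P = colon I g)}"

text \<open>A maximal member of the ideals \<open>I : h\<close> with \<open>h\<close> outside
  \<open>I\<close> is prime: if it contains \<open>a b\<close> but not \<open>b\<close>, then
  \<open>I : (b h)\<close> contains it together with \<open>a\<close>, so by maximality
  \<open>a\<close> already belongs to it.\<close>

lemma exists_assoc_prime:
  assumes I: "ideal I R" and g: "g \<in> carrier R" "g \<notin> I"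
  shows "\<exists>P\<in>assoc_primes I. colon I g \<subseteq> P"
proof -
  have id: "ideal (colon I g) R" using colon_ideal[OF I g(1)] .
  obtain M where M: "ideal M R" "colon I g \<subseteq> M" "\<exists>h\<in>carrier R. h \<notin> I \<and> M = colon I h"
    and max: "\<And>K. ideal K R \<Longrightarrow> M \<subset> K \<Longrightarrow> \<not> (\<exists>h\<in>carrier R. h \<notin> I \<and> K = colon I h)"
    using noetherian_maximal[OF id, of "\<lambda>K. \<exists>h\<in>carrier R. h \<notin> I \<and> K = colon I h"] g by blast
  obtain h where h: "h \<in> carrier R" "h \<notin> I" "M = colon I h" using M by blast
  have "primeideal M R"
  proof (rule primeidealI[OF M(1) cring_axioms])
    have "\<one> \<notin> M" using h by (simp add: colon_def)
    then show "carrier R \<noteq> M" using one_closed by blast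
    fix a b assume ab: "a \<in> carrier R" "b \<in> carrier R" "a \<otimes> b \<in> M"
    show "a \<in> M \<or> b \<in> M"
    proof (rule ccontr)
      assume n: "\<not> (a \<in> M \<or> b \<in> M)"
      then have bh: "b \<otimes> h \<in> carrier R" "b \<otimes> h \<notin> I" using ab h by (auto simp: colon_def)
      have "M \<subseteq> colon I (b \<otimes> h)"
      proof
        fix z assume "z \<in> M"
        then have z: "z \<in> carrier R" "z \<otimes> h \<in> I" unfolding h(3) by (auto simp: colon_def)
        have "z \<otimes> (b \<otimes> h) = b \<otimes> (z \<otimes> h)" using z(1) ab(2) h(1) by algebra
        then show "z \<in> colon I (b \<otimes> h)" using z ideal.I_l_closed[OF I z(2) ab(2)]
          by (simp add: colon_def)
      qed
      moreover have "a \<in> colon I (b \<otimes> h)" using ab h by (simp add: colon_def m_assoc)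
      ultimately show False using max[OF colon_ideal[OF I bh(1)]] bh n by blast
    qed
  qed
  then show ?thesis unfolding assoc_primes_def using M(2) h by blast
qed

text \<open>With \<open>R/P\<close> embedded in \<open>R/I\<close> by multiplication with
  \<open>g\<close>, the associated primes of \<open>I\<close> are \<open>P\<close> and associated
  primes of the strictly larger ideal \<open>I + g\<close>.\<close>

lemma finite_assoc_primes:
  assumes "ideal I R"
  shows "finite (assoc_primes I)"
  using assms
proof (induction rule: noetherian_induct)
  case (step I)
  show ?case
  proof (cases "I = carrier R")
    case True
    then have "assoc_primes I \<subseteq> {}"
      unfolding assoc_primes_def colon_def using primeideal.I_notcarr by fastforce
    then show ?thesis using finite_subset by blast
  next
    case False
    have "\<one> \<notin> I" using False ideal.one_imp_carrier[OF step(1)] by blast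
    then obtain P where P: "P \<in> assoc_primes I" using exists_assoc_prime[OF step(1) one_closed] by blast
    then obtain g where g: "g \<in> carrier R" "P = colon I g" and prP: "primeideal P R"
      by (auto simp: assoc_primes_def)
    have gI: "g \<notin> I" using g primeideal.I_notcarr[OF prP] colon_eq_carrier[OF step(1)] by blast
    have adj: "ideal (adjoin I g) R" "I \<subset> adjoin I g"
      using adjoin_ideal[OF step(1) g(1)] adjoin_strict[OF step(1) g(1) gI] by auto
    have "assoc_primes I \<subseteq> insert P (assoc_primes (adjoin I g))"
    proof
      fix Q assume "Q \<in> assoc_primes I"
      then obtain h where h: "h \<in> carrier R" "Q = colon I h" and prQ: "primeideal Q R"
        by (auto simp: assoc_primes_def)
      \<comment> \<open>Every nonzero element of a copy of \<open>R/P\<close> has annihilator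
        \<open>P\<close>.\<close>
      have colon_mult: "colon I (r \<otimes> a) = colon I a"
        if ra: "r \<in> carrier R" "a \<in> carrier R" "r \<otimes> a \<notin> I" "primeideal (colon I a) R" for r a
      proof -
        have eq: "z \<otimes> (r \<otimes> a) = (z \<otimes> r) \<otimes> a" if "z \<in> carrier R" for z
          using that ra(1,2) by algebra
        have "z \<in> colon I (r \<otimes> a) \<longleftrightarrow> z \<in> colon I a" if z: "z \<in> carrier R" for z
        proof -
          have "z \<in> colon I (r \<otimes> a) \<longleftrightarrow> z \<otimes> r \<in> colon I a"
            using z ra(1) eq[OF z] by (simp add: colon_def)
          also have "\<dots> \<longleftrightarrow> z \<in> colon I a \<or> r \<in> colon I a"
            using primeideal.I_prime[OF ra(4) z ra(1)]
              ideal.I_r_closed[OF colon_ideal[OF step(1) ra(2)] _ ra(1)]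
              ideal.I_l_closed[OF colon_ideal[OF step(1) ra(2)] _ z] by blast
          finally show ?thesis using ra by (simp add: colon_def)
        qed
        then show ?thesis by (auto simp: colon_def)
      qed
      show "Q \<in> insert P (assoc_primes (adjoin I g))"
      \<comment> \<open>Either the submodules of \<open>R/I\<close> generated by \<open>h\<close>
        and \<open>g\<close> share a nonzero element, whose annihilator is then both
        \<open>Q\<close> and \<open>P\<close>, or \<open>h\<close> keeps its annihilator
        \<open>Q\<close> in \<open>R/(I + g)\<close>.\<close>
      proof (cases "\<exists>r\<in>carrier R. r \<otimes> h \<notin> I \<and> r \<otimes> h \<in> adjoin I g")
        case True
        then obtain r where r: "r \<in> carrier R" "r \<otimes> h \<notin> I" "r \<otimes> h \<in> adjoin I g" by blast
        then obtain i s where is_: "i \<in> I" "s \<in> carrier R" "r \<otimes> h = i \<oplus> s \<otimes> g" by (metis adjoinE)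
        have i: "i \<in> carrier R" using ideal_carr[OF step(1) is_(1)] .
        have sg: "s \<otimes> g \<notin> I" using r is_ ideal_add[OF step(1)] by auto
        have "z \<in> colon I (r \<otimes> h) \<longleftrightarrow> z \<in> colon I (s \<otimes> g)" for z
        proof (cases "z \<in> carrier R")
          case z: True
          have "z \<otimes> (r \<otimes> h) = z \<otimes> i \<oplus> z \<otimes> (s \<otimes> g)" unfolding is_(3) using z is_(2) i g(1) by algebra
          moreover have zi: "z \<otimes> i \<in> I" by (rule ideal.I_l_closed[OF step(1) is_(1) z])
          moreover have "z \<otimes> (s \<otimes> g) \<in> carrier R" using z is_(2) g(1) by simp
          ultimately have "z \<otimes> (r \<otimes> h) \<in> I \<longleftrightarrow> z \<otimes> (s \<otimes> g) \<in> I"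
            using ideal_add[OF step(1) zi] ideal_cancel_left[OF step(1) zi] by metis
          then show ?thesis using z by (simp add: colon_def)
        qed (simp add: colon_def)
        then have "Q = P"
          using colon_mult[OF r(1) h(1) r(2)] colon_mult[OF is_(2) g(1) sg] prP prQ
          unfolding g(2) h(2) by blast
        then show ?thesis by simp
      next
        case False
        then have "Q = colon (adjoin I g) h" unfolding h(2) using adj by (auto simp: colon_def)
        then show ?thesis using h prQ by (auto simp: assoc_primes_def)
      qed
    qed
    then show ?thesis using step(2)[OF adj] finite_subset by blast
  qed
qed

text \<open>A zero divisor on \<open>R/I\<close> lies in an associated prime: if \<open>z f\<close>
  is in \<open>I\<close> and \<open>z\<close> is not, then \<open>f\<close> is in
  \<open>I : z\<close>.\<close>

lemma colon_eq_if_avoids_assoc_primes: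
  assumes I: "ideal I R" and f: "f \<in> carrier R" "\<And>P. P \<in> assoc_primes I \<Longrightarrow> f \<notin> P"
  shows "colon I f = I"
proof (rule colon_eqI[OF I f(1)], rule ccontr)
  fix z assume z: "z \<in> carrier R" "z \<otimes> f \<in> I" "z \<notin> I"
  then have "f \<in> colon I z" using f by (simp add: colon_def m_comm)
  then show False using exists_assoc_prime[OF I z(1,3)] f(2) by blast
qed

end

section \<open>Cohomology of a complex of injective modules\<close>

text \<open>Only the length and the generated ideal are recorded. The set \<open>T\<close> confines
  the entries, later to homogeneous elements of positive degree in \<open>I\<close>; building
  \<open>J\<close> by \<open>adjoin\<close> makes the last entries accessible to case
  analysis.\<close>

inductive (in cring) regseq :: "'a set \<Rightarrow> nat \<Rightarrow> 'a set \<Rightarrow> bool" for T where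
  zero: "regseq T 0 {\<zero>}"
| Suc: "regseq T n J \<Longrightarrow> x \<in> T \<Longrightarrow> x \<in> carrier R \<Longrightarrow> colon J x = J \<Longrightarrow> regseq T (Suc n) (adjoin J x)"

lemma (in cring) regseq_ideal: "regseq T n J \<Longrightarrow> ideal J R"
  by (induction rule: regseq.induct) (auto simp: zeroideal adjoin_ideal)

lemma (in cring) regseq_subset:
  "regseq T n J \<Longrightarrow> ideal K R \<Longrightarrow> T \<subseteq> K \<Longrightarrow> J \<subseteq> K"
proof (induction rule: regseq.induct)
  case (Suc n J x)
  then show ?case using adjoin_least[of K J x] by blast
qed (simp add: ideal_zero)

text \<open>\<open>J\<close> is the contraction of its extension to the localization at
  \<open>M\<close>, expressed without fractions.\<close>

definition (in cring) saturated :: "'a set \<Rightarrow> 'a set \<Rightarrow> bool" where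
  "saturated M J \<longleftrightarrow> (\<forall>w\<in>carrier R - M. \<forall>f\<in>carrier R. w \<otimes> f \<in> J \<longrightarrow> f \<in> J)"

lemma (in cring) saturatedD:
  "saturated M J \<Longrightarrow> w \<in> carrier R - M \<Longrightarrow> f \<in> carrier R \<Longrightarrow> w \<otimes> f \<in> J \<Longrightarrow> f \<in> J"
  unfolding saturated_def by blast

text \<open>Shifting by one, with \<open>C 0\<close> trivial, makes \<open>cocycles k I\<close> modulo \<open>coboundaries k I\<close> compute
  \<open>Ext\<^sup>k(R/I, -)\<close> uniformly in \<open>k\<close>; injectivity of the terms enters only through \<open>lift\<close>. The
  element \<open>\<theta>\<close> generates the kernel of the augmented complex up to denominators outside \<open>M\<close>.\<close>

locale injective_complex = noetherian_cring R for R (structure) +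
  fixes C :: "nat \<Rightarrow> ('a, 'm) module" and d :: "nat \<Rightarrow> 'm \<Rightarrow> 'm" and M :: "'a set" and \<theta> :: 'm
  assumes module_C: "module R (C i)"
    and d_hom: "d i \<in> mod_hom R (C i) (C (Suc i))"
    and d_d: "e \<in> carrier (C i) \<Longrightarrow> d (Suc i) (d i e) = \<zero>\<^bsub>C (Suc (Suc i))\<^esub>"
    and lift: "\<lbrakk>ideal I R; f \<in> carrier R; e \<in> carrier (C i); \<And>r. r \<in> colon I f \<Longrightarrow> r \<odot>\<^bsub>C i\<^esub> e = \<zero>\<^bsub>C i\<^esub>\<rbrakk> \<Longrightarrow>
      \<exists>e'\<in>carrier (C i). (\<forall>r\<in>I. r \<odot>\<^bsub>C i\<^esub> e' = \<zero>\<^bsub>C i\<^esub>) \<and> f \<odot>\<^bsub>C i\<^esub> e' = e"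
    and exact: "\<lbrakk>0 < i; e \<in> carrier (C (Suc i)); d (Suc i) e = \<zero>\<^bsub>C (Suc (Suc i))\<^esub>\<rbrakk> \<Longrightarrow> e \<in> d i ` carrier (C i)"
    and bounded: "\<exists>n. \<forall>i>n. carrier (C i) = {\<zero>\<^bsub>C i\<^esub>}"
    and trivial: "carrier (C 0) = {\<zero>\<^bsub>C 0\<^esub>}"
    and maximal: "maximalideal M R"
    and exists_regular: "\<lbrakk>ideal I R; I \<noteq> carrier R;
        \<And>z. z \<in> carrier R \<Longrightarrow> (\<And>x. x \<in> M \<Longrightarrow> x \<otimes> z \<in> I) \<Longrightarrow> z \<in> I\<rbrakk> \<Longrightarrow> \<exists>x\<in>M. colon I x = I"
    and \<theta>_closed: "\<theta> \<in> carrier (C 1)" and \<theta>_ker: "d 1 \<theta> = \<zero>\<^bsub>C 2\<^esub>"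
    and \<theta>_generates: "\<lbrakk>e \<in> carrier (C 1); d 1 e = \<zero>\<^bsub>C 2\<^esub>\<rbrakk> \<Longrightarrow>
      \<exists>v\<in>carrier R - M. \<exists>u\<in>carrier R. v \<odot>\<^bsub>C 1\<^esub> e = u \<odot>\<^bsub>C 1\<^esub> \<theta>"
    and \<theta>_annihilator: "\<lbrakk>r \<in> carrier R; r \<odot>\<^bsub>C 1\<^esub> \<theta> = \<zero>\<^bsub>C 1\<^esub>\<rbrakk> \<Longrightarrow> \<exists>w\<in>carrier R - M. w \<otimes> r = \<zero>"
begin

sublocale C: module R "C i" for i by (rule module_C)

text \<open>This is Hom(R/I, C i), a homomorphism being given by the image of 1.\<close>

definition torsion :: "nat \<Rightarrow> 'a set \<Rightarrow> 'm set" where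
  "torsion i I = {e \<in> carrier (C i). \<forall>r\<in>I. r \<odot>\<^bsub>C i\<^esub> e = \<zero>\<^bsub>C i\<^esub>}"

definition cocycles :: "nat \<Rightarrow> 'a set \<Rightarrow> 'm set" where
  "cocycles k I = {e \<in> torsion (Suc k) I. d (Suc k) e = \<zero>\<^bsub>C (Suc (Suc k))\<^esub>}"

definition coboundaries :: "nat \<Rightarrow> 'a set \<Rightarrow> 'm set" where
  "coboundaries k I = d k ` torsion k I"

definition Ext_vanishes :: "nat \<Rightarrow> 'a set \<Rightarrow> bool" where
  "Ext_vanishes k I \<longleftrightarrow> cocycles k I \<subseteq> coboundaries k I"

text \<open>For each \<open>x\<close> one exponent \<open>N\<close> serves all cocycles at once.
  This uniformity is what can be played off against surjectivity of multiplication by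
  \<open>x\<close>.\<close>

definition Ext_torsion :: "nat \<Rightarrow> 'a set \<Rightarrow> bool" where
  "Ext_torsion k I \<longleftrightarrow> (\<forall>x\<in>M. \<exists>N::nat. \<forall>e\<in>cocycles k I. x [^] N \<odot>\<^bsub>C (Suc k)\<^esub> e \<in> coboundaries k I)"

lemma d_closed [simp]: "e \<in> carrier (C i) \<Longrightarrow> d i e \<in> carrier (C (Suc i))"
  using d_hom[of i] by (auto simp: mod_hom_def)

lemma d_add: "x \<in> carrier (C i) \<Longrightarrow> y \<in> carrier (C i) \<Longrightarrow> d i (x \<oplus>\<^bsub>C i\<^esub> y) = d i x \<oplus>\<^bsub>C (Suc i)\<^esub> d i y"
  using d_hom[of i] by (auto simp: mod_hom_def)

lemma d_smult: "r \<in> carrier R \<Longrightarrow> x \<in> carrier (C i) \<Longrightarrow> d i (r \<odot>\<^bsub>C i\<^esub> x) = r \<odot>\<^bsub>C (Suc i)\<^esub> d i x"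
  using d_hom[of i] by (auto simp: mod_hom_def)

lemma sub_eq: "x \<in> carrier (C i) \<Longrightarrow> y \<in> carrier (C i) \<Longrightarrow> x \<ominus>\<^bsub>C i\<^esub> y = x \<oplus>\<^bsub>C i\<^esub> (\<ominus> \<one>) \<odot>\<^bsub>C i\<^esub> y"
  by (simp add: C.smult_l_minus a_minus_def)

lemma d_sub: "x \<in> carrier (C i) \<Longrightarrow> y \<in> carrier (C i) \<Longrightarrow> d i (x \<ominus>\<^bsub>C i\<^esub> y) = d i x \<ominus>\<^bsub>C (Suc i)\<^esub> d i y"
  by (simp add: sub_eq d_add d_smult)

lemma d_zero [simp]: "d i \<zero>\<^bsub>C i\<^esub> = \<zero>\<^bsub>C (Suc i)\<^esub>"
  using d_smult[of \<zero> "\<zero>\<^bsub>C i\<^esub>" i] by simp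

lemma smult_sub:
  "r \<in> carrier R \<Longrightarrow> x \<in> carrier (C i) \<Longrightarrow> y \<in> carrier (C i) \<Longrightarrow>
    r \<odot>\<^bsub>C i\<^esub> (x \<ominus>\<^bsub>C i\<^esub> y) = r \<odot>\<^bsub>C i\<^esub> x \<ominus>\<^bsub>C i\<^esub> r \<odot>\<^bsub>C i\<^esub> y"
  by (simp add: a_minus_def C.smult_r_distr C.smult_r_minus)

lemma sub_zero_iff:
  "x \<in> carrier (C i) \<Longrightarrow> y \<in> carrier (C i) \<Longrightarrow> x \<ominus>\<^bsub>C i\<^esub> y = \<zero>\<^bsub>C i\<^esub> \<longleftrightarrow> x = y"
  by (metis C.M.a_inv_closed C.M.minus_equality C.M.minus_minus C.M.r_neg a_minus_def C.M.a_comm)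

lemma sub_zero [simp]: "x \<in> carrier (C i) \<Longrightarrow> x \<ominus>\<^bsub>C i\<^esub> \<zero>\<^bsub>C i\<^esub> = x"
  by (simp add: a_minus_def)

lemma sub_self [simp]: "x \<in> carrier (C i) \<Longrightarrow> x \<ominus>\<^bsub>C i\<^esub> x = \<zero>\<^bsub>C i\<^esub>"
  by (simp add: a_minus_def C.M.r_neg)

lemma sub_add_cancel:
  "x \<in> carrier (C i) \<Longrightarrow> y \<in> carrier (C i) \<Longrightarrow> (x \<ominus>\<^bsub>C i\<^esub> y) \<oplus>\<^bsub>C i\<^esub> y = x"
  by (simp add: a_minus_def C.M.a_assoc C.M.l_neg)

lemma zero_sub_zero_sub:
  "x \<in> carrier (C i) \<Longrightarrow> \<zero>\<^bsub>C i\<^esub> \<ominus>\<^bsub>C i\<^esub> (\<zero>\<^bsub>C i\<^esub> \<ominus>\<^bsub>C i\<^esub> x) = x"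
  by (simp add: a_minus_def)

lemma smult_comm:
  "r \<in> carrier R \<Longrightarrow> s \<in> carrier R \<Longrightarrow> x \<in> carrier (C i) \<Longrightarrow>
    r \<odot>\<^bsub>C i\<^esub> (s \<odot>\<^bsub>C i\<^esub> x) = s \<odot>\<^bsub>C i\<^esub> (r \<odot>\<^bsub>C i\<^esub> x)"
  by (simp flip: C.smult_assoc1 add: m_comm)

lemma torsion_carrier: "e \<in> torsion i I \<Longrightarrow> e \<in> carrier (C i)"
  by (simp add: torsion_def)

lemma torsion_add: "ideal I R \<Longrightarrow> x \<in> torsion i I \<Longrightarrow> y \<in> torsion i I \<Longrightarrow> x \<oplus>\<^bsub>C i\<^esub> y \<in> torsion i I"
  by (auto simp: torsion_def C.smult_r_distr ideal_carr)

lemma torsion_smult: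
  assumes "ideal I R" "r \<in> carrier R" "x \<in> torsion i I"
  shows "r \<odot>\<^bsub>C i\<^esub> x \<in> torsion i I"
  using assms smult_comm[of _ r x i] by (auto simp: torsion_def ideal_carr[OF assms(1)])

lemma torsion_sub:
  assumes "ideal I R" "x \<in> torsion i I" "y \<in> torsion i I"
  shows "x \<ominus>\<^bsub>C i\<^esub> y \<in> torsion i I"
  using sub_eq[OF assms(2,3)[THEN torsion_carrier]] torsion_add[OF assms(1,2)]
    torsion_smult[OF assms(1) _ assms(3), of "\<ominus> \<one>"] by simp

lemma torsion_mono: "I \<subseteq> K \<Longrightarrow> torsion i K \<subseteq> torsion i I"
  by (auto simp: torsion_def)

lemma torsion_d:
  assumes "ideal I R" "x \<in> torsion i I"
  shows "d i x \<in> torsion (Suc i) I"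
proof -
  have "r \<odot>\<^bsub>C (Suc i)\<^esub> d i x = \<zero>\<^bsub>C (Suc i)\<^esub>" if "r \<in> I" for r
    using d_smult[of r x i] ideal_carr[OF assms(1) that] that assms(2) by (simp add: torsion_def)
  then show ?thesis using assms(2) by (simp add: torsion_def)
qed

lemma torsion_zero: "ideal I R \<Longrightarrow> \<zero>\<^bsub>C i\<^esub> \<in> torsion i I"
  by (auto simp: torsion_def ideal_carr)

lemma torsion_adjoin:
  assumes "ideal I R" "f \<in> carrier R"
  shows "e \<in> torsion i (adjoin I f) \<longleftrightarrow> e \<in> torsion i I \<and> f \<odot>\<^bsub>C i\<^esub> e = \<zero>\<^bsub>C i\<^esub>"
proof
  assume "e \<in> torsion i (adjoin I f)"
  then show "e \<in> torsion i I \<and> f \<odot>\<^bsub>C i\<^esub> e = \<zero>\<^bsub>C i\<^esub>"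
    using adjoin_incl[OF assms] adjoin_mem[OF assms] by (auto simp: torsion_def)
next
  assume e: "e \<in> torsion i I \<and> f \<odot>\<^bsub>C i\<^esub> e = \<zero>\<^bsub>C i\<^esub>"
  then show "e \<in> torsion i (adjoin I f)"
    using assms by (auto simp: torsion_def C.smult_l_distr C.smult_assoc1 ideal_carr elim!: adjoinE)
qed

lemma torsion_smult_colon:
  assumes "f \<in> carrier R" "e \<in> torsion i I"
  shows "f \<odot>\<^bsub>C i\<^esub> e \<in> torsion i (colon I f)"
  using assms by (auto simp: torsion_def colon_def C.smult_assoc1[symmetric])

text \<open>Multiplication by \<open>f\<close> embeds \<open>R/(I : f)\<close> into
  \<open>R/I\<close>, and homomorphisms into an injective module extend along it.\<close>

lemma torsion_lift:
  assumes "ideal I R" "f \<in> carrier R" "e \<in> torsion i (colon I f)"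
  obtains e' where "e' \<in> torsion i I" "f \<odot>\<^bsub>C i\<^esub> e' = e"
  using lift[OF assms(1,2), of e i] assms(3) by (auto simp: torsion_def)

lemma torsion_carrier_ring: "torsion i (carrier R) = {\<zero>\<^bsub>C i\<^esub>}"
proof -
  have "e = \<zero>\<^bsub>C i\<^esub>" if "e \<in> torsion i (carrier R)" for e
    using that C.smult_one[of e i] one_closed by (auto simp: torsion_def simp del: C.smult_one)
  then show ?thesis using torsion_zero[OF oneideal] by auto
qed

lemma cocyclesI: "e \<in> torsion (Suc k) I \<Longrightarrow> d (Suc k) e = \<zero>\<^bsub>C (Suc (Suc k))\<^esub> \<Longrightarrow> e \<in> cocycles k I"
  by (simp add: cocycles_def)

lemma cocyclesD:
  assumes "e \<in> cocycles k I"
  shows "e \<in> torsion (Suc k) I" "d (Suc k) e = \<zero>\<^bsub>C (Suc (Suc k))\<^esub>" "e \<in> carrier (C (Suc k))"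
  using assms by (auto simp: cocycles_def torsion_def)

lemma cocycles_mono: "I \<subseteq> K \<Longrightarrow> cocycles k K \<subseteq> cocycles k I"
  using torsion_mono[of I K "Suc k"] by (auto simp: cocycles_def)

lemma cocycles_smult_colon:
  "f \<in> carrier R \<Longrightarrow> e \<in> cocycles k I \<Longrightarrow> f \<odot>\<^bsub>C (Suc k)\<^esub> e \<in> cocycles k (colon I f)"
  by (auto simp: cocycles_def torsion_smult_colon d_smult torsion_carrier)

lemma coboundariesE:
  assumes "e \<in> coboundaries k I"
  obtains w where "w \<in> torsion k I" "w \<in> carrier (C k)" "d k w = e"
  using assms by (auto simp: coboundaries_def torsion_def)

lemma coboundariesI: "w \<in> torsion k I \<Longrightarrow> d k w \<in> coboundaries k I"
  by (simp add: coboundaries_def)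

lemma coboundaries_carrier: "e \<in> coboundaries k I \<Longrightarrow> e \<in> carrier (C (Suc k))"
  by (auto elim: coboundariesE)

lemma coboundaries_smult:
  assumes "ideal I R" "r \<in> carrier R" "e \<in> coboundaries k I"
  shows "r \<odot>\<^bsub>C (Suc k)\<^esub> e \<in> coboundaries k I"
proof -
  obtain w where "w \<in> torsion k I" "w \<in> carrier (C k)" "d k w = e" using coboundariesE[OF assms(3)] .
  then show ?thesis
    using coboundariesI[OF torsion_smult[OF assms(1,2)], of w k] d_smult[OF assms(2), of w k] by simp
qed

lemma coboundaries_add:
  assumes "ideal I R" "x \<in> coboundaries k I" "y \<in> coboundaries k I"
  shows "x \<oplus>\<^bsub>C (Suc k)\<^esub> y \<in> coboundaries k I"
proof -
  obtain w where "w \<in> torsion k I" "w \<in> carrier (C k)" "d k w = x" using coboundariesE[OF assms(2)] .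
  moreover obtain v where "v \<in> torsion k I" "v \<in> carrier (C k)" "d k v = y" using coboundariesE[OF assms(3)] .
  ultimately show ?thesis using coboundariesI[OF torsion_add[OF assms(1)], of w k v] by (simp add: d_add)
qed

lemma coboundaries_sub:
  assumes "ideal I R" "x \<in> coboundaries k I" "y \<in> coboundaries k I"
  shows "x \<ominus>\<^bsub>C (Suc k)\<^esub> y \<in> coboundaries k I"
  using sub_eq[OF assms(2,3)[THEN coboundaries_carrier]] coboundaries_add[OF assms(1,2)]
    coboundaries_smult[OF assms(1) _ assms(3), of "\<ominus> \<one>"] by simp

lemma coboundaries_mono: "I \<subseteq> K \<Longrightarrow> coboundaries k K \<subseteq> coboundaries k I"
  using torsion_mono[of I K k] by (auto simp: coboundaries_def)

lemma Ext_vanishesE: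
  assumes "Ext_vanishes k I" "e \<in> cocycles k I"
  obtains w where "w \<in> torsion k I" "w \<in> carrier (C k)" "d k w = e"
  using assms by (auto simp: Ext_vanishes_def elim: coboundariesE)

lemma Ext_vanishes_carrier: "Ext_vanishes k (carrier R)"
  using torsion_carrier_ring by (auto simp: Ext_vanishes_def cocycles_def coboundaries_def)

lemma Ext_vanishes_zero: "0 < k \<Longrightarrow> Ext_vanishes k {\<zero>}"
  using exact[of k] by (force simp: Ext_vanishes_def cocycles_def coboundaries_def torsion_def)

lemma d_sub_coboundary:
  assumes "\<eta> \<in> carrier (C (Suc k))" "w \<in> carrier (C k)"
  shows "d (Suc k) (\<eta> \<ominus>\<^bsub>C (Suc k)\<^esub> d k w) = d (Suc k) \<eta>"
  using assms by (simp add: d_sub d_d)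

text \<open>The next four lemmas are exactness of
  \<open>Ext\<^sup>k(R/(I + f)) \<rightarrow> Ext\<^sup>k(R/I) \<rightarrow> Ext\<^sup>k(R/(I : f)) \<rightarrow> Ext\<^sup>k\<^sup>+\<^sup>1(R/(I + f)) \<rightarrow> Ext\<^sup>k\<^sup>+\<^sup>1(R/I)\<close>.\<close>

lemma Ext_colon_surj:
  assumes I: "ideal I R" and f: "f \<in> carrier R"
    and v: "Ext_vanishes (Suc k) (adjoin I f)" and z: "z \<in> cocycles k (colon I f)"
  obtains \<xi> where "\<xi> \<in> cocycles k I" "f \<odot>\<^bsub>C (Suc k)\<^esub> \<xi> = z"
proof -
  note z' = cocyclesD[OF z]
  obtain \<eta> where \<eta>: "\<eta> \<in> torsion (Suc k) I" "f \<odot>\<^bsub>C (Suc k)\<^esub> \<eta> = z" using torsion_lift[OF I f z'(1)] .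
  have \<eta>c: "\<eta> \<in> carrier (C (Suc k))" using torsion_carrier[OF \<eta>(1)] .
  have "f \<odot>\<^bsub>C (Suc (Suc k))\<^esub> d (Suc k) \<eta> = \<zero>\<^bsub>C (Suc (Suc k))\<^esub>"
    using d_smult[OF f \<eta>c] \<eta>(2) z'(2) by simp
  \<comment> \<open>The connecting homomorphism: \<open>d \<eta>\<close> represents the image of
    \<open>z\<close> in Ext^(k+1)(R/(I + f)), and its vanishing corrects \<open>\<eta>\<close> to a
    cocycle.\<close>
  then have "d (Suc k) \<eta> \<in> cocycles (Suc k) (adjoin I f)"
    using torsion_d[OF I \<eta>(1)] d_d[OF \<eta>c] by (simp add: cocycles_def torsion_adjoin[OF I f])
  then obtain \<eta>' where \<eta>': "\<eta>' \<in> torsion (Suc k) (adjoin I f)" "\<eta>' \<in> carrier (C (Suc k))"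
      "d (Suc k) \<eta>' = d (Suc k) \<eta>" using Ext_vanishesE[OF v] by blast
  show thesis
  proof (rule that)
    show "\<eta> \<ominus>\<^bsub>C (Suc k)\<^esub> \<eta>' \<in> cocycles k I"
      using \<eta>' \<eta>c torsion_sub[OF I \<eta>(1)] by (simp add: cocycles_def torsion_adjoin[OF I f] d_sub sub_zero_iff)
    show "f \<odot>\<^bsub>C (Suc k)\<^esub> (\<eta> \<ominus>\<^bsub>C (Suc k)\<^esub> \<eta>') = z"
      using \<eta>' \<eta>c \<eta>(2) f z'(3) by (simp add: smult_sub torsion_adjoin[OF I f])
  qed
qed

lemma Ext_vanishes_middle:
  assumes I: "ideal I R" and f: "f \<in> carrier R"
    and v1: "Ext_vanishes k (adjoin I f)" and v2: "Ext_vanishes k (colon I f)"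
  shows "Ext_vanishes k I"
  unfolding Ext_vanishes_def
proof
  fix e assume e: "e \<in> cocycles k I"
  note e' = cocyclesD[OF e]
  obtain w where w: "w \<in> torsion k (colon I f)" "w \<in> carrier (C k)" "d k w = f \<odot>\<^bsub>C (Suc k)\<^esub> e"
    using Ext_vanishesE[OF v2 cocycles_smult_colon[OF f e]] .
  obtain w' where w': "w' \<in> torsion k I" "f \<odot>\<^bsub>C k\<^esub> w' = w" using torsion_lift[OF I f w(1)] .
  have w'c: "w' \<in> carrier (C k)" using torsion_carrier[OF w'(1)] .
  \<comment> \<open>A lift \<open>w'\<close> of \<open>w\<close> along \<open>f\<close> corrects
    \<open>e\<close> by a coboundary, after which it is killed by \<open>f\<close> too.\<close>
  have "e \<ominus>\<^bsub>C (Suc k)\<^esub> d k w' \<in> cocycles k (adjoin I f)"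
  proof (rule cocyclesI)
    have "f \<odot>\<^bsub>C (Suc k)\<^esub> (e \<ominus>\<^bsub>C (Suc k)\<^esub> d k w') = \<zero>\<^bsub>C (Suc k)\<^esub>"
      using e'(3) w'c f w(3) d_smult[OF f w'c] w'(2) by (simp add: smult_sub sub_zero_iff)
    then show "e \<ominus>\<^bsub>C (Suc k)\<^esub> d k w' \<in> torsion (Suc k) (adjoin I f)"
      using torsion_sub[OF I e'(1) torsion_d[OF I w'(1)]] by (simp add: torsion_adjoin[OF I f])
    show "d (Suc k) (e \<ominus>\<^bsub>C (Suc k)\<^esub> d k w') = \<zero>\<^bsub>C (Suc (Suc k))\<^esub>"
      using d_sub_coboundary[OF e'(3) w'c] e'(2) by simp
  qed
  then have "e \<ominus>\<^bsub>C (Suc k)\<^esub> d k w' \<in> coboundaries k I"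
    using v1 coboundaries_mono[OF adjoin_incl[OF I f]] by (auto simp: Ext_vanishes_def)
  then have "(e \<ominus>\<^bsub>C (Suc k)\<^esub> d k w') \<oplus>\<^bsub>C (Suc k)\<^esub> d k w' \<in> coboundaries k I"
    using coboundaries_add[OF I] coboundariesI[OF w'(1)] by blast
  then show "e \<in> coboundaries k I" using e'(3) w'c by (simp add: sub_add_cancel)
qed

lemma Ext_vanishes_adjoin:
  assumes I: "ideal I R" and f: "f \<in> carrier R"
    and v1: "Ext_vanishes k (colon I f)" and v2: "Ext_vanishes (Suc k) I"
  shows "Ext_vanishes (Suc k) (adjoin I f)"
  unfolding Ext_vanishes_def
proof
  fix e assume e: "e \<in> cocycles (Suc k) (adjoin I f)"
  note e' = cocyclesD[OF e]
  have fe: "f \<odot>\<^bsub>C (Suc (Suc k))\<^esub> e = \<zero>\<^bsub>C (Suc (Suc k))\<^esub>" using e'(1) torsion_adjoin[OF I f] by blast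
  obtain \<eta> where \<eta>: "\<eta> \<in> torsion (Suc k) I" "\<eta> \<in> carrier (C (Suc k))" "d (Suc k) \<eta> = e"
    using Ext_vanishesE[OF v2] cocycles_mono[OF adjoin_incl[OF I f]] e by blast
  have "f \<odot>\<^bsub>C (Suc k)\<^esub> \<eta> \<in> cocycles k (colon I f)"
    using torsion_smult_colon[OF f \<eta>(1)] fe \<eta> f by (simp add: cocycles_def d_smult)
  then obtain w where w: "w \<in> torsion k (colon I f)" "w \<in> carrier (C k)" "d k w = f \<odot>\<^bsub>C (Suc k)\<^esub> \<eta>"
    using Ext_vanishesE[OF v1] by blast
  obtain w' where w': "w' \<in> torsion k I" "f \<odot>\<^bsub>C k\<^esub> w' = w" using torsion_lift[OF I f w(1)] .
  have w'c: "w' \<in> carrier (C k)" using torsion_carrier[OF w'(1)] .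
  have "f \<odot>\<^bsub>C (Suc k)\<^esub> (\<eta> \<ominus>\<^bsub>C (Suc k)\<^esub> d k w') = \<zero>\<^bsub>C (Suc k)\<^esub>"
    using \<eta>(2) w'c f w(3) d_smult[OF f w'c] w'(2) by (simp add: smult_sub sub_zero_iff)
  then have "\<eta> \<ominus>\<^bsub>C (Suc k)\<^esub> d k w' \<in> torsion (Suc k) (adjoin I f)"
    using torsion_sub[OF I \<eta>(1) torsion_d[OF I w'(1)]] by (simp add: torsion_adjoin[OF I f])
  then show "e \<in> coboundaries (Suc k) (adjoin I f)"
    using coboundariesI[of "\<eta> \<ominus>\<^bsub>C (Suc k)\<^esub> d k w'" "Suc k" "adjoin I f"]
      d_sub_coboundary[OF \<eta>(2) w'c] \<eta>(3) by simp
qed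

lemma Ext_vanishes_colon:
  assumes I: "ideal I R" and f: "f \<in> carrier R"
    and v1: "Ext_vanishes (Suc k) (adjoin I f)" and v2: "Ext_vanishes k I"
  shows "Ext_vanishes k (colon I f)"
  unfolding Ext_vanishes_def
proof
  fix z assume z: "z \<in> cocycles k (colon I f)"
  obtain \<xi> where \<xi>: "\<xi> \<in> cocycles k I" "f \<odot>\<^bsub>C (Suc k)\<^esub> \<xi> = z" using Ext_colon_surj[OF I f v1 z] .
  obtain w where w: "w \<in> torsion k I" "w \<in> carrier (C k)" "d k w = \<xi>" using Ext_vanishesE[OF v2 \<xi>(1)] .
  show "z \<in> coboundaries k (colon I f)"
    using coboundariesI[OF torsion_smult_colon[OF f w(1)]] d_smult[OF f w(2)] w(3) \<xi>(2) by simp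
qed

lemma maximal_ideal: "ideal M R"
  using maximal maximalideal.axioms(1) by blast

text \<open>A substitute for Bass's lemma: instead of applying Nakayama's lemma to \<open>Ext\<^sup>j(R/I)\<close>, whose
  finite generation is not visible on an injective resolution, one uses that it is killed by powers
  of the elements of \<open>M\<close>.\<close>

lemma Ext_vanishes_if_torsion:
  assumes "ideal I R" and vM: "\<And>i. n < i \<Longrightarrow> Ext_vanishes i M"
  shows "\<forall>j. n < j \<longrightarrow> (\<forall>i>j. Ext_vanishes i I) \<longrightarrow> Ext_torsion j I \<longrightarrow> Ext_vanishes j I"
  using assms(1)
proof (induction rule: noetherian_induct)
  case (step I)
  show ?case
  proof (intro allI impI)
    fix j assume j: "n < j" and above: "\<forall>i>j. Ext_vanishes i I" and tors: "Ext_torsion j I"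
    \<comment> \<open>Zero module, depth zero with a socle element \<open>f\<close>, or positive
      depth.\<close>
    consider "I = carrier R"
      | f where "f \<in> carrier R" "f \<notin> I" "\<And>x. x \<in> M \<Longrightarrow> x \<otimes> f \<in> I"
      | "I \<noteq> carrier R" "\<And>z. z \<in> carrier R \<Longrightarrow> (\<And>x. x \<in> M \<Longrightarrow> x \<otimes> z \<in> I) \<Longrightarrow> z \<in> I"
      by blast
    then show "Ext_vanishes j I"
    proof cases
      case 1
      then show ?thesis using Ext_vanishes_carrier by simp
    next
      case (2 f)
      have cM: "colon I f = M" by (rule colon_eq_maximalideal[OF maximal step(1) 2])
      have adj: "ideal (adjoin I f) R" "I \<subset> adjoin I f"
        using adjoin_ideal[OF step(1) 2(1)] adjoin_strict[OF step(1) 2(1,2)] by auto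
      have "Ext_vanishes i (adjoin I f)" if i: "j < i" for i
      proof (cases i)
        case (Suc k)
        then show ?thesis using Ext_vanishes_adjoin[OF step(1) 2(1), of k] vM[of k] cM above i j by simp
      qed (use i in simp)
      moreover have "Ext_torsion j (adjoin I f)"
        unfolding Ext_torsion_def
      proof
        fix x assume x: "x \<in> M"
        then have xc: "x \<in> carrier R" using ideal_carr[OF maximal_ideal] by blast
        obtain N where N: "\<And>e. e \<in> cocycles j I \<Longrightarrow> x [^] (N::nat) \<odot>\<^bsub>C (Suc j)\<^esub> e \<in> coboundaries j I"
          using tors x unfolding Ext_torsion_def by blast
        show "\<exists>N::nat. \<forall>e\<in>cocycles j (adjoin I f). x [^] N \<odot>\<^bsub>C (Suc j)\<^esub> e \<in> coboundaries j (adjoin I f)"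
        proof (intro exI ballI)
          fix e assume e: "e \<in> cocycles j (adjoin I f)"
          then have eI: "e \<in> cocycles j I" using cocycles_mono[OF adjoin_incl[OF step(1) 2(1)]] by blast
          obtain w where w: "w \<in> torsion j I" "w \<in> carrier (C j)" "d j w = x [^] N \<odot>\<^bsub>C (Suc j)\<^esub> e"
            using coboundariesE[OF N[OF eI]] .
          \<comment> \<open>\<open>f w\<close> is killed by \<open>I : f = M\<close>, so one more
            factor \<open>x\<close> makes the bounding element torsion for \<open>I + f\<close>;
            hence the exponent \<open>Suc N\<close>.\<close>
          have "x \<odot>\<^bsub>C j\<^esub> (f \<odot>\<^bsub>C j\<^esub> w) = \<zero>\<^bsub>C j\<^esub>"
            using torsion_smult_colon[OF 2(1) w(1)] cM x by (simp add: torsion_def)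
          then have "x \<odot>\<^bsub>C j\<^esub> w \<in> torsion j (adjoin I f)"
            using torsion_smult[OF step(1) xc w(1)] smult_comm[OF 2(1) xc w(2)]
            by (simp add: torsion_adjoin[OF step(1) 2(1)])
          moreover have "d j (x \<odot>\<^bsub>C j\<^esub> w) = x [^] Suc N \<odot>\<^bsub>C (Suc j)\<^esub> e"
            using d_smult[OF xc w(2)] w(3) xc cocyclesD(3)[OF e]
            by (simp add: C.smult_assoc1[symmetric] m_comm)
          ultimately show "x [^] Suc N \<odot>\<^bsub>C (Suc j)\<^esub> e \<in> coboundaries j (adjoin I f)"
            by (metis coboundariesI)
        qed
      qed
      ultimately have "Ext_vanishes j (adjoin I f)" using step(2)[OF adj] j by blast
      then show ?thesis using Ext_vanishes_middle[OF step(1) 2(1)] vM[OF j] cM by simp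
    next
      case 3
      obtain x where x: "x \<in> M" "colon I x = I" using exists_regular[OF step(1) 3] by blast
      have xc: "x \<in> carrier R" using x ideal_carr[OF maximal_ideal] by blast
      have "x \<notin> I" using colon_eq_carrier[OF step(1), of x] x 3(1) by blast
      then have adj: "ideal (adjoin I x) R" "I \<subset> adjoin I x"
        using adjoin_ideal[OF step(1) xc] adjoin_strict[OF step(1) xc] by auto
      \<comment> \<open>The induction hypothesis for \<open>I + x\<close> is applied one degree
        higher, which is why \<open>j\<close> is quantified inside the induction.\<close>
      have "Ext_vanishes i (adjoin I x)" if i: "Suc j < i" for i
      proof (cases i)
        case (Suc k)
        then show ?thesis using Ext_vanishes_adjoin[OF step(1) xc, of k] x(2) above i by simp
      qed (use i in simp)
      moreover have "Ext_torsion (Suc j) (adjoin I x)"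
        unfolding Ext_torsion_def
      proof
        fix z assume z: "z \<in> M"
        then have zc: "z \<in> carrier R" using ideal_carr[OF maximal_ideal] by blast
        obtain N where N: "\<And>e. e \<in> cocycles j I \<Longrightarrow> z [^] (N::nat) \<odot>\<^bsub>C (Suc j)\<^esub> e \<in> coboundaries j I"
          using tors z unfolding Ext_torsion_def by blast
        have zN: "z [^] N \<in> carrier R" using zc by simp
        show "\<exists>N::nat. \<forall>e\<in>cocycles (Suc j) (adjoin I x).
          z [^] N \<odot>\<^bsub>C (Suc (Suc j))\<^esub> e \<in> coboundaries (Suc j) (adjoin I x)"
        proof (intro exI ballI)
          fix e assume e: "e \<in> cocycles (Suc j) (adjoin I x)"
          have xe: "x \<odot>\<^bsub>C (Suc (Suc j))\<^esub> e = \<zero>\<^bsub>C (Suc (Suc j))\<^esub>"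
            using cocyclesD(1)[OF e] torsion_adjoin[OF step(1) xc] by blast
          have "e \<in> cocycles (Suc j) I" using e cocycles_mono[OF adjoin_incl[OF step(1) xc]] by blast
          then obtain \<eta> where \<eta>: "\<eta> \<in> torsion (Suc j) I" "\<eta> \<in> carrier (C (Suc j))" "d (Suc j) \<eta> = e"
            using above Ext_vanishesE[of "Suc j" I e] by blast
          \<comment> \<open>Since Ext^(j+1)(R/I) vanishes, the connecting map from Ext^j(R/I) to
            Ext^(j+1)(R/(I + x)) is onto; \<open>x \<eta>\<close> is a preimage of \<open>e\<close>,
            and so the exponent \<open>N\<close> carries over.\<close>
          have "x \<odot>\<^bsub>C (Suc j)\<^esub> \<eta> \<in> cocycles j I"
            using torsion_smult[OF step(1) xc \<eta>(1)] d_smult[OF xc \<eta>(2)] \<eta>(3) xe by (simp add: cocycles_def)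
          then obtain w where w: "w \<in> torsion j I" "w \<in> carrier (C j)"
              "d j w = z [^] N \<odot>\<^bsub>C (Suc j)\<^esub> (x \<odot>\<^bsub>C (Suc j)\<^esub> \<eta>)"
            using coboundariesE[OF N] by blast
          obtain w' where w': "w' \<in> torsion j I" "x \<odot>\<^bsub>C j\<^esub> w' = w"
            using torsion_lift[OF step(1) xc, of w j] w(1) x(2) by auto
          have w'c: "w' \<in> carrier (C j)" using torsion_carrier[OF w'(1)] .
          let ?\<eta> = "z [^] N \<odot>\<^bsub>C (Suc j)\<^esub> \<eta>"
          have "x \<odot>\<^bsub>C (Suc j)\<^esub> (?\<eta> \<ominus>\<^bsub>C (Suc j)\<^esub> d j w') = \<zero>\<^bsub>C (Suc j)\<^esub>"
            using \<eta>(2) w'c xc zN w(3) d_smult[OF xc w'c] w'(2) smult_comm[OF xc zN \<eta>(2)]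
            by (simp add: smult_sub sub_zero_iff)
          then have "?\<eta> \<ominus>\<^bsub>C (Suc j)\<^esub> d j w' \<in> torsion (Suc j) (adjoin I x)"
            using torsion_sub[OF step(1) torsion_smult[OF step(1) zN \<eta>(1)] torsion_d[OF step(1) w'(1)]]
            by (simp add: torsion_adjoin[OF step(1) xc])
          moreover have "d (Suc j) (?\<eta> \<ominus>\<^bsub>C (Suc j)\<^esub> d j w') = z [^] N \<odot>\<^bsub>C (Suc (Suc j))\<^esub> e"
            using d_sub_coboundary[OF C.smult_closed[OF zN \<eta>(2)] w'c] d_smult[OF zN \<eta>(2)] \<eta>(3) by simp
          ultimately show "z [^] N \<odot>\<^bsub>C (Suc (Suc j))\<^esub> e \<in> coboundaries (Suc j) (adjoin I x)"
            by (metis coboundariesI)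
        qed
      qed
      ultimately have vS: "Ext_vanishes (Suc j) (adjoin I x)" using step(2)[OF adj] j by (meson less_SucI)
      obtain N where N: "\<And>e. e \<in> cocycles j I \<Longrightarrow> x [^] (N::nat) \<odot>\<^bsub>C (Suc j)\<^esub> e \<in> coboundaries j I"
        using tors x(1) unfolding Ext_torsion_def by blast
      \<comment> \<open>As Ext^(j+1)(R/(I + x)) is zero, multiplication by \<open>x\<close> is onto
        on Ext^j(R/I). Its \<open>N\<close>-th iterate is then both onto and zero.\<close>
      have "\<exists>\<xi>\<in>cocycles j I. x [^] (N::nat) \<odot>\<^bsub>C (Suc j)\<^esub> \<xi> = z" if "z \<in> cocycles j I" for z N
        using that
      proof (induction N arbitrary: z)
        case 0
        then show ?case using cocyclesD(3) by (intro bexI[of _ z]) auto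
      next
        case (Suc N)
        obtain \<xi> where \<xi>: "\<xi> \<in> cocycles j I" "x [^] N \<odot>\<^bsub>C (Suc j)\<^esub> \<xi> = z" using Suc by blast
        obtain \<zeta> where \<zeta>: "\<zeta> \<in> cocycles j I" "x \<odot>\<^bsub>C (Suc j)\<^esub> \<zeta> = \<xi>"
          using Ext_colon_surj[OF step(1) xc vS, of \<xi>] \<xi>(1) x(2) by auto
        have "x [^] Suc N \<odot>\<^bsub>C (Suc j)\<^esub> \<zeta> = z"
          using \<zeta> \<xi>(2) xc cocyclesD(3)[OF \<zeta>(1)] by (simp add: C.smult_assoc1)
        then show ?case using \<zeta>(1) by blast
      qed
      then show ?thesis using N unfolding Ext_vanishes_def by (metis subsetI)
    qed
  qed
qed

text \<open>Like a module of projective dimension at most \<open>n\<close>: each further entry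
  raises the last possibly nonzero degree by at most one.\<close>

lemma Ext_vanishes_regseq: "regseq T n J \<Longrightarrow> n < k \<Longrightarrow> Ext_vanishes k J"
proof (induction arbitrary: k rule: regseq.induct)
  case zero
  then show ?case using Ext_vanishes_zero by simp
next
  case (Suc n J x)
  obtain k' where k': "k = Suc k'" using Suc.prems by (cases k) auto
  show ?case
    using Ext_vanishes_adjoin[OF regseq_ideal[OF Suc.hyps(1)] Suc.hyps(3), of k'] Suc k' by simp
qed

text \<open>Depth bounds the injective dimension. Descending from the end of the complex, use 0 ->
  R/M -> R/J -> R/(J + s) -> 0: as Ext^(m+2)(R/J) is zero, Ext^(m+2)(R/(J + s)) is a quotient of
  Ext^(m+1)(R/M), hence killed by \<open>M\<close>, hence zero by
  \<open>Ext_vanishes_if_torsion\<close>. Then Ext^(m+1)(R/M) lies between two zero groups.\<close>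

lemma Ext_vanishes_above_depth:
  assumes J: "regseq T n J" and s: "s \<in> carrier R" "s \<notin> J" "\<And>x. x \<in> M \<Longrightarrow> x \<otimes> s \<in> J"
    and k: "n < k"
  shows "Ext_vanishes k M"
proof -
  have JI: "ideal J R" using regseq_ideal[OF J] .
  have cM: "colon J s = M" by (rule colon_eq_maximalideal[OF maximal JI s])
  obtain b where b: "\<And>i. b < i \<Longrightarrow> carrier (C i) = {\<zero>\<^bsub>C i\<^esub>}" using bounded by blast
  \<comment> \<open>Cocycles of degree \<open>i\<close> live in \<open>C (Suc i)\<close>, so the
    bound already serves at \<open>i = b\<close>.\<close>
  have top: "Ext_vanishes i M" if "b \<le> i" for i
  proof -
    have "cocycles i M \<subseteq> {d i \<zero>\<^bsub>C i\<^esub>}"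
      using b[of "Suc i"] that by (auto simp: cocycles_def torsion_def)
    then show ?thesis
      using coboundariesI[OF torsion_zero[OF maximal_ideal, of i]] by (auto simp: Ext_vanishes_def)
  qed
  have "\<forall>i>m. Ext_vanishes i M" if m: "n \<le> m" "m \<le> max n b" for m
    using m(2,1)
  proof (induction rule: inc_induct)
    case base
    then show ?case using top by simp
  next
    case (step m)
    then have above: "\<And>i. Suc m < i \<Longrightarrow> Ext_vanishes i M" by simp
    have adj: "ideal (adjoin J s) R" using adjoin_ideal[OF JI s(1)] .
    have "Ext_vanishes i (adjoin J s)" if i: "Suc (Suc m) < i" for i
    proof (cases i)
      case (Suc k)
      then show ?thesis
        using Ext_vanishes_adjoin[OF JI s(1), of k] above[of k] cM Ext_vanishes_regseq[OF J, of i] i step.prems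
        by simp
    qed (use i in simp)
    moreover have "Ext_torsion (Suc (Suc m)) (adjoin J s)"
      unfolding Ext_torsion_def
    proof
      fix x assume x: "x \<in> M"
      then have xc: "x \<in> carrier R" using ideal_carr[OF maximal_ideal] by blast
      show "\<exists>N::nat. \<forall>e\<in>cocycles (Suc (Suc m)) (adjoin J s).
        x [^] N \<odot>\<^bsub>C (Suc (Suc (Suc m)))\<^esub> e \<in> coboundaries (Suc (Suc m)) (adjoin J s)"
      proof (intro exI ballI)
        fix e assume e: "e \<in> cocycles (Suc (Suc m)) (adjoin J s)"
        have se: "s \<odot>\<^bsub>C (Suc (Suc (Suc m)))\<^esub> e = \<zero>\<^bsub>C (Suc (Suc (Suc m)))\<^esub>"
          using cocyclesD(1)[OF e] torsion_adjoin[OF JI s(1)] by blast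
        have "e \<in> cocycles (Suc (Suc m)) J" using e cocycles_mono[OF adjoin_incl[OF JI s(1)]] by blast
        then obtain \<eta> where \<eta>: "\<eta> \<in> torsion (Suc (Suc m)) J" "\<eta> \<in> carrier (C (Suc (Suc m)))"
            "d (Suc (Suc m)) \<eta> = e"
          using Ext_vanishesE[OF Ext_vanishes_regseq[OF J]] step.prems by (metis le_imp_less_Suc less_SucI)
        have "x \<odot>\<^bsub>C (Suc (Suc m))\<^esub> (s \<odot>\<^bsub>C (Suc (Suc m))\<^esub> \<eta>) = \<zero>\<^bsub>C (Suc (Suc m))\<^esub>"
          using torsion_smult_colon[OF s(1) \<eta>(1)] cM x by (simp add: torsion_def)
        then have "x \<odot>\<^bsub>C (Suc (Suc m))\<^esub> \<eta> \<in> torsion (Suc (Suc m)) (adjoin J s)"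
          using torsion_smult[OF JI xc \<eta>(1)] smult_comm[OF s(1) xc \<eta>(2)]
          by (simp add: torsion_adjoin[OF JI s(1)])
        then show "x [^] (1::nat) \<odot>\<^bsub>C (Suc (Suc (Suc m)))\<^esub> e \<in> coboundaries (Suc (Suc m)) (adjoin J s)"
          using coboundariesI[of "x \<odot>\<^bsub>C (Suc (Suc m))\<^esub> \<eta>" "Suc (Suc m)"] d_smult[OF xc \<eta>(2)] \<eta>(3) xc by simp
      qed
    qed
    ultimately have "Ext_vanishes (Suc (Suc m)) (adjoin J s)"
      using Ext_vanishes_if_torsion[OF adj above] by blast
    then have "Ext_vanishes (Suc m) M"
      using Ext_vanishes_colon[OF JI s(1), of "Suc m"] Ext_vanishes_regseq[OF J, of "Suc m"] cM step.prems by simp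
    then show ?case using above by (metis Suc_lessI)
  qed
  then show ?thesis using k by (meson le_refl max.cobounded1)
qed

text \<open>\<open>R/I\<close> has a finite filtration with quotients \<open>R/M\<close>; Noetherian
  induction strips off one socle element at a time.\<close>

lemma Ext_vanishes_primary:
  assumes I: "ideal I R" and vM: "Ext_vanishes k M" and rad: "\<And>x. x \<in> M \<Longrightarrow> \<exists>j::nat. x [^] j \<in> I"
  shows "Ext_vanishes k I"
  using I rad
proof (induction rule: noetherian_induct)
  case (step I)
  consider "I = carrier R"
    | f where "f \<in> carrier R" "f \<notin> I" "\<And>x. x \<in> M \<Longrightarrow> x \<otimes> f \<in> I"
    | "I \<noteq> carrier R" "\<And>z. z \<in> carrier R \<Longrightarrow> (\<And>x. x \<in> M \<Longrightarrow> x \<otimes> z \<in> I) \<Longrightarrow> z \<in> I"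
    by blast
  then show ?case
  proof cases
    case 1
    then show ?thesis using Ext_vanishes_carrier by simp
  next
    case (2 f)
    have "Ext_vanishes k (adjoin I f)"
      using step(2)[OF adjoin_ideal[OF step(1) 2(1)] adjoin_strict[OF step(1) 2(1,2)]] step(3)
        adjoin_incl[OF step(1) 2(1)] by blast
    then show ?thesis
      using Ext_vanishes_middle[OF step(1) 2(1)] vM colon_eq_maximalideal[OF maximal step(1) 2] by simp
  next
    case 3
    obtain x where x: "x \<in> M" "colon I x = I" using exists_regular[OF step(1) 3] by blast
    have xc: "x \<in> carrier R" using x ideal_carr[OF maximal_ideal] by blast
    obtain j :: nat where j: "x [^] j \<in> I" using step(3) x by blast
    \<comment> \<open>A proper ideal contains no power of an element regular modulo it, so positive
      depth is excluded.\<close>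
    have "I = carrier R" using colon_pow_eq[OF step(1) xc x(2), of j] colon_eq_carrier[OF step(1) j] by simp
    then show ?thesis using Ext_vanishes_carrier by simp
  qed
qed

text \<open>If \<open>x \<eta> = \<theta>'\<close> for the generator \<open>\<theta>'\<close> of \<open>Ext\<^sup>n(R/J)\<close>, then \<open>d \<eta>\<close> generates
  \<open>Ext\<^sup>n\<^sup>+\<^sup>1(R/(J + x))\<close>, which is thus identified with the localization of \<open>R/(J + x)\<close> at \<open>M\<close>.\<close>

lemma Ext_regseq_generator:
  assumes "regseq T n J"
    and sat: "\<forall>n J. regseq T n J \<longrightarrow> saturated M J"
  shows "\<exists>\<theta>\<in>cocycles n J.
    (\<forall>\<xi>\<in>cocycles n J. \<exists>v\<in>carrier R - M. \<exists>u\<in>carrier R.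
       v \<odot>\<^bsub>C (Suc n)\<^esub> \<xi> \<ominus>\<^bsub>C (Suc n)\<^esub> u \<odot>\<^bsub>C (Suc n)\<^esub> \<theta> \<in> coboundaries n J) \<and>
    (\<forall>r\<in>carrier R. r \<odot>\<^bsub>C (Suc n)\<^esub> \<theta> \<in> coboundaries n J \<longrightarrow> r \<in> J)"
  using assms(1)
proof (induction rule: regseq.induct)
  case zero
  have z0: "torsion i {\<zero>} = carrier (C i)" for i by (auto simp: torsion_def)
  have b0: "coboundaries 0 {\<zero>} = {\<zero>\<^bsub>C 1\<^esub>}" using trivial by (simp add: coboundaries_def z0)
  show ?case
  proof (rule bexI[of _ \<theta>], intro conjI ballI impI)
    show "\<theta> \<in> cocycles 0 {\<zero>}"
      using \<theta>_closed \<theta>_ker by (simp add: cocycles_def z0 numeral_2_eq_2)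
    fix \<xi> assume "\<xi> \<in> cocycles 0 {\<zero>}"
    then have \<xi>: "\<xi> \<in> carrier (C 1)" "d 1 \<xi> = \<zero>\<^bsub>C 2\<^esub>" by (auto simp: cocycles_def z0 numeral_2_eq_2)
    then obtain v u where "v \<in> carrier R - M" "u \<in> carrier R" "v \<odot>\<^bsub>C 1\<^esub> \<xi> = u \<odot>\<^bsub>C 1\<^esub> \<theta>"
      using \<theta>_generates by blast
    then show "\<exists>v\<in>carrier R - M. \<exists>u\<in>carrier R.
       v \<odot>\<^bsub>C (Suc 0)\<^esub> \<xi> \<ominus>\<^bsub>C (Suc 0)\<^esub> u \<odot>\<^bsub>C (Suc 0)\<^esub> \<theta> \<in> coboundaries 0 {\<zero>}"
      using \<theta>_closed \<xi>(1) b0 by (intro bexI[of _ v] bexI[of _ u]) (auto simp: sub_zero_iff)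
  next
    fix r assume r: "r \<in> carrier R" "r \<odot>\<^bsub>C (Suc 0)\<^esub> \<theta> \<in> coboundaries 0 {\<zero>}"
    \<comment> \<open>The annihilator of \<open>\<theta>\<close> is only known to vanish after
      localization; saturation of the zero ideal removes \<open>w\<close>.\<close>
    then obtain w where "w \<in> carrier R - M" "w \<otimes> r = \<zero>" using \<theta>_annihilator[of r] b0 by auto
    then show "r \<in> {\<zero>}" using saturatedD[of M "{\<zero>}" w r] sat regseq.zero[of T] r(1) by blast
  qed
next
  case (Suc n J x)
  have JI: "ideal J R" using regseq_ideal[OF Suc.hyps(1)] .
  have adj: "ideal (adjoin J x) R" using adjoin_ideal[OF JI Suc.hyps(3)] .
  note x = Suc.hyps(3) and colon = Suc.hyps(4) and adjiff = torsion_adjoin[OF JI Suc.hyps(3)]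
  obtain \<theta>' where \<theta>': "\<theta>' \<in> cocycles n J"
    and gen: "\<And>\<xi>. \<xi> \<in> cocycles n J \<Longrightarrow> \<exists>v\<in>carrier R - M. \<exists>u\<in>carrier R.
       v \<odot>\<^bsub>C (Suc n)\<^esub> \<xi> \<ominus>\<^bsub>C (Suc n)\<^esub> u \<odot>\<^bsub>C (Suc n)\<^esub> \<theta>' \<in> coboundaries n J"
    and ann: "\<And>r. r \<in> carrier R \<Longrightarrow> r \<odot>\<^bsub>C (Suc n)\<^esub> \<theta>' \<in> coboundaries n J \<Longrightarrow> r \<in> J"
    using Suc.IH by blast
  note \<theta>'D = cocyclesD[OF \<theta>']
  \<comment> \<open>\<open>\<theta>'\<close> can be divided by \<open>x\<close> because
    \<open>J : x = J\<close>.\<close>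
  obtain \<eta> where \<eta>: "\<eta> \<in> torsion (Suc n) J" "x \<odot>\<^bsub>C (Suc n)\<^esub> \<eta> = \<theta>'"
    using torsion_lift[OF JI x, of \<theta>' "Suc n"] \<theta>'D(1) colon by auto
  have \<eta>c: "\<eta> \<in> carrier (C (Suc n))" using torsion_carrier[OF \<eta>(1)] .
  have x\<theta>: "x \<odot>\<^bsub>C (Suc (Suc n))\<^esub> d (Suc n) \<eta> = \<zero>\<^bsub>C (Suc (Suc n))\<^esub>"
    using d_smult[OF x \<eta>c] \<eta>(2) \<theta>'D(2) by simp
  show ?case
  proof (rule bexI[of _ "d (Suc n) \<eta>"], intro conjI ballI impI)
    show "d (Suc n) \<eta> \<in> cocycles (Suc n) (adjoin J x)"
      using x\<theta> torsion_d[OF JI \<eta>(1)] d_d[OF \<eta>c] by (simp add: cocycles_def adjiff)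
    fix \<xi> assume \<xi>: "\<xi> \<in> cocycles (Suc n) (adjoin J x)"
    have x\<xi>: "x \<odot>\<^bsub>C (Suc (Suc n))\<^esub> \<xi> = \<zero>\<^bsub>C (Suc (Suc n))\<^esub>" using cocyclesD(1)[OF \<xi>] adjiff by blast
    have "\<xi> \<in> cocycles (Suc n) J" using \<xi> cocycles_mono[OF adjoin_incl[OF JI x]] by blast
    then obtain \<zeta> where \<zeta>: "\<zeta> \<in> torsion (Suc n) J" "\<zeta> \<in> carrier (C (Suc n))" "d (Suc n) \<zeta> = \<xi>"
      using Ext_vanishesE[OF Ext_vanishes_regseq[OF Suc.hyps(1)], of "Suc n"] by blast
    have "x \<odot>\<^bsub>C (Suc n)\<^esub> \<zeta> \<in> cocycles n J"
      using torsion_smult[OF JI x \<zeta>(1)] d_smult[OF x \<zeta>(2)] \<zeta>(3) x\<xi> by (simp add: cocycles_def)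
    then obtain v u where vu: "v \<in> carrier R - M" "u \<in> carrier R"
      and b: "v \<odot>\<^bsub>C (Suc n)\<^esub> (x \<odot>\<^bsub>C (Suc n)\<^esub> \<zeta>) \<ominus>\<^bsub>C (Suc n)\<^esub> u \<odot>\<^bsub>C (Suc n)\<^esub> \<theta>' \<in> coboundaries n J"
      using gen by blast
    then have v: "v \<in> carrier R" by blast
    obtain w where w: "w \<in> torsion n J" "w \<in> carrier (C n)"
        "d n w = v \<odot>\<^bsub>C (Suc n)\<^esub> (x \<odot>\<^bsub>C (Suc n)\<^esub> \<zeta>) \<ominus>\<^bsub>C (Suc n)\<^esub> u \<odot>\<^bsub>C (Suc n)\<^esub> \<theta>'"
      using coboundariesE[OF b] .
    obtain w' where w': "w' \<in> torsion n J" "x \<odot>\<^bsub>C n\<^esub> w' = w"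
      using torsion_lift[OF JI x, of w n] w(1) colon by auto
    have w'c: "w' \<in> carrier (C n)" using torsion_carrier[OF w'(1)] .
    let ?a = "v \<odot>\<^bsub>C (Suc n)\<^esub> \<zeta> \<ominus>\<^bsub>C (Suc n)\<^esub> u \<odot>\<^bsub>C (Suc n)\<^esub> \<eta>"
    have ac: "?a \<in> carrier (C (Suc n))" using v vu \<zeta>(2) \<eta>c by simp
    have aT: "?a \<in> torsion (Suc n) J"
      using torsion_sub[OF JI torsion_smult[OF JI v \<zeta>(1)] torsion_smult[OF JI vu(2) \<eta>(1)]] .
    have "x \<odot>\<^bsub>C (Suc n)\<^esub> ?a = d n w"
      unfolding w(3) using v vu(2) x \<zeta>(2) \<eta>c \<eta>(2) smult_comm[OF x v \<zeta>(2)] smult_comm[OF x vu(2) \<eta>c]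
      by (simp add: smult_sub)
    then have "x \<odot>\<^bsub>C (Suc n)\<^esub> (?a \<ominus>\<^bsub>C (Suc n)\<^esub> d n w') = \<zero>\<^bsub>C (Suc n)\<^esub>"
      using ac w'c x d_smult[OF x w'c] w'(2) by (simp add: smult_sub sub_zero_iff)
    then have "?a \<ominus>\<^bsub>C (Suc n)\<^esub> d n w' \<in> torsion (Suc n) (adjoin J x)"
      using torsion_sub[OF JI aT torsion_d[OF JI w'(1)]] by (simp add: adjiff)
    then have "d (Suc n) (?a \<ominus>\<^bsub>C (Suc n)\<^esub> d n w') \<in> coboundaries (Suc n) (adjoin J x)"
      by (rule coboundariesI)
    moreover have "d (Suc n) (?a \<ominus>\<^bsub>C (Suc n)\<^esub> d n w') =
        v \<odot>\<^bsub>C (Suc (Suc n))\<^esub> \<xi> \<ominus>\<^bsub>C (Suc (Suc n))\<^esub> u \<odot>\<^bsub>C (Suc (Suc n))\<^esub> d (Suc n) \<eta>"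
      using d_sub_coboundary[OF ac w'c] v vu(2) \<zeta>(2,3) \<eta>c by (simp add: d_sub d_smult)
    ultimately show "\<exists>v\<in>carrier R - M. \<exists>u\<in>carrier R.
       v \<odot>\<^bsub>C (Suc (Suc n))\<^esub> \<xi> \<ominus>\<^bsub>C (Suc (Suc n))\<^esub> u \<odot>\<^bsub>C (Suc (Suc n))\<^esub> d (Suc n) \<eta>
         \<in> coboundaries (Suc n) (adjoin J x)"
      using vu by (intro bexI[of _ v] bexI[of _ u]) auto
  next
    fix r assume r: "r \<in> carrier R"
      and rb: "r \<odot>\<^bsub>C (Suc (Suc n))\<^esub> d (Suc n) \<eta> \<in> coboundaries (Suc n) (adjoin J x)"
    obtain \<zeta> where \<zeta>: "\<zeta> \<in> torsion (Suc n) (adjoin J x)" "\<zeta> \<in> carrier (C (Suc n))"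
        "d (Suc n) \<zeta> = r \<odot>\<^bsub>C (Suc (Suc n))\<^esub> d (Suc n) \<eta>" using coboundariesE[OF rb] .
    let ?a = "r \<odot>\<^bsub>C (Suc n)\<^esub> \<eta> \<ominus>\<^bsub>C (Suc n)\<^esub> \<zeta>"
    have ac: "?a \<in> carrier (C (Suc n))" using r \<zeta>(2) \<eta>c by simp
    have "?a \<in> cocycles n J"
      using torsion_sub[OF JI torsion_smult[OF JI r \<eta>(1)], of \<zeta>] \<zeta> r \<eta>c
      by (simp add: cocycles_def adjiff d_sub d_smult sub_zero_iff)
    then obtain v u where vu: "v \<in> carrier R - M" "u \<in> carrier R"
      and b: "v \<odot>\<^bsub>C (Suc n)\<^esub> ?a \<ominus>\<^bsub>C (Suc n)\<^esub> u \<odot>\<^bsub>C (Suc n)\<^esub> \<theta>' \<in> coboundaries n J"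
      using gen by blast
    then have v: "v \<in> carrier R" by blast
    \<comment> \<open>\<open>x\<close> kills \<open>\<zeta>\<close>, so \<open>r \<theta>'\<close>
      is \<open>x\<close> times the cocycle \<open>?a\<close>. Since \<open>v\<close> times
      \<open>?a\<close> is \<open>u \<theta>'\<close> up to a coboundary, \<open>v r - x u\<close>
      annihilates the class of \<open>\<theta>'\<close>.\<close>
    have "x \<odot>\<^bsub>C (Suc n)\<^esub> ?a = r \<odot>\<^bsub>C (Suc n)\<^esub> \<theta>'"
      using r x \<eta>c \<eta>(2) \<zeta>(1,2) smult_comm[OF x r \<eta>c] \<theta>'D(3)
      by (simp add: smult_sub adjiff)
    then have "x \<odot>\<^bsub>C (Suc n)\<^esub> (v \<odot>\<^bsub>C (Suc n)\<^esub> ?a \<ominus>\<^bsub>C (Suc n)\<^esub> u \<odot>\<^bsub>C (Suc n)\<^esub> \<theta>') =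
        (v \<otimes> r \<ominus> x \<otimes> u) \<odot>\<^bsub>C (Suc n)\<^esub> \<theta>'"
      using v x r vu(2) ac \<theta>'D(3) smult_comm[OF x v ac]
      by (simp add: smult_sub C.smult_assoc1 C.smult_l_distr C.smult_l_minus a_minus_def C.smult_r_distr
            C.smult_r_minus)
    then have "v \<otimes> r \<ominus> x \<otimes> u \<in> J"
      using coboundaries_smult[OF JI x b] ann[of "v \<otimes> r \<ominus> x \<otimes> u"] v x r vu(2) by simp
    then have "(v \<otimes> r \<ominus> x \<otimes> u) \<oplus> u \<otimes> x \<in> adjoin J x" using adjoinI[of _ J u x] vu(2) by blast
    moreover have "(v \<otimes> r \<ominus> x \<otimes> u) \<oplus> u \<otimes> x = v \<otimes> r" using v r x vu(2) by algebra
    ultimately show "r \<in> adjoin J x"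
      using saturatedD[of M "adjoin J x" v r] sat regseq.Suc[OF Suc.hyps(1-4)] vu(1) r by auto
  qed
qed

text \<open>The element \<open>s \<theta>'\<close> is killed by \<open>M = I : y\<close>. Since
  Ext^(n+1)(R/(I + y)) vanishes, it equals \<open>y \<xi>\<close> for a cocycle \<open>\<xi>\<close>
  of \<open>R/I\<close>, and \<open>v \<xi>\<close> is \<open>u \<theta>'\<close> up to a coboundary
  for some \<open>v\<close> outside \<open>M\<close>. This \<open>u\<close> works: \<open>I\<close>
  kills \<open>\<xi>\<close>, whereas \<open>u y\<close> in \<open>J\<close> would force
  \<open>v s\<close>, hence \<open>s\<close>, into \<open>J\<close>.\<close>

theorem irreducible_duality:
  assumes J: "regseq T n J"
    and sat: "\<forall>n J. regseq T n J \<longrightarrow> saturated M J"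
    and s: "s \<in> carrier R" "s \<notin> J" "\<And>x. x \<in> M \<Longrightarrow> x \<otimes> s \<in> J"
    and I: "ideal I R" "J \<subseteq> I" and y: "y \<in> carrier R" "y \<notin> I" "\<And>x. x \<in> M \<Longrightarrow> x \<otimes> y \<in> I"
    and rad: "\<And>x. x \<in> M \<Longrightarrow> \<exists>j::nat. x [^] j \<in> I"
  shows "\<exists>u\<in>carrier R. (\<forall>i\<in>I. u \<otimes> i \<in> J) \<and> u \<otimes> y \<notin> J"
proof -
  have JI: "ideal J R" using regseq_ideal[OF J] .
  obtain \<theta>' where \<theta>': "\<theta>' \<in> cocycles n J"
    and gen: "\<And>\<xi>. \<xi> \<in> cocycles n J \<Longrightarrow> \<exists>v\<in>carrier R - M. \<exists>u\<in>carrier R.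
       v \<odot>\<^bsub>C (Suc n)\<^esub> \<xi> \<ominus>\<^bsub>C (Suc n)\<^esub> u \<odot>\<^bsub>C (Suc n)\<^esub> \<theta>' \<in> coboundaries n J"
    and ann: "\<And>r. r \<in> carrier R \<Longrightarrow> r \<odot>\<^bsub>C (Suc n)\<^esub> \<theta>' \<in> coboundaries n J \<Longrightarrow> r \<in> J"
    using Ext_regseq_generator[OF J sat] by blast
  note \<theta>'c = cocyclesD(3)[OF \<theta>']
  have zM: "s \<odot>\<^bsub>C (Suc n)\<^esub> \<theta>' \<in> cocycles n (colon I y)"
    using cocycles_smult_colon[OF s(1) \<theta>'] colon_eq_maximalideal[OF maximal JI s]
      colon_eq_maximalideal[OF maximal I(1) y] by simp
  have "Ext_vanishes (Suc n) (adjoin I y)"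
    using Ext_vanishes_primary[OF adjoin_ideal[OF I(1) y(1)] Ext_vanishes_above_depth[OF J s, of "Suc n"]]
      rad adjoin_incl[OF I(1) y(1)] by blast
  then obtain \<xi> where \<xi>: "\<xi> \<in> cocycles n I" "y \<odot>\<^bsub>C (Suc n)\<^esub> \<xi> = s \<odot>\<^bsub>C (Suc n)\<^esub> \<theta>'"
    using Ext_colon_surj[OF I(1) y(1) _ zM] by blast
  note \<xi>c = cocyclesD(3)[OF \<xi>(1)]
  obtain v u where vu: "v \<in> carrier R - M" "u \<in> carrier R"
    and b: "v \<odot>\<^bsub>C (Suc n)\<^esub> \<xi> \<ominus>\<^bsub>C (Suc n)\<^esub> u \<odot>\<^bsub>C (Suc n)\<^esub> \<theta>' \<in> coboundaries n J"
    using gen \<xi>(1) cocycles_mono[OF I(2)] by blast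
  then have v: "v \<in> carrier R" by blast
  have mult: "(v \<odot>\<^bsub>C (Suc n)\<^esub> (r \<odot>\<^bsub>C (Suc n)\<^esub> \<xi>)) \<ominus>\<^bsub>C (Suc n)\<^esub> (u \<otimes> r) \<odot>\<^bsub>C (Suc n)\<^esub> \<theta>' \<in> coboundaries n J"
    if r: "r \<in> carrier R" for r
  proof -
    have "r \<odot>\<^bsub>C (Suc n)\<^esub> (v \<odot>\<^bsub>C (Suc n)\<^esub> \<xi> \<ominus>\<^bsub>C (Suc n)\<^esub> u \<odot>\<^bsub>C (Suc n)\<^esub> \<theta>') =
      (v \<odot>\<^bsub>C (Suc n)\<^esub> (r \<odot>\<^bsub>C (Suc n)\<^esub> \<xi>)) \<ominus>\<^bsub>C (Suc n)\<^esub> (u \<otimes> r) \<odot>\<^bsub>C (Suc n)\<^esub> \<theta>'"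
      using r v vu(2) \<xi>c \<theta>'c smult_comm[OF r v \<xi>c] smult_comm[OF r vu(2) \<theta>'c]
      by (simp add: smult_sub C.smult_assoc1)
    then show ?thesis using coboundaries_smult[OF JI r b] by simp
  qed
  have zero_cob: "\<zero>\<^bsub>C (Suc n)\<^esub> \<in> coboundaries n J"
    using coboundariesI[OF torsion_zero[OF JI, of n]] by simp
  have "u \<otimes> i \<in> J" if i: "i \<in> I" for i
  proof -
    have ic: "i \<in> carrier R" using ideal_carr[OF I(1) i] .
    have "i \<odot>\<^bsub>C (Suc n)\<^esub> \<xi> = \<zero>\<^bsub>C (Suc n)\<^esub>" using cocyclesD(1)[OF \<xi>(1)] i by (simp add: torsion_def)
    then have "\<zero>\<^bsub>C (Suc n)\<^esub> \<ominus>\<^bsub>C (Suc n)\<^esub> (u \<otimes> i) \<odot>\<^bsub>C (Suc n)\<^esub> \<theta>' \<in> coboundaries n J"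
      using mult[OF ic] v by simp
    then have "\<zero>\<^bsub>C (Suc n)\<^esub> \<ominus>\<^bsub>C (Suc n)\<^esub> (\<zero>\<^bsub>C (Suc n)\<^esub> \<ominus>\<^bsub>C (Suc n)\<^esub> (u \<otimes> i) \<odot>\<^bsub>C (Suc n)\<^esub> \<theta>')
        \<in> coboundaries n J"
      by (rule coboundaries_sub[OF JI zero_cob])
    then show ?thesis using ann[of "u \<otimes> i"] vu(2) ic \<theta>'c by (simp add: zero_sub_zero_sub)
  qed
  moreover have "u \<otimes> y \<notin> J"
  proof
    assume uy: "u \<otimes> y \<in> J"
    have "(u \<otimes> y) \<odot>\<^bsub>C (Suc n)\<^esub> \<theta>' = \<zero>\<^bsub>C (Suc n)\<^esub>"
      using uy cocyclesD(1)[OF \<theta>'] by (simp add: torsion_def)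
    then have "(v \<otimes> s) \<odot>\<^bsub>C (Suc n)\<^esub> \<theta>' \<in> coboundaries n J"
      using mult[OF y(1)] v s(1) \<theta>'c \<xi>(2) by (simp add: C.smult_assoc1)
    then have "v \<otimes> s \<in> J" using ann[of "v \<otimes> s"] v s(1) by simp
    then show False using saturatedD[of M J v s] sat J vu(1) s(1,2) by blast
  qed
  ultimately show ?thesis using vu(2) by blast
qed

end

section \<open>Graded rings\<close>

locale graded_ring = noetherian_cring R for R (structure) +
  fixes G :: "nat \<Rightarrow> 'a set"
  assumes grading: "is_grading R G" and base_field: "subfield (G 0) R"
begin

lemma G_subgroup: "additive_subgroup (G n) R"
  using grading by (simp add: is_grading_def)

lemma G_mult: "x \<in> G m \<Longrightarrow> y \<in> G n \<Longrightarrow> x \<otimes> y \<in> G (m + n)"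
  using grading by (auto simp: is_grading_def)

lemma G_carr: "x \<in> G n \<Longrightarrow> x \<in> carrier R"
  using additive_subgroup.a_subset[OF G_subgroup] by blast

lemma G_zero [simp]: "\<zero> \<in> G n"
  by (rule additive_subgroup.zero_closed[OF G_subgroup])

lemma G_add: "x \<in> G n \<Longrightarrow> y \<in> G n \<Longrightarrow> x \<oplus> y \<in> G n"
  by (rule additive_subgroup.a_closed[OF G_subgroup])

lemma G_one: "\<one> \<in> G 0"
  using subringE(3)[OF subfieldE(1)[OF base_field]] .

lemma G_pow: "x \<in> G n \<Longrightarrow> x [^] (k::nat) \<in> G (k * n)"
proof (induction k)
  case 0
  then show ?case using G_one by simp
next
  case (Suc k)
  then show ?case using G_mult[of "x [^] k" "k * n" x n] by (simp add: add.commute)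
qed

definition component :: "nat \<Rightarrow> 'a \<Rightarrow> 'a" where
  "component n x = (THE f. (\<forall>n. f n \<in> G n) \<and> finite {n. f n \<noteq> \<zero>} \<and>
     x = (\<Oplus>n\<in>{n. f n \<noteq> \<zero>}. f n)) n"

lemma finsum_support:
  assumes f: "\<And>n. f n \<in> G n" and N: "\<And>n. N < n \<Longrightarrow> f n = \<zero>"
  shows "finite {n. f n \<noteq> \<zero>}" "(\<Oplus>n\<in>{n. f n \<noteq> \<zero>}. f n) = (\<Oplus>n\<in>{..N}. f n)"
proof -
  have sub: "{n. f n \<noteq> \<zero>} \<subseteq> {..N}" using N by (auto simp: not_less[symmetric])
  then show "finite {n. f n \<noteq> \<zero>}" using finite_subset by blast
  show "(\<Oplus>n\<in>{n. f n \<noteq> \<zero>}. f n) = (\<Oplus>n\<in>{..N}. f n)"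
    by (rule add.finprod_mono_neutral_cong_left) (use sub G_carr[OF f] in auto)
qed

lemma component_in: "x \<in> carrier R \<Longrightarrow> component n x \<in> G n"
  and component_sum: "x \<in> carrier R \<Longrightarrow> \<exists>N. (\<forall>n>N. component n x = \<zero>) \<and> x = (\<Oplus>n\<in>{..N}. component n x)"
proof -
  assume x: "x \<in> carrier R"
  define P where "P f \<longleftrightarrow> (\<forall>n. f n \<in> G n) \<and> finite {n. f n \<noteq> \<zero>} \<and> x = (\<Oplus>n\<in>{n. f n \<noteq> \<zero>}. f n)" for f
  have "\<exists>!f. P f" using grading x unfolding is_grading_def P_def by blast
  then have P: "P (\<lambda>n. component n x)"
    unfolding component_def P_def[symmetric] by (rule theI')
  then show "component n x \<in> G n" unfolding P_def by blast
  obtain N where "\<forall>n\<in>{n. component n x \<noteq> \<zero>}. n \<le> N"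
    using P finite_nat_set_iff_bounded_le unfolding P_def by blast
  then have N: "\<And>n. N < n \<Longrightarrow> component n x = \<zero>" using not_less by blast
  then show "\<exists>N. (\<forall>n>N. component n x = \<zero>) \<and> x = (\<Oplus>n\<in>{..N}. component n x)"
    using finsum_support(2)[of "\<lambda>n. component n x" N] P unfolding P_def by (intro exI[of _ N]) auto
qed

lemma component_unique:
  assumes f: "\<And>n. f n \<in> G n" and N: "\<And>n. N < n \<Longrightarrow> f n = \<zero>" and x: "x = (\<Oplus>n\<in>{..N}. f n)"
  shows "component n x = f n"
proof -
  define P where "P f \<longleftrightarrow> (\<forall>n. f n \<in> G n) \<and> finite {n. f n \<noteq> \<zero>} \<and> x = (\<Oplus>n\<in>{n. f n \<noteq> \<zero>}. f n)" for f
  have "x \<in> carrier R" unfolding x using G_carr[OF f] by simp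
  then have "\<exists>!f. P f" using grading unfolding is_grading_def P_def by blast
  moreover have "P f" using finsum_support[of f N] f N x unfolding P_def by simp
  ultimately show ?thesis unfolding component_def P_def[symmetric] by (metis the1_equality)
qed

lemma component_carr [simp]: "x \<in> carrier R \<Longrightarrow> component n x \<in> carrier R"
  using component_in G_carr by blast

lemma component_add:
  assumes "x \<in> carrier R" "y \<in> carrier R"
  shows "component n (x \<oplus> y) = component n x \<oplus> component n y"
proof -
  obtain N where N: "\<And>n. N < n \<Longrightarrow> component n x = \<zero>" "x = (\<Oplus>n\<in>{..N}. component n x)"
    using component_sum[OF assms(1)] by blast
  obtain K where K: "\<And>n. K < n \<Longrightarrow> component n y = \<zero>" "y = (\<Oplus>n\<in>{..K}. component n y)"
    using component_sum[OF assms(2)] by blast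
  let ?m = "max N K"
  have mono: "(\<Oplus>n\<in>{..?m}. component n z) = (\<Oplus>n\<in>{..L}. component n z)"
    if "L \<le> ?m" "\<And>n. L < n \<Longrightarrow> component n z = \<zero>" "z \<in> carrier R" for L z
    by (rule add.finprod_mono_neutral_cong_left[symmetric]) (use that in auto)
  have "x \<oplus> y = (\<Oplus>n\<in>{..?m}. component n x) \<oplus> (\<Oplus>n\<in>{..?m}. component n y)"
    using mono[of N x] mono[of K y] N K assms by simp
  also have "\<dots> = (\<Oplus>n\<in>{..?m}. component n x \<oplus> component n y)"
    by (rule finsum_addf[symmetric]) (use assms in auto)
  finally show ?thesis
    using component_unique[of "\<lambda>n. component n x \<oplus> component n y" ?m "x \<oplus> y"] N K component_in assms
    by (simp add: G_add)
qed

lemma component_homogeneous: "h \<in> G k \<Longrightarrow> component n h = (if n = k then h else \<zero>)"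
proof -
  assume h: "h \<in> G k"
  have "(\<Oplus>n\<in>{..k}. if n = k then h else \<zero>) = (\<Oplus>n\<in>{k}. h)"
    by (rule add.finprod_mono_neutral_cong_right) (use h G_carr in auto)
  then show ?thesis
    using component_unique[of "\<lambda>n. if n = k then h else \<zero>" k h n] h G_carr by auto
qed

lemma component_zero [simp]: "component n \<zero> = \<zero>"
  using component_homogeneous[OF G_zero] by simp

lemma component_neg: "x \<in> carrier R \<Longrightarrow> component n (\<ominus> x) = \<ominus> component n x"
  using component_add[of "\<ominus> x" x n] minus_equality[of "component n (\<ominus> x)" "component n x"]
  by (simp add: l_neg)

lemma component_diff:
  "x \<in> carrier R \<Longrightarrow> y \<in> carrier R \<Longrightarrow> component n (x \<ominus> y) = component n x \<ominus> component n y"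
  by (simp add: a_minus_def component_add component_neg)

text \<open>The filtration by order, \<open>R_(>=n)\<close>. It stands in for the powers of
  \<open>R_+\<close>: indices add under products, and \<open>tail 1\<close> is \<open>R_+\<close>
  itself.\<close>

definition tail :: "nat \<Rightarrow> 'a set" where
  "tail n = {x \<in> carrier R. \<forall>i<n. component i x = \<zero>}"

lemma tail_carr: "x \<in> tail n \<Longrightarrow> x \<in> carrier R"
  by (simp add: tail_def)

lemma G_tail: "h \<in> G k \<Longrightarrow> n \<le> k \<Longrightarrow> h \<in> tail n"
  by (auto simp: tail_def component_homogeneous G_carr)

lemma tail_add: "x \<in> tail n \<Longrightarrow> y \<in> tail n \<Longrightarrow> x \<oplus> y \<in> tail n"
  by (simp add: tail_def component_add)

lemma tail_zero [simp]: "\<zero> \<in> tail n"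
  by (simp add: tail_def)

lemma tail_0 [simp]: "tail 0 = carrier R"
  by (auto simp: tail_def)

lemma tail_antimono: "m \<le> n \<Longrightarrow> tail n \<subseteq> tail m"
  by (auto simp: tail_def)

lemma tail_induct [consumes 1, case_names homogeneous add]:
  assumes x: "x \<in> tail a"
    and hom: "\<And>n h. a \<le> n \<Longrightarrow> h \<in> G n \<Longrightarrow> h \<in> carrier R \<Longrightarrow> P h"
    and add: "\<And>x y. x \<in> tail a \<Longrightarrow> y \<in> tail a \<Longrightarrow> P x \<Longrightarrow> P y \<Longrightarrow> P (x \<oplus> y)"
  shows "P x"
proof -
  have xc: "x \<in> carrier R" using tail_carr[OF x] .
  obtain N where N: "x = (\<Oplus>n\<in>{..N}. component n x)" using component_sum[OF xc] by blast
  have t: "component n x \<in> tail a \<and> P (component n x)" for n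
  proof (cases "a \<le> n")
    case True
    then show ?thesis using G_tail[OF component_in[OF xc] True] hom[OF True component_in[OF xc]] xc by simp
  next
    case False
    then have "component n x = \<zero>" using x by (simp add: tail_def)
    \<comment> \<open>Zero counts as homogeneous of every degree, in particular of degree
      \<open>a\<close>.\<close>
    then show ?thesis using hom[of a \<zero>] by simp
  qed
  have "(\<Oplus>n\<in>{..k}. component n x) \<in> tail a \<and> P (\<Oplus>n\<in>{..k}. component n x)" for k
  proof (induction k)
    case 0
    then show ?case using t[of 0] xc by simp
  next
    case (Suc k)
    then show ?case using t[of "Suc k"] xc add tail_add by (simp add: finsum_Suc)
  qed
  then show ?thesis using N by metis
qed

lemmas homogeneous_induct = tail_induct[of _ 0, simplified, consumes 1, case_names homogeneous add]

lemma component_mult: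
  assumes h: "h \<in> G k" and x: "x \<in> carrier R"
  shows "component n (h \<otimes> x) = (if n < k then \<zero> else h \<otimes> component (n - k) x)"
  using x
proof (induction x rule: homogeneous_induct)
  case (homogeneous j g)
  then show ?case using h G_carr[OF h] component_homogeneous[OF G_mult[OF h homogeneous(1)]]
    by (auto simp: component_homogeneous[OF homogeneous(1)])
next
  case (add x y)
  then show ?case using G_carr[OF h] by (simp add: r_distr component_add)
qed

lemma tail_mult:
  assumes "x \<in> tail m" "y \<in> tail n"
  shows "x \<otimes> y \<in> tail (m + n)"
  using assms(1)
proof (induction x rule: tail_induct)
  case (homogeneous i g)
  have yc: "y \<in> carrier R" using tail_carr[OF assms(2)] .
  have "component j (g \<otimes> y) = \<zero>" if "j < m + n" for j
    using component_mult[OF homogeneous(2) yc, of j] assms(2) homogeneous that by (auto simp: tail_def)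
  then show ?case using homogeneous yc by (simp add: tail_def)
next
  case (add x z)
  then show ?case using tail_carr assms(2) tail_add by (simp add: l_distr)
qed

lemma tail_ideal: "ideal (tail n) R"
  by (rule idealI_cring) (use tail_add tail_carr tail_mult[of _ 0 _ n] in auto)

lemma tail_pow: "x \<in> tail n \<Longrightarrow> x [^] (k::nat) \<in> tail (k * n)"
proof (induction k)
  case (Suc k)
  then show ?case using tail_mult[of "x [^] k" "k * n" x n] by (simp add: add.commute)
qed simp

lemma irrelevant_ideal_eq: "irrelevant_ideal R G = tail 1"
proof
  show "irrelevant_ideal R G \<subseteq> tail 1"
  proof
    fix x assume "x \<in> irrelevant_ideal R G"
    then obtain N f where Nf: "finite N" "0 \<notin> N" "\<And>n. n \<in> N \<Longrightarrow> f n \<in> G n" "x = (\<Oplus>n\<in>N. f n)"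
      unfolding irrelevant_ideal_def by blast
    have "finite N \<Longrightarrow> 0 \<notin> N \<Longrightarrow> (\<forall>n\<in>N. f n \<in> G n) \<Longrightarrow> (\<Oplus>n\<in>N. f n) \<in> tail 1"
    proof (induction N rule: finite_induct)
      case (insert n N)
      then have "f n \<in> tail 1" using G_tail[of "f n" n 1] by (cases n) auto
      then show ?case using insert G_carr tail_add by (subst finsum_insert) auto
    qed simp
    then show "x \<in> tail 1" using Nf by blast
  qed
  show "tail 1 \<subseteq> irrelevant_ideal R G"
  proof
    fix x assume x: "x \<in> tail 1"
    have xc: "x \<in> carrier R" using tail_carr[OF x] .
    obtain N where N: "x = (\<Oplus>n\<in>{..N}. component n x)" using component_sum[OF xc] by blast
    also have "\<dots> = (\<Oplus>n\<in>{1..N}. component n x)"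
      by (rule add.finprod_mono_neutral_cong_right) (use x xc in \<open>auto simp: tail_def not_less_eq_eq\<close>)
    finally show "x \<in> irrelevant_ideal R G"
      unfolding irrelevant_ideal_def using component_in[OF xc]
      by (intro CollectI exI[of _ "{1..N}"] exI[of _ "\<lambda>n. component n x"]) auto
  qed
qed

lemma base_unit:
  assumes "x \<in> G 0" "x \<noteq> \<zero>"
  obtains y where "y \<in> G 0" "y \<otimes> x = \<one>"
  using subfield_m_inv(1,3)[OF base_field, of x] assms by blast

lemma one_not_zero: "\<one> \<noteq> \<zero>"
  using subfieldE(6)[OF base_field] by auto

lemma one_notin_tail: "\<one> \<notin> tail 1"
  using component_homogeneous[OF G_one] one_not_zero by (auto simp: tail_def)

lemma component_0_nonzero: "w \<in> carrier R \<Longrightarrow> w \<notin> tail 1 \<Longrightarrow> component 0 w \<noteq> \<zero>"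
  by (auto simp: tail_def)

text \<open>The degree-zero component of \<open>w\<close> is a nonzero element of the base field;
  \<open>u\<close> is its inverse.\<close>

lemma unit_mod_tail:
  assumes w: "w \<in> carrier R" "w \<notin> tail 1"
  obtains u where "u \<in> G 0" "\<one> \<ominus> u \<otimes> w \<in> tail 1"
proof -
  have "component 0 w \<in> G 0" "component 0 w \<noteq> \<zero>"
    using component_in[OF w(1)] component_0_nonzero[OF w] by auto
  then obtain u where u: "u \<in> G 0" "u \<otimes> component 0 w = \<one>" by (rule base_unit)
  have "component 0 (\<one> \<ominus> u \<otimes> w) = \<zero>"
    using u w G_carr[OF u(1)] component_mult[OF u(1) w(1), of 0] component_homogeneous[OF G_one, of 0]
    by (simp add: a_minus_def component_add component_neg r_neg)
  then show thesis using that[OF u(1)] w G_carr[OF u(1)] by (simp add: tail_def)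
qed

lemma tail_1_maximal: "maximalideal (tail 1) R"
proof (rule maximalidealI[OF tail_ideal])
  show "carrier R \<noteq> tail 1" using one_notin_tail one_closed by blast
  fix K assume K: "ideal K R" "tail 1 \<subseteq> K" "K \<subseteq> carrier R"
  show "K = tail 1 \<or> K = carrier R"
  proof (rule disjCI)
    assume "K \<noteq> carrier R"
    show "K = tail 1"
    proof (rule ccontr)
      assume "K \<noteq> tail 1"
      then obtain w where w: "w \<in> K" "w \<notin> tail 1" using K by blast
      then have wc: "w \<in> carrier R" using K by blast
      obtain u where u: "u \<in> G 0" "\<one> \<ominus> u \<otimes> w \<in> tail 1" using unit_mod_tail[OF wc w(2)] .
      have uc: "u \<in> carrier R" using G_carr[OF u(1)] .
      have "(\<one> \<ominus> u \<otimes> w) \<oplus> u \<otimes> w \<in> K"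
        using ideal_add[OF K(1)] K(2) u(2) ideal.I_l_closed[OF K(1) w(1) uc] by blast
      moreover have "(\<one> \<ominus> u \<otimes> w) \<oplus> u \<otimes> w = \<one>" using uc wc by algebra
      ultimately show False using ideal.one_imp_carrier[OF K(1)] \<open>K \<noteq> carrier R\<close> by simp
    qed
  qed
qed

text \<open>Closure under components is the form in which arguments on orders use homogeneity;
  \<open>homogeneous_genideal\<close> and \<open>finite_homogeneous_generators\<close> connect it
  with generators.\<close>

definition homogeneous :: "'a set \<Rightarrow> bool" where
  "homogeneous J \<longleftrightarrow> ideal J R \<and> (\<forall>x\<in>J. \<forall>n. component n x \<in> J)"

lemma homogeneousD:
  assumes "homogeneous J"
  shows "ideal J R" "x \<in> J \<Longrightarrow> component n x \<in> J"
  using assms by (auto simp: homogeneous_def)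

lemma homogeneous_zero: "homogeneous {\<zero>}"
  by (simp add: homogeneous_def zeroideal)

lemma homogeneous_adjoin:
  assumes J: "homogeneous J" and x: "x \<in> G k"
  shows "homogeneous (adjoin J x)"
proof -
  note JI = homogeneousD(1)[OF J]
  have xc: "x \<in> carrier R" using G_carr[OF x] .
  have "component n y \<in> adjoin J x" if y: "y \<in> adjoin J x" for y n
  proof -
    obtain j r where jr: "j \<in> J" "r \<in> carrier R" "y = j \<oplus> r \<otimes> x" using y by (rule adjoinE)
    have jc: "j \<in> carrier R" using ideal_carr[OF JI jr(1)] .
    have "component n y = component n j \<oplus> (if n < k then \<zero> else component (n - k) r) \<otimes> x"
      using component_mult[OF x jr(2), of n] jc jr xc by (simp add: component_add m_comm)
    then show ?thesis using adjoinI[OF homogeneousD(2)[OF J jr(1)]] jr(2) by simp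
  qed
  then show ?thesis using adjoin_ideal[OF JI xc] by (simp add: homogeneous_def)
qed

lemma mem_if_components:
  assumes J: "ideal J R" and x: "x \<in> carrier R" and c: "\<And>n. component n x \<in> J"
  shows "x \<in> J"
proof -
  obtain N where "x = (\<Oplus>n\<in>{..N}. component n x)" using component_sum[OF x] by blast
  moreover have "(\<Oplus>n\<in>{..k}. component n x) \<in> J" for k
  proof (induction k)
    case 0
    then show ?case using c[of 0] x by simp
  next
    case (Suc k)
    then show ?case using c[of "Suc k"] x ideal_add[OF J] by (simp add: finsum_Suc)
  qed
  ultimately show ?thesis by metis
qed

text \<open>A graded substitute for Krull's intersection theorem: the component of degree
  \<open>n\<close> is already determined modulo \<open>tail (Suc n)\<close>.\<close>

lemma mem_homogeneous_if_close:
  assumes J: "homogeneous J" and x: "x \<in> carrier R" and c: "\<And>n. \<exists>j\<in>J. x \<ominus> j \<in> tail n"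
  shows "x \<in> J"
proof (rule mem_if_components[OF homogeneousD(1)[OF J] x])
  fix n
  obtain j where j: "j \<in> J" "x \<ominus> j \<in> tail (Suc n)" using c by blast
  have jc: "j \<in> carrier R" using ideal_carr[OF homogeneousD(1)[OF J] j(1)] .
  have "component n (x \<ominus> j) = \<zero>" using j(2) by (simp add: tail_def)
  then have "(component n x \<ominus> component n j) \<oplus> component n j = component n j"
    using x jc by (simp add: component_diff)
  moreover have "(component n x \<ominus> component n j) \<oplus> component n j = component n x"
    using component_carr[OF x, of n] component_carr[OF jc, of n] by algebra
  ultimately have "component n x = component n j" by simp
  then show "component n x \<in> J" using homogeneousD(2)[OF J j(1)] by simp
qed

text \<open>With \<open>v = 1 - u w\<close> of positive order, \<open>f\<close> is congruent to
  \<open>v f\<close>, hence to \<open>v^n f\<close>, modulo \<open>J\<close>; so \<open>f\<close>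
  lies in \<open>J + R_(>=n)\<close> for every \<open>n\<close>. This brings results from the
  localization at \<open>R_+\<close> back to \<open>R\<close>.\<close>

lemma homogeneous_saturated:
  assumes J: "homogeneous J"
  shows "saturated (tail 1) J"
  unfolding saturated_def
proof (intro ballI impI)
  fix w f assume w: "w \<in> carrier R - tail 1" and f: "f \<in> carrier R" and wf: "w \<otimes> f \<in> J"
  note JI = homogeneousD(1)[OF J]
  obtain u where u: "u \<in> G 0" "\<one> \<ominus> u \<otimes> w \<in> tail 1" using unit_mod_tail w by blast
  define v where "v = \<one> \<ominus> u \<otimes> w"
  have uc: "u \<in> carrier R" and wc: "w \<in> carrier R" using G_carr[OF u(1)] w by auto
  have vc: "v \<in> carrier R" using uc wc by (simp add: v_def)
  have fv: "f \<ominus> v \<otimes> f = u \<otimes> (w \<otimes> f)" unfolding v_def using uc wc f by algebra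
  have "f \<ominus> v [^] n \<otimes> f \<in> J" for n :: nat
  proof (induction n)
    case 0
    then show ?case using f ideal_zero[OF JI] by (simp add: a_minus_def r_neg)
  next
    case (Suc n)
    have vn: "v [^] n \<in> carrier R" using vc by simp
    have "f \<ominus> v [^] Suc n \<otimes> f = (f \<ominus> v [^] n \<otimes> f) \<oplus> v [^] n \<otimes> (f \<ominus> v \<otimes> f)"
      unfolding nat_pow_Suc using vn vc f by algebra
    then show ?case
      using ideal_add[OF JI Suc] ideal.I_l_closed[OF JI _ vn] ideal.I_l_closed[OF JI wf uc] fv by simp
  qed
  moreover have "f \<ominus> (f \<ominus> v [^] n \<otimes> f) \<in> tail n" for n :: nat
  proof -
    have vn: "v [^] n \<in> carrier R" using vc by simp
    have "f \<ominus> (f \<ominus> v [^] n \<otimes> f) = v [^] n \<otimes> f" using vn f by algebra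
    then show ?thesis using tail_mult[OF tail_pow[of v 1 n], of f 0] u(2) f by (simp add: v_def)
  qed
  ultimately show "f \<in> J" using mem_homogeneous_if_close[OF J f] by blast
qed

section \<open>Homogeneous prime avoidance\<close>

lemma homogeneous_notin_prime:
  assumes P: "primeideal P R" "\<not> tail 1 \<subseteq> P"
  shows "\<exists>k>0. \<exists>x\<in>G k. x \<notin> P"
proof (rule ccontr)
  assume n: "\<not> ?thesis"
  have PI: "ideal P R" using P primeideal.axioms(1) by blast
  have "tail 1 \<subseteq> P"
  proof
    fix x assume "x \<in> tail 1"
    then show "x \<in> P"
    proof (induction x rule: tail_induct)
      case (homogeneous i h)
      then have "0 < i" by simp
      then show ?case using n homogeneous(2) by blast
    qed (rule ideal_add[OF PI])
  qed
  then show False using P by blast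
qed

text \<open>Multiply one witness for each \<open>Q\<close>; primality of \<open>P\<close> keeps the
  product outside. A homogeneous element of positive degree outside \<open>P\<close> starts the
  product and makes its degree positive.\<close>

lemma homogeneous_product_avoiding:
  assumes "finite \<Q>" "primeideal P R" "\<not> tail 1 \<subseteq> P"
    and "\<And>Q. Q \<in> \<Q> \<Longrightarrow> primeideal Q R \<and> (\<exists>k. \<exists>x\<in>G k. x \<in> Q \<and> x \<notin> P)"
  shows "\<exists>k>0. \<exists>x\<in>G k. x \<notin> P \<and> (\<forall>Q\<in>\<Q>. x \<in> Q)"
  using assms(1,4)
proof (induction \<Q> rule: finite_induct)
  case empty
  then show ?case using homogeneous_notin_prime[OF assms(2,3)] by auto
next
  case (insert Q \<Q>)
  obtain k x where x: "k > 0" "x \<in> G k" "x \<notin> P" "\<And>Q. Q \<in> \<Q> \<Longrightarrow> x \<in> Q" using insert by blast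
  obtain j y where y: "y \<in> G j" "y \<in> Q" "y \<notin> P" using insert(4)[of Q] by blast
  have xy: "x \<in> carrier R" "y \<in> carrier R" using G_carr x(2) y(1) by blast+
  have "x \<otimes> y \<notin> P" using primeideal.I_prime[OF assms(2) xy] x(3) y(3) by blast
  moreover have "x \<otimes> y \<in> K" if "K \<in> insert Q \<Q>" for K
  proof -
    have "ideal K R" using insert(4)[OF that] primeideal.axioms(1) by blast
    then show ?thesis using that x(4) y(2) ideal.I_l_closed ideal.I_r_closed xy by (metis insertE)
  qed
  ultimately show ?case using G_mult[OF x(2) y(1)] x(1) by (metis add_gr_0)
qed

text \<open>Homogeneous prime avoidance for primes that need not be homogeneous themselves: if the
  homogeneous elements of one of them lie in another, the former may be dropped.\<close>

lemma homogeneous_prime_avoidance: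
  assumes "finite \<Q>" "\<And>Q. Q \<in> \<Q> \<Longrightarrow> primeideal Q R \<and> \<not> tail 1 \<subseteq> Q"
  shows "\<exists>k>0. \<exists>x\<in>G k. \<forall>Q\<in>\<Q>. x \<notin> Q"
  using assms
proof (induction "card \<Q>" arbitrary: \<Q>)
  case 0
  then have "\<Q> = {}" by simp
  then show ?case using G_zero[of 1] by blast
next
  case (Suc m)
  then obtain P where P: "P \<in> \<Q>" by fastforce
  note primes = Suc(4)
  have red: "\<exists>k>0. \<exists>x\<in>G k. \<forall>Q\<in>\<Q> - {K}. x \<notin> Q" if "K \<in> \<Q>" for K
    using Suc(1)[of "\<Q> - {K}"] Suc(2-4) that by simp
  show ?case
  proof (cases "\<exists>K\<in>\<Q>. K \<noteq> P \<and> (\<forall>k. \<forall>x\<in>G k. x \<in> K \<longrightarrow> x \<in> P)")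
    case True
    then obtain K where K: "K \<in> \<Q>" "K \<noteq> P" "\<And>k x. x \<in> G k \<Longrightarrow> x \<in> K \<Longrightarrow> x \<in> P" by blast
    obtain k x where "k > 0" "x \<in> G k" "\<And>Q. Q \<in> \<Q> - {K} \<Longrightarrow> x \<notin> Q" using red[OF K(1)] by blast
    then show ?thesis using K P by (metis Diff_iff singletonD)
  next
    case False
    obtain k x where x: "k > 0" "x \<in> G k" "\<And>Q. Q \<in> \<Q> - {P} \<Longrightarrow> x \<notin> Q" using red[OF P] by blast
    show ?thesis
    proof (cases "x \<in> P")
      case xP: True
      obtain j y where y: "j > 0" "y \<in> G j" "y \<notin> P" "\<And>Q. Q \<in> \<Q> - {P} \<Longrightarrow> y \<in> Q"
        using homogeneous_product_avoiding[of "\<Q> - {P}" P] Suc(3,4) P False by (metis DiffE finite_Diff insertI1)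
      have xc: "x \<in> carrier R" and yc: "y \<in> carrier R" using G_carr x(2) y(2) by auto
      have pow: "z [^] (n::nat) \<in> Q \<longleftrightarrow> z \<in> Q" if "Q \<in> \<Q>" "z \<in> carrier R" "0 < n" for z Q n
        using that(3)
      proof (induction n rule: nat_induct_non_zero)
        case (Suc n)
        have Qp: "primeideal Q R" using primes that(1) by blast
        show ?case using Suc primeideal.I_prime[OF Qp _ that(2), of "z [^] n"] that(2)
            ideal.I_l_closed[OF primeideal.axioms(1)[OF Qp] _ , of z "z [^] n"] by auto
      qed (use that in simp)
      \<comment> \<open>Each exponent is the degree of the other element, so the sum is homogeneous
        of degree \<open>j * k\<close>; each prime of the set contains exactly one of the two
        summands.\<close>
      let ?z = "x [^] j \<oplus> y [^] k"
      have c: "x [^] j \<in> carrier R" "y [^] k \<in> carrier R" using xc yc by auto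
      have "x [^] j \<in> G (j * k)" "y [^] k \<in> G (j * k)" using G_pow[OF x(2), of j] G_pow[OF y(2), of k] by (auto simp: mult.commute)
      then have "?z \<in> G (j * k)" by (rule G_add)
      moreover have "?z \<notin> Q" if Q: "Q \<in> \<Q>" for Q
      proof
        assume z: "?z \<in> Q"
        have QI: "ideal Q R" using Suc(4)[OF Q] primeideal.axioms(1) by blast
        have comm: "?z = y [^] k \<oplus> x [^] j" using a_comm[OF c] .
        show False
        proof (cases "Q = P")
          case True
          then have "y [^] k \<in> Q" using ideal_cancel_left[OF QI _ z c(2)] pow[OF Q xc y(1)] xP by simp
          then show False using pow[OF Q yc x(1)] y(3) True by simp
        next
          case False
          then have "x [^] j \<in> Q"
            using ideal_cancel_left[OF QI, of "y [^] k" "x [^] j"] c(1) z comm pow[OF Q yc x(1)] y(4) Q by simp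
          then show False using pow[OF Q xc y(1)] x(3) False Q by simp
        qed
      qed
      ultimately show ?thesis using x(1) y(1) by (intro exI[of _ "j * k"]) auto
    qed (use x in blast)
  qed
qed

text \<open>By hypothesis \<open>d\<close>, \<open>R_+\<close> annihilates no nonzero element of
  \<open>R/I\<close>, so no associated prime contains \<open>R_+\<close>, and avoidance applies to
  these possibly inhomogeneous primes.\<close>

lemma exists_homogeneous_regular:
  assumes I: "ideal I R" "I \<noteq> carrier R"
    and d: "\<And>z. z \<in> carrier R \<Longrightarrow> (\<And>x. x \<in> tail 1 \<Longrightarrow> x \<otimes> z \<in> I) \<Longrightarrow> z \<in> I"
  shows "\<exists>k>0. \<exists>x\<in>G k. colon I x = I"
proof -
  have "\<not> tail 1 \<subseteq> P" if "P \<in> assoc_primes I" for P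
  proof
    assume t: "tail 1 \<subseteq> P"
    have P: "primeideal P R" "\<exists>g\<in>carrier R. P = colon I g"
      using that by (simp_all add: assoc_primes_def)
    then obtain g where g: "g \<in> carrier R" "P = colon I g" by (elim bexE)
    have "x \<otimes> g \<in> I" if "x \<in> tail 1" for x
    proof -
      have "x \<in> colon I g" using subsetD[OF t that] g(2) by (rule back_subst)
      then show ?thesis by (simp add: colon_def)
    qed
    then have "g \<in> I" using d[OF g(1)] by blast
    then show False using colon_eq_carrier[OF I(1)] g(2) primeideal.I_notcarr[OF P(1)] by simp
  qed
  then obtain k x where "k > 0" "x \<in> G k" "\<And>P. P \<in> assoc_primes I \<Longrightarrow> x \<notin> P"
    using homogeneous_prime_avoidance[OF finite_assoc_primes[OF I(1)]] by (auto simp: assoc_primes_def)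
  then show ?thesis using colon_eq_if_avoids_assoc_primes[OF I(1)] G_carr by blast
qed

end

section \<open>Localization and injective resolutions\<close>

text \<open>\<open>injective_module\<close> tests modules carried by the type \<open>'m\<close>, so
  an ideal must first be transported there along an injection \<open>emb\<close>.\<close>

definition ideal_module :: "('r \<Rightarrow> 'm) \<Rightarrow> ('r, 'c) ring_scheme \<Rightarrow> 'r set \<Rightarrow> ('r, 'm) module" where
  "ideal_module emb L K = \<lparr>carrier = emb ` K, monoid.mult = undefined, one = undefined,
     ring.zero = emb \<zero>\<^bsub>L\<^esub>, add = (\<lambda>x y. emb (the_inv emb x \<oplus>\<^bsub>L\<^esub> the_inv emb y)),
     smult = (\<lambda>r x. emb (r \<otimes>\<^bsub>L\<^esub> the_inv emb x))\<rparr>"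

lemma module_ideal_module:
  assumes L: "cring L" and emb: "inj emb" and K: "ideal K L"
  shows "module L (ideal_module emb L K)"
proof -
  interpret L: cring L by (rule L)
  have [simp]: "the_inv emb (emb x) = x" for x using emb by (simp add: the_inv_f_f)
  note c = L.ideal_carr[OF K]
  show ?thesis
  proof (rule moduleI[OF L abelian_groupI])
    fix x assume "x \<in> carrier (ideal_module emb L K)"
    then obtain k where k: "k \<in> K" "x = emb k" by (auto simp: ideal_module_def)
    show "\<exists>y\<in>carrier (ideal_module emb L K). y \<oplus>\<^bsub>ideal_module emb L K\<^esub> x = \<zero>\<^bsub>ideal_module emb L K\<^esub>"
      using k L.ideal_neg[OF K k(1)] c[OF k(1)]
      by (auto simp: ideal_module_def L.l_neg intro!: bexI[of _ "\<ominus>\<^bsub>L\<^esub> k"])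
  qed (auto simp: ideal_module_def c L.ideal_add[OF K] L.ideal_zero[OF K] L.a_ac L.l_distr L.r_distr
      L.m_assoc ideal.I_l_closed[OF K])
qed

text \<open>For \<open>(I : f) e = 0\<close>, the assignment \<open>i + l f \<mapsto> l e\<close> is a homomorphism on the ideal \<open>I + L f\<close>.\<close>

lemma injective_module_lift:
  fixes L :: "('r, 'c) ring_scheme" and E :: "('r, 'm) module" and emb :: "'r \<Rightarrow> 'm"
  assumes L: "cring L" and E: "injective_module L E" and emb: "inj emb" and I: "ideal I L"
    and f: "f \<in> carrier L" and e: "e \<in> carrier E"
    and ann: "\<And>l. l \<in> carrier L \<Longrightarrow> l \<otimes>\<^bsub>L\<^esub> f \<in> I \<Longrightarrow> l \<odot>\<^bsub>E\<^esub> e = \<zero>\<^bsub>E\<^esub>"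
  shows "\<exists>e'\<in>carrier E. (\<forall>i\<in>I. i \<odot>\<^bsub>E\<^esub> e' = \<zero>\<^bsub>E\<^esub>) \<and> f \<odot>\<^bsub>E\<^esub> e' = e"
proof -
  interpret L: cring L by (rule L)
  interpret E: module L E using E by (simp add: injective_module_def)
  have [simp]: "the_inv emb (emb x) = x" for x using emb by (simp add: the_inv_f_f)
  define K where "K = L.adjoin I f"
  have K: "ideal K L" unfolding K_def by (rule L.adjoin_ideal[OF I f])
  have one: "ideal (carrier L) L" by (rule L.oneideal)
  \<comment> \<open>The coefficient of \<open>f\<close> in an element of \<open>I + L f\<close> is
    not unique, but by \<open>wd\<close> its action on \<open>e\<close> is.\<close>
  define l0 where "l0 k = (SOME l. l \<in> carrier L \<and> (\<exists>i\<in>I. k = i \<oplus>\<^bsub>L\<^esub> l \<otimes>\<^bsub>L\<^esub> f))" for k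
  have l0: "l0 k \<in> carrier L \<and> (\<exists>i\<in>I. k = i \<oplus>\<^bsub>L\<^esub> l0 k \<otimes>\<^bsub>L\<^esub> f)" if "k \<in> K" for k
    unfolding l0_def by (rule someI_ex) (use that in \<open>auto simp: K_def L.adjoin_def\<close>)
  have wd: "l0 k \<odot>\<^bsub>E\<^esub> e = l \<odot>\<^bsub>E\<^esub> e" if il: "i \<in> I" "l \<in> carrier L" and k: "k = i \<oplus>\<^bsub>L\<^esub> l \<otimes>\<^bsub>L\<^esub> f" for k i l
  proof -
    have "k \<in> K" unfolding k K_def using L.adjoinI[OF il] .
    then obtain j where j: "j \<in> I" "k = j \<oplus>\<^bsub>L\<^esub> l0 k \<otimes>\<^bsub>L\<^esub> f" "l0 k \<in> carrier L" using l0 by blast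
    have ij: "i \<in> carrier L" "j \<in> carrier L" using L.ideal_carr[OF I] il(1) j(1) by auto
    have "(l0 k \<ominus>\<^bsub>L\<^esub> l) \<otimes>\<^bsub>L\<^esub> f = (j \<oplus>\<^bsub>L\<^esub> l0 k \<otimes>\<^bsub>L\<^esub> f) \<ominus>\<^bsub>L\<^esub> l \<otimes>\<^bsub>L\<^esub> f \<ominus>\<^bsub>L\<^esub> j"
      using ij j(3) il(2) f by algebra
    also have "\<dots> = (i \<oplus>\<^bsub>L\<^esub> l \<otimes>\<^bsub>L\<^esub> f) \<ominus>\<^bsub>L\<^esub> l \<otimes>\<^bsub>L\<^esub> f \<ominus>\<^bsub>L\<^esub> j" using j(2) k by simp
    also have "\<dots> = i \<ominus>\<^bsub>L\<^esub> j" using ij il(2) f by algebra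
    finally have "(l0 k \<ominus>\<^bsub>L\<^esub> l) \<odot>\<^bsub>E\<^esub> e = \<zero>\<^bsub>E\<^esub>"
      using ann[of "l0 k \<ominus>\<^bsub>L\<^esub> l"] L.ideal_diff[OF I il(1) j(1)] j(3) il(2) by simp
    moreover have "l0 k = (l0 k \<ominus>\<^bsub>L\<^esub> l) \<oplus>\<^bsub>L\<^esub> l" using j(3) il(2)
      by (simp add: a_minus_def L.a_assoc L.l_neg)
    ultimately show ?thesis using E.smult_l_distr[of "l0 k \<ominus>\<^bsub>L\<^esub> l" l e] j(3) il(2) e by simp
  qed
  define g where "g x = l0 (the_inv emb x) \<odot>\<^bsub>E\<^esub> e" for x
  have g: "g \<in> mod_hom L (ideal_module emb L K) E"
    unfolding mod_hom_def
  proof (intro CollectI conjI ballI funcsetI)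
    fix x assume "x \<in> carrier (ideal_module emb L K)"
    then obtain a where a: "a \<in> K" "x = emb a" by (auto simp: ideal_module_def)
    obtain i where i: "i \<in> I" "a = i \<oplus>\<^bsub>L\<^esub> l0 a \<otimes>\<^bsub>L\<^esub> f" and la: "l0 a \<in> carrier L" using l0[OF a(1)] by blast
    have ic: "i \<in> carrier L" using L.ideal_carr[OF I i(1)] .
    have gx: "g x = l0 a \<odot>\<^bsub>E\<^esub> e" using a by (simp add: g_def)
    then show "g x \<in> carrier E" using la e by simp
    { fix y assume "y \<in> carrier (ideal_module emb L K)"
      then obtain b where b: "b \<in> K" "y = emb b" by (auto simp: ideal_module_def)
      obtain j where j: "j \<in> I" "b = j \<oplus>\<^bsub>L\<^esub> l0 b \<otimes>\<^bsub>L\<^esub> f" and lb: "l0 b \<in> carrier L" using l0[OF b(1)] by blast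
      have jc: "j \<in> carrier L" using L.ideal_carr[OF I j(1)] .
      have "(i \<oplus>\<^bsub>L\<^esub> l0 a \<otimes>\<^bsub>L\<^esub> f) \<oplus>\<^bsub>L\<^esub> (j \<oplus>\<^bsub>L\<^esub> l0 b \<otimes>\<^bsub>L\<^esub> f) = (i \<oplus>\<^bsub>L\<^esub> j) \<oplus>\<^bsub>L\<^esub> (l0 a \<oplus>\<^bsub>L\<^esub> l0 b) \<otimes>\<^bsub>L\<^esub> f"
        using ic jc la lb f by algebra
      then have "a \<oplus>\<^bsub>L\<^esub> b = (i \<oplus>\<^bsub>L\<^esub> j) \<oplus>\<^bsub>L\<^esub> (l0 a \<oplus>\<^bsub>L\<^esub> l0 b) \<otimes>\<^bsub>L\<^esub> f" using i(2) j(2) by simp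
      then have "l0 (a \<oplus>\<^bsub>L\<^esub> b) \<odot>\<^bsub>E\<^esub> e = (l0 a \<oplus>\<^bsub>L\<^esub> l0 b) \<odot>\<^bsub>E\<^esub> e"
        using wd[OF L.ideal_add[OF I i(1) j(1)]] la lb by simp
      then show "g (x \<oplus>\<^bsub>ideal_module emb L K\<^esub> y) = g x \<oplus>\<^bsub>E\<^esub> g y"
        using a b la lb e by (simp add: g_def ideal_module_def E.smult_l_distr) }
    fix r assume r: "r \<in> carrier L"
    have "r \<otimes>\<^bsub>L\<^esub> (i \<oplus>\<^bsub>L\<^esub> l0 a \<otimes>\<^bsub>L\<^esub> f) = r \<otimes>\<^bsub>L\<^esub> i \<oplus>\<^bsub>L\<^esub> (r \<otimes>\<^bsub>L\<^esub> l0 a) \<otimes>\<^bsub>L\<^esub> f"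
      using r ic la f by algebra
    then have "r \<otimes>\<^bsub>L\<^esub> a = r \<otimes>\<^bsub>L\<^esub> i \<oplus>\<^bsub>L\<^esub> (r \<otimes>\<^bsub>L\<^esub> l0 a) \<otimes>\<^bsub>L\<^esub> f" using i(2) by simp
    then have "l0 (r \<otimes>\<^bsub>L\<^esub> a) \<odot>\<^bsub>E\<^esub> e = (r \<otimes>\<^bsub>L\<^esub> l0 a) \<odot>\<^bsub>E\<^esub> e"
      using wd[OF ideal.I_l_closed[OF I i(1) r]] r la by simp
    then show "g (r \<odot>\<^bsub>ideal_module emb L K\<^esub> x) = r \<odot>\<^bsub>E\<^esub> g x"
      using a r la e by (simp add: g_def ideal_module_def E.smult_assoc1)
  qed
  \<comment> \<open>As in Baer's criterion, \<open>g\<close> is extended along the inclusion of the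
    ideal into the ring, and the image of 1 is the element sought.\<close>
  have id: "id \<in> mod_hom L (ideal_module emb L K) (ideal_module emb L (carrier L))"
    using L.ideal_carr[OF K] by (auto simp: mod_hom_def ideal_module_def)
  have "\<exists>h\<in>mod_hom L (ideal_module emb L (carrier L)) E. \<forall>x\<in>carrier (ideal_module emb L K). h (id x) = g x"
    using E module_ideal_module[OF L emb K] module_ideal_module[OF L emb one] id g
    unfolding injective_module_def by (metis inj_on_id)
  then obtain h where h: "h \<in> mod_hom L (ideal_module emb L (carrier L)) E"
    and hg: "\<And>a. a \<in> K \<Longrightarrow> h (emb a) = g (emb a)" by (auto simp: ideal_module_def)
  define e' where "e' = h (emb \<one>\<^bsub>L\<^esub>)"
  have e': "e' \<in> carrier E" using h by (auto simp: mod_hom_def ideal_module_def e'_def)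
  have he: "h (emb a) = a \<odot>\<^bsub>E\<^esub> e'" if "a \<in> carrier L" for a
  proof -
    have "h (emb (a \<otimes>\<^bsub>L\<^esub> \<one>\<^bsub>L\<^esub>)) = a \<odot>\<^bsub>E\<^esub> h (emb \<one>\<^bsub>L\<^esub>)"
      using h that L.one_closed by (simp add: mod_hom_def ideal_module_def del: L.r_one)
    then show ?thesis using that by (simp add: e'_def)
  qed
  have val: "(i \<oplus>\<^bsub>L\<^esub> l \<otimes>\<^bsub>L\<^esub> f) \<odot>\<^bsub>E\<^esub> e' = l \<odot>\<^bsub>E\<^esub> e" if il: "i \<in> I" "l \<in> carrier L" for i l
  proof -
    have "i \<oplus>\<^bsub>L\<^esub> l \<otimes>\<^bsub>L\<^esub> f \<in> K" unfolding K_def using L.adjoinI[OF il] .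
    then show ?thesis using hg[of "i \<oplus>\<^bsub>L\<^esub> l \<otimes>\<^bsub>L\<^esub> f"] he[of "i \<oplus>\<^bsub>L\<^esub> l \<otimes>\<^bsub>L\<^esub> f"] wd[OF il refl]
        L.ideal_carr[OF K] by (simp add: g_def)
  qed
  show ?thesis
  proof (intro bexI[OF _ e'] conjI ballI)
    show "i \<odot>\<^bsub>E\<^esub> e' = \<zero>\<^bsub>E\<^esub>" if "i \<in> I" for i
      using val[OF that L.zero_closed] L.ideal_carr[OF I that] f e by simp
    show "f \<odot>\<^bsub>E\<^esub> e' = e"
      using val[OF L.ideal_zero[OF I] L.one_closed] f e by simp
  qed
qed

section \<open>Rings of fractions\<close>

locale multiplicative_subset = cring R for R (structure) +
  fixes S :: "'a set"
  assumes S_subset: "S \<subseteq> carrier R" and S_one: "\<one> \<in> S"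
    and S_mult: "s \<in> S \<Longrightarrow> t \<in> S \<Longrightarrow> s \<otimes> t \<in> S"
begin

abbreviation "L \<equiv> localization R S"

definition frac :: "'a \<Rightarrow> 'a \<Rightarrow> ('a \<times> 'a) set" where
  "frac a s = frac_rel R S `` {(a, s)}"

lemma S_carr: "s \<in> S \<Longrightarrow> s \<in> carrier R"
  using S_subset by blast

lemma frac_rel_iff:
  "((a, s), (b, t)) \<in> frac_rel R S \<longleftrightarrow> a \<in> carrier R \<and> s \<in> S \<and> b \<in> carrier R \<and> t \<in> S \<and>
     (\<exists>u\<in>S. u \<otimes> (a \<otimes> t) = u \<otimes> (b \<otimes> s))"
  by (simp add: frac_rel_def)

lemma frac_rel_trans:
  assumes 1: "((a, s), (b, t)) \<in> frac_rel R S" and 2: "((b, t), (c, r)) \<in> frac_rel R S"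
  shows "((a, s), (c, r)) \<in> frac_rel R S"
proof -
  obtain u where u: "u \<in> S" "u \<otimes> (a \<otimes> t) = u \<otimes> (b \<otimes> s)" using 1 by (auto simp: frac_rel_iff)
  obtain v where v: "v \<in> S" "v \<otimes> (b \<otimes> r) = v \<otimes> (c \<otimes> t)" using 2 by (auto simp: frac_rel_iff)
  have m: "a \<in> carrier R" "s \<in> S" "b \<in> carrier R" "t \<in> S" "c \<in> carrier R" "r \<in> S"
    using 1 2 by (auto simp: frac_rel_iff)
  have c: "u \<in> carrier R" "v \<in> carrier R" "s \<in> carrier R" "t \<in> carrier R" "r \<in> carrier R"
    using u(1) v(1) m S_carr by auto
  have "(u \<otimes> v \<otimes> t) \<otimes> (a \<otimes> r) = v \<otimes> r \<otimes> (u \<otimes> (a \<otimes> t))" using c m(1,3,5) by algebra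
  also have "\<dots> = v \<otimes> r \<otimes> (u \<otimes> (b \<otimes> s))" using u(2) by simp
  also have "\<dots> = u \<otimes> s \<otimes> (v \<otimes> (b \<otimes> r))" using c m(1,3,5) by algebra
  also have "\<dots> = u \<otimes> s \<otimes> (v \<otimes> (c \<otimes> t))" using v(2) by simp
  also have "\<dots> = (u \<otimes> v \<otimes> t) \<otimes> (c \<otimes> s)" using c m(1,3,5) by algebra
  finally show ?thesis using m u(1) v(1) S_mult unfolding frac_rel_iff by blast
qed

lemma frac_rel_sym: "(x, y) \<in> frac_rel R S \<Longrightarrow> (y, x) \<in> frac_rel R S"
  by (cases x, cases y) (auto simp: frac_rel_iff dest: sym)

lemma equiv_frac_rel: "equiv (carrier R \<times> S) (frac_rel R S)"
proof (rule equivI)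
  show "frac_rel R S \<subseteq> (carrier R \<times> S) \<times> (carrier R \<times> S)" by (auto simp: frac_rel_def)
  show "refl_on (carrier R \<times> S) (frac_rel R S)"
    using S_one by (auto simp: refl_on_def frac_rel_iff)
  show "sym (frac_rel R S)" by (rule symI) (rule frac_rel_sym)
  show "trans (frac_rel R S)" by (rule transI) (use frac_rel_trans in \<open>auto simp del: split_paired_All\<close>)
qed

lemma frac_eq_iff:
  assumes "a \<in> carrier R" "s \<in> S" "b \<in> carrier R" "t \<in> S"
  shows "frac a s = frac b t \<longleftrightarrow> (\<exists>u\<in>S. u \<otimes> (a \<otimes> t) = u \<otimes> (b \<otimes> s))"
  unfolding frac_def
  using eq_equiv_class_iff[OF equiv_frac_rel, of "(a, s)" "(b, t)"] assms by (simp add: frac_rel_iff)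

lemma frac_closed: "a \<in> carrier R \<Longrightarrow> s \<in> S \<Longrightarrow> frac a s \<in> carrier L"
  by (auto simp: localization_def frac_def intro: quotientI)

lemma frac_cases:
  assumes "l \<in> carrier L"
  obtains a s where "a \<in> carrier R" "s \<in> S" "l = frac a s"
  using assms by (auto simp: localization_def frac_def elim!: quotientE)

lemma frac_mem:
  assumes "x \<in> frac a s"
  shows "fst x \<in> carrier R" "snd x \<in> S" "frac (fst x) (snd x) = frac a s"
proof -
  have x: "((a, s), (fst x, snd x)) \<in> frac_rel R S" using assms by (simp add: frac_def)
  then show "fst x \<in> carrier R" "snd x \<in> S" unfolding frac_rel_iff by auto
  show "frac (fst x) (snd x) = frac a s"
    unfolding frac_def using equiv_class_eq[OF equiv_frac_rel x] by simp
qed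

lemma frac_self: "a \<in> carrier R \<Longrightarrow> s \<in> S \<Longrightarrow> (a, s) \<in> frac a s"
  using equiv_class_self[OF equiv_frac_rel, of "(a, s)"] by (simp add: frac_def)

text \<open>The operations of \<open>localization\<close> are unions over all representatives; once
  the value does not depend on them, the union collapses to it.\<close>

lemma UN_frac:
  assumes a: "a \<in> carrier R" "s \<in> S" and b: "b \<in> carrier R" "t \<in> S"
    and F: "\<And>a' s' b' t'. \<lbrakk>a' \<in> carrier R; s' \<in> S; b' \<in> carrier R; t' \<in> S; frac a' s' = frac a s; frac b' t' = frac b t\<rbrakk>
      \<Longrightarrow> F (a', s') (b', t') = K"
  shows "(\<Union>x\<in>frac a s. \<Union>y\<in>frac b t. F x y) = K"
proof -
  have "F x y = K" if "x \<in> frac a s" "y \<in> frac b t" for x y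
    using F[of "fst x" "snd x" "fst y" "snd y"] frac_mem[OF that(1)] frac_mem[OF that(2)] by simp
  then show ?thesis using frac_self[OF a] frac_self[OF b] by auto
qed

lemma frac_mult:
  assumes a: "a \<in> carrier R" "s \<in> S" and b: "b \<in> carrier R" "t \<in> S"
  shows "frac a s \<otimes>\<^bsub>L\<^esub> frac b t = frac (a \<otimes> b) (s \<otimes> t)"
proof -
  have "(\<Union>x\<in>frac a s. \<Union>y\<in>frac b t. frac (fst x \<otimes> fst y) (snd x \<otimes> snd y)) = frac (a \<otimes> b) (s \<otimes> t)"
  proof (rule UN_frac[OF a b])
    fix a' s' b' t' assume m: "a' \<in> carrier R" "s' \<in> S" "b' \<in> carrier R" "t' \<in> S"
      and e: "frac a' s' = frac a s" "frac b' t' = frac b t"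
    obtain u where u: "u \<in> S" "u \<otimes> (a' \<otimes> s) = u \<otimes> (a \<otimes> s')" using e(1) m a by (auto simp: frac_eq_iff)
    obtain v where v: "v \<in> S" "v \<otimes> (b' \<otimes> t) = v \<otimes> (b \<otimes> t')" using e(2) m b by (auto simp: frac_eq_iff)
    have c: "u \<in> carrier R" "v \<in> carrier R" "s \<in> carrier R" "t \<in> carrier R" "s' \<in> carrier R" "t' \<in> carrier R"
      using u(1) v(1) m a b S_carr by auto
    have "(u \<otimes> v) \<otimes> ((a' \<otimes> b') \<otimes> (s \<otimes> t)) = (u \<otimes> (a' \<otimes> s)) \<otimes> (v \<otimes> (b' \<otimes> t))"
      using c m(1,3) a(1) b(1) by algebra
    also have "\<dots> = (u \<otimes> (a \<otimes> s')) \<otimes> (v \<otimes> (b \<otimes> t'))" using u(2) v(2) by simp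
    also have "\<dots> = (u \<otimes> v) \<otimes> ((a \<otimes> b) \<otimes> (s' \<otimes> t'))" using c m(1,3) a(1) b(1) by algebra
    finally show "frac (fst (a', s') \<otimes> fst (b', t')) (snd (a', s') \<otimes> snd (b', t')) = frac (a \<otimes> b) (s \<otimes> t)"
      using m a b u(1) v(1) S_mult by (auto simp: frac_eq_iff)
  qed
  then show ?thesis by (simp add: localization_def frac_def)
qed

lemma frac_add:
  assumes a: "a \<in> carrier R" "s \<in> S" and b: "b \<in> carrier R" "t \<in> S"
  shows "frac a s \<oplus>\<^bsub>L\<^esub> frac b t = frac (a \<otimes> t \<oplus> b \<otimes> s) (s \<otimes> t)"
proof -
  have "(\<Union>x\<in>frac a s. \<Union>y\<in>frac b t. frac (fst x \<otimes> snd y \<oplus> fst y \<otimes> snd x) (snd x \<otimes> snd y))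
      = frac (a \<otimes> t \<oplus> b \<otimes> s) (s \<otimes> t)"
  proof (rule UN_frac[OF a b])
    fix a' s' b' t' assume m: "a' \<in> carrier R" "s' \<in> S" "b' \<in> carrier R" "t' \<in> S"
      and e: "frac a' s' = frac a s" "frac b' t' = frac b t"
    obtain u where u: "u \<in> S" "u \<otimes> (a' \<otimes> s) = u \<otimes> (a \<otimes> s')" using e(1) m a by (auto simp: frac_eq_iff)
    obtain v where v: "v \<in> S" "v \<otimes> (b' \<otimes> t) = v \<otimes> (b \<otimes> t')" using e(2) m b by (auto simp: frac_eq_iff)
    have c: "u \<in> carrier R" "v \<in> carrier R" "s \<in> carrier R" "t \<in> carrier R" "s' \<in> carrier R" "t' \<in> carrier R"
      using u(1) v(1) m a b S_carr by auto
    have "(u \<otimes> v) \<otimes> ((a' \<otimes> t' \<oplus> b' \<otimes> s') \<otimes> (s \<otimes> t))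
        = (v \<otimes> t \<otimes> t') \<otimes> (u \<otimes> (a' \<otimes> s)) \<oplus> (u \<otimes> s \<otimes> s') \<otimes> (v \<otimes> (b' \<otimes> t))"
      using c m(1,3) a(1) b(1) by algebra
    also have "\<dots> = (v \<otimes> t \<otimes> t') \<otimes> (u \<otimes> (a \<otimes> s')) \<oplus> (u \<otimes> s \<otimes> s') \<otimes> (v \<otimes> (b \<otimes> t'))"
      using u(2) v(2) by simp
    also have "\<dots> = (u \<otimes> v) \<otimes> ((a \<otimes> t \<oplus> b \<otimes> s) \<otimes> (s' \<otimes> t'))" using c m(1,3) a(1) b(1) by algebra
    finally show "frac (fst (a', s') \<otimes> snd (b', t') \<oplus> fst (b', t') \<otimes> snd (a', s')) (snd (a', s') \<otimes> snd (b', t'))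
        = frac (a \<otimes> t \<oplus> b \<otimes> s) (s \<otimes> t)"
      using m a b u(1) v(1) S_mult c by (auto simp: frac_eq_iff)
  qed
  then show ?thesis by (simp add: localization_def frac_def)
qed

lemma frac_one: "\<one>\<^bsub>L\<^esub> = frac \<one> \<one>" and frac_zero: "\<zero>\<^bsub>L\<^esub> = frac \<zero> \<one>"
  by (simp_all add: localization_def frac_def)

definition loc :: "'a \<Rightarrow> ('a \<times> 'a) set" where
  "loc a = frac a \<one>"

lemma loc_closed [simp]: "a \<in> carrier R \<Longrightarrow> loc a \<in> carrier L"
  by (simp add: loc_def frac_closed S_one)

lemma loc_mult: "a \<in> carrier R \<Longrightarrow> b \<in> carrier R \<Longrightarrow> loc (a \<otimes> b) = loc a \<otimes>\<^bsub>L\<^esub> loc b"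
  by (simp add: loc_def frac_mult S_one)

lemma loc_add: "a \<in> carrier R \<Longrightarrow> b \<in> carrier R \<Longrightarrow> loc (a \<oplus> b) = loc a \<oplus>\<^bsub>L\<^esub> loc b"
  by (simp add: loc_def frac_add S_one)

lemma loc_one: "loc \<one> = \<one>\<^bsub>L\<^esub>" and loc_zero: "loc \<zero> = \<zero>\<^bsub>L\<^esub>"
  by (simp_all add: loc_def frac_one frac_zero)

lemma loc_eqD: "a \<in> carrier R \<Longrightarrow> b \<in> carrier R \<Longrightarrow> loc a = loc b \<Longrightarrow> \<exists>w\<in>S. w \<otimes> a = w \<otimes> b"
  by (auto simp: loc_def frac_eq_iff S_one)

lemma loc_denominator:
  assumes "l \<in> carrier L"
  shows "\<exists>s\<in>S. \<exists>a\<in>carrier R. loc s \<otimes>\<^bsub>L\<^esub> l = loc a"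
proof -
  obtain a s where as: "a \<in> carrier R" "s \<in> S" "l = frac a s" using frac_cases[OF assms] .
  have sc: "s \<in> carrier R" using as S_carr by blast
  have "frac (s \<otimes> a) s = frac a \<one>"
    using as sc S_one by (auto simp: frac_eq_iff m_comm intro!: bexI[of _ \<one>])
  then have "loc s \<otimes>\<^bsub>L\<^esub> l = loc a" using as sc S_one by (simp add: loc_def frac_mult)
  then show ?thesis using as by blast
qed

lemma loc_unit:
  assumes "s \<in> S"
  shows "\<exists>l\<in>carrier L. l \<otimes>\<^bsub>L\<^esub> loc s = \<one>\<^bsub>L\<^esub>"
proof -
  have sc: "s \<in> carrier R" using assms S_carr by blast
  have "frac s s = frac \<one> \<one>"
    using assms sc S_one by (auto simp: frac_eq_iff intro!: bexI[of _ \<one>])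
  then have "frac \<one> s \<otimes>\<^bsub>L\<^esub> loc s = \<one>\<^bsub>L\<^esub>" using assms sc S_one by (simp add: loc_def frac_mult frac_one)
  then show ?thesis using frac_closed[OF one_closed assms] by blast
qed

lemma smult_loc_unit_zero:
  assumes E: "module L E" and s: "s \<in> S" and e: "e \<in> carrier E" "loc s \<odot>\<^bsub>E\<^esub> e = \<zero>\<^bsub>E\<^esub>"
  shows "e = \<zero>\<^bsub>E\<^esub>"
proof -
  interpret E: module L E by (rule E)
  obtain l where l: "l \<in> carrier L" "l \<otimes>\<^bsub>L\<^esub> loc s = \<one>\<^bsub>L\<^esub>" using loc_unit[OF s] by blast
  have "e = (l \<otimes>\<^bsub>L\<^esub> loc s) \<odot>\<^bsub>E\<^esub> e" using l e by simp
  also have "\<dots> = l \<odot>\<^bsub>E\<^esub> (loc s \<odot>\<^bsub>E\<^esub> e)" using l(1) e(1) s S_carr by (simp add: E.smult_assoc1)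
  finally show ?thesis using e l by simp
qed

definition restrict_scalars :: "(('a \<times> 'a) set, 'm) module \<Rightarrow> ('a, 'm) module" where
  "restrict_scalars E = \<lparr>carrier = carrier E, monoid.mult = monoid.mult E, one = one E,
     ring.zero = ring.zero E, add = add E, smult = (\<lambda>r. smult E (loc r))\<rparr>"

lemma restrict_scalars_simps [simp]:
  "carrier (restrict_scalars E) = carrier E" "\<zero>\<^bsub>restrict_scalars E\<^esub> = \<zero>\<^bsub>E\<^esub>"
  "x \<oplus>\<^bsub>restrict_scalars E\<^esub> y = x \<oplus>\<^bsub>E\<^esub> y" "r \<odot>\<^bsub>restrict_scalars E\<^esub> x = loc r \<odot>\<^bsub>E\<^esub> x"
  by (simp_all add: restrict_scalars_def)

lemma module_restrict_scalars:
  assumes "module L E"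
  shows "module R (restrict_scalars E)"
proof -
  interpret E: module L E by (rule assms)
  show ?thesis
  proof (rule moduleI[OF cring_axioms abelian_groupI])
    fix x assume "x \<in> carrier (restrict_scalars E)"
    then show "\<exists>y\<in>carrier (restrict_scalars E). y \<oplus>\<^bsub>restrict_scalars E\<^esub> x = \<zero>\<^bsub>restrict_scalars E\<^esub>"
      by (intro bexI[of _ "\<ominus>\<^bsub>E\<^esub> x"]) (auto simp: E.M.l_neg)
  qed (auto simp: E.M.a_ac E.smult_l_distr E.smult_r_distr E.smult_assoc1 loc_add loc_mult loc_one)
qed

text \<open>The lifting problem is solved over the localization for the extended ideal
  \<open>IL\<close>. The condition on \<open>e\<close> survives the extension because elements of
  \<open>S\<close> act injectively on \<open>E\<close>.\<close>

lemma restrict_scalars_lift: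
  fixes E :: "(('a \<times> 'a) set, 'm) module" and emb :: "('a \<times> 'a) set \<Rightarrow> 'm"
  assumes L: "cring L" and E: "injective_module L E" and emb: "inj emb" and I: "ideal I R"
    and f: "f \<in> carrier R" and e: "e \<in> carrier E"
    and ann: "\<And>r. r \<in> colon I f \<Longrightarrow> loc r \<odot>\<^bsub>E\<^esub> e = \<zero>\<^bsub>E\<^esub>"
  shows "\<exists>e'\<in>carrier E. (\<forall>r\<in>I. loc r \<odot>\<^bsub>E\<^esub> e' = \<zero>\<^bsub>E\<^esub>) \<and> loc f \<odot>\<^bsub>E\<^esub> e' = e"
proof -
  interpret L: cring L by (rule L)
  have EM: "module L E" using E by (simp add: injective_module_def)
  interpret E: module L E by (rule EM)
  note Ic = ideal_carr[OF I]
  define IL where "IL = {l \<in> carrier L. \<exists>s\<in>S. \<exists>i\<in>I. loc s \<otimes>\<^bsub>L\<^esub> l = loc i}"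
  have IL: "ideal IL L"
  proof (rule L.idealI_cring)
    show "IL \<subseteq> carrier L" by (auto simp: IL_def)
    show "\<zero>\<^bsub>L\<^esub> \<in> IL"
    proof -
      have "loc \<one> \<otimes>\<^bsub>L\<^esub> \<zero>\<^bsub>L\<^esub> = loc \<zero>" by (simp add: loc_one loc_zero)
      then show ?thesis unfolding IL_def using S_one ideal_zero[OF I] L.zero_closed by blast
    qed
    fix x assume "x \<in> IL"
    then obtain s i where x: "x \<in> carrier L" "s \<in> S" "i \<in> I" "loc s \<otimes>\<^bsub>L\<^esub> x = loc i" by (auto simp: IL_def)
    have c: "s \<in> carrier R" "i \<in> carrier R" using x S_carr Ic by auto
    { fix y assume "y \<in> IL"
      then obtain t j where y: "y \<in> carrier L" "t \<in> S" "j \<in> I" "loc t \<otimes>\<^bsub>L\<^esub> y = loc j" by (auto simp: IL_def)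
      have d: "t \<in> carrier R" "j \<in> carrier R" using y S_carr Ic by auto
      have "loc (s \<otimes> t) \<otimes>\<^bsub>L\<^esub> (x \<oplus>\<^bsub>L\<^esub> y) = loc t \<otimes>\<^bsub>L\<^esub> (loc s \<otimes>\<^bsub>L\<^esub> x) \<oplus>\<^bsub>L\<^esub> loc s \<otimes>\<^bsub>L\<^esub> (loc t \<otimes>\<^bsub>L\<^esub> y)"
        unfolding loc_mult[OF c(1) d(1)]
        using loc_closed[OF c(1)] loc_closed[OF d(1)] x(1) y(1) by algebra
      also have "\<dots> = loc (t \<otimes> i \<oplus> s \<otimes> j)" using c d x(4) y(4) by (simp add: loc_mult loc_add)
      finally have "loc (s \<otimes> t) \<otimes>\<^bsub>L\<^esub> (x \<oplus>\<^bsub>L\<^esub> y) = loc (t \<otimes> i \<oplus> s \<otimes> j)" .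
      moreover have "t \<otimes> i \<oplus> s \<otimes> j \<in> I"
        by (intro ideal_add[OF I] ideal.I_l_closed[OF I] x y c d)
      ultimately show "x \<oplus>\<^bsub>L\<^esub> y \<in> IL" using x(1) y(1) S_mult[OF x(2) y(2)] by (auto simp: IL_def) }
    fix r assume r: "r \<in> carrier L"
    then obtain t a where t: "t \<in> S" "a \<in> carrier R" "loc t \<otimes>\<^bsub>L\<^esub> r = loc a" using loc_denominator by blast
    have tc: "t \<in> carrier R" using t S_carr by blast
    have "loc (t \<otimes> s) \<otimes>\<^bsub>L\<^esub> (r \<otimes>\<^bsub>L\<^esub> x) = (loc t \<otimes>\<^bsub>L\<^esub> r) \<otimes>\<^bsub>L\<^esub> (loc s \<otimes>\<^bsub>L\<^esub> x)"
      unfolding loc_mult[OF tc c(1)] using loc_closed[OF c(1)] loc_closed[OF tc] x(1) r by algebra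
    also have "\<dots> = loc (a \<otimes> i)" using t x c by (simp add: loc_mult)
    finally show "r \<otimes>\<^bsub>L\<^esub> x \<in> IL"
      using r x(1) S_mult[OF t(1) x(2)] ideal.I_l_closed[OF I x(3) t(2)] by (auto simp: IL_def)
  qed
  have "\<exists>e'\<in>carrier E. (\<forall>i\<in>IL. i \<odot>\<^bsub>E\<^esub> e' = \<zero>\<^bsub>E\<^esub>) \<and> loc f \<odot>\<^bsub>E\<^esub> e' = e"
  proof (rule injective_module_lift[OF L E emb IL loc_closed[OF f] e])
    fix l assume l: "l \<in> carrier L" "l \<otimes>\<^bsub>L\<^esub> loc f \<in> IL"
    obtain s i where s: "s \<in> S" "i \<in> I" "loc s \<otimes>\<^bsub>L\<^esub> (l \<otimes>\<^bsub>L\<^esub> loc f) = loc i" using l(2) by (auto simp: IL_def)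
    obtain t a where t: "t \<in> S" "a \<in> carrier R" "loc t \<otimes>\<^bsub>L\<^esub> l = loc a" using loc_denominator[OF l(1)] by blast
    have c: "s \<in> carrier R" "i \<in> carrier R" "t \<in> carrier R" using s t S_carr Ic by auto
    have "loc (s \<otimes> a \<otimes> f) = loc s \<otimes>\<^bsub>L\<^esub> (loc t \<otimes>\<^bsub>L\<^esub> l) \<otimes>\<^bsub>L\<^esub> loc f" using c t f by (simp add: loc_mult)
    also have "\<dots> = loc t \<otimes>\<^bsub>L\<^esub> (loc s \<otimes>\<^bsub>L\<^esub> (l \<otimes>\<^bsub>L\<^esub> loc f))"
      using loc_closed[OF c(1)] loc_closed[OF c(3)] loc_closed[OF f] l(1) by algebra
    also have "\<dots> = loc (t \<otimes> i)" using s c by (simp add: loc_mult)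
    \<comment> \<open>Clearing denominators turns \<open>l f\<close> in \<open>IL\<close> into
      \<open>w s a\<close> in \<open>I : f\<close>, where \<open>ann\<close> applies.\<close>
    finally obtain w where w: "w \<in> S" "w \<otimes> (s \<otimes> a \<otimes> f) = w \<otimes> (t \<otimes> i)"
      using loc_eqD[of "s \<otimes> a \<otimes> f" "t \<otimes> i"] c t f by auto
    have wc: "w \<in> carrier R" using w S_carr by blast
    have "(w \<otimes> s \<otimes> a) \<otimes> f = w \<otimes> (s \<otimes> a \<otimes> f)" using wc c t(2) f by algebra
    moreover have "w \<otimes> (t \<otimes> i) \<in> I" by (intro ideal.I_l_closed[OF I] s c wc)
    ultimately have "w \<otimes> s \<otimes> a \<in> colon I f" using w(2) wc c t(2) by (simp add: colon_def)
    then have "loc (w \<otimes> s \<otimes> a) \<odot>\<^bsub>E\<^esub> e = \<zero>\<^bsub>E\<^esub>" by (rule ann)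
    moreover have "loc (w \<otimes> s \<otimes> a) = loc (w \<otimes> s \<otimes> t) \<otimes>\<^bsub>L\<^esub> l"
      using wc c t l(1) by (simp add: loc_mult L.m_assoc)
    ultimately have "loc (w \<otimes> s \<otimes> t) \<odot>\<^bsub>E\<^esub> (l \<odot>\<^bsub>E\<^esub> e) = \<zero>\<^bsub>E\<^esub>"
      using wc c l(1) e by (simp add: E.smult_assoc1)
    then show "l \<odot>\<^bsub>E\<^esub> e = \<zero>\<^bsub>E\<^esub>"
      using smult_loc_unit_zero[OF EM S_mult[OF S_mult[OF w(1) s(1)] t(1)]] l(1) e by blast
  qed
  then obtain e' where "e' \<in> carrier E" "\<And>i. i \<in> IL \<Longrightarrow> i \<odot>\<^bsub>E\<^esub> e' = \<zero>\<^bsub>E\<^esub>" "loc f \<odot>\<^bsub>E\<^esub> e' = e" by blast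
  moreover have "loc i \<in> IL" if "i \<in> I" for i
  proof -
    have "loc \<one> \<otimes>\<^bsub>L\<^esub> loc i = loc i" using Ic[OF that] by (simp add: loc_one)
    then show ?thesis unfolding IL_def using that S_one loc_closed[OF Ic[OF that]] by blast
  qed
  ultimately show ?thesis by blast
qed

end

context graded_ring
begin

lemma multiplicative_complement: "multiplicative_subset R (carrier R - tail 1)"
proof
  show "\<one> \<in> carrier R - tail 1" using one_notin_tail by simp
  fix s t assume st: "s \<in> carrier R - tail 1" "t \<in> carrier R - tail 1"
  then have st': "s \<in> carrier R" "t \<in> carrier R" "t \<notin> tail 1" "s \<notin> tail 1" by auto
  have "s \<otimes> t \<notin> tail 1"
    using homogeneous_saturated[of "tail 1"] primeideal.I_prime[OF maximalideal_prime[OF tail_1_maximal] st'(1,2)] st'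
    by blast
  then show "s \<otimes> t \<in> carrier R - tail 1" using st' by simp
qed auto

text \<open>The terms of a finite injective resolution of the localization at \<open>R\<^sub>+\<close>, seen as \<open>R\<close>-modules.\<close>

lemma gorenstein_injective_complex:
  assumes "gorenstein_ring R"
  obtains C :: "nat \<Rightarrow> ('a, (('a \<times> 'a) set \<times> ('a \<times> 'a) set \<times> nat) set) module" and d \<theta>
  where "injective_complex R C d (tail 1) \<theta>"
proof -
  define S where "S = carrier R - tail 1"
  interpret S: multiplicative_subset R S unfolding S_def by (rule multiplicative_complement)
  let ?L = "localization R S"
  have gor: "gorenstein_local_ring ?L"
    using assms tail_1_maximal by (simp add: gorenstein_ring_def localization_at_def S_def)
  have L: "cring ?L" using gor by (simp add: gorenstein_local_ring_def local_ring_def)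
  interpret L: cring ?L by (rule L)
  have "inj_dim ?L (self_module ?L) < \<infinity>" using gor by (simp add: gorenstein_local_ring_def)
  \<comment> \<open>An infimum over the empty set would be infinite, so finiteness provides an
    actual resolution.\<close>
  then have "{enat n | n. \<exists>(E :: nat \<Rightarrow> (('a \<times> 'a) set, (('a \<times> 'a) set \<times> ('a \<times> 'a) set \<times> nat) set) module) \<epsilon> d.
       injective_resolution ?L (self_module ?L) E \<epsilon> d \<and> (\<forall>i>n. carrier (E i) = {\<zero>\<^bsub>E i\<^esub>})} \<noteq> {}"
    unfolding inj_dim_def by (metis Inf_empty infinity_enat_def top_enat_def order_less_irrefl)
  then obtain n \<epsilon> d and E :: "nat \<Rightarrow> (('a \<times> 'a) set, (('a \<times> 'a) set \<times> ('a \<times> 'a) set \<times> nat) set) module"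
    where res: "injective_resolution ?L (self_module ?L) E \<epsilon> d" and n: "\<And>i. n < i \<Longrightarrow> carrier (E i) = {\<zero>\<^bsub>E i\<^esub>}"
    by blast
  have inj: "injective_module ?L (E i)" for i using res by (simp add: injective_resolution_def)
  have EM: "module ?L (E i)" for i using inj[of i] by (simp add: injective_module_def)
  interpret E: module ?L "E i" for i by (rule EM)
  have dh: "d i \<in> mod_hom ?L (E i) (E (Suc i))" for i using res by (simp add: injective_resolution_def)
  have \<epsilon>: "\<epsilon> \<in> mod_hom ?L (self_module ?L) (E 0)" "inj_on \<epsilon> (carrier ?L)"
    "\<epsilon> ` carrier ?L = mod_ker (E 0) (E 1) (d 0)"
    using res by (simp_all add: injective_resolution_def self_module_def)
  have ex: "d i ` carrier (E i) = mod_ker (E (Suc i)) (E (Suc (Suc i))) (d (Suc i))" for i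
    using res by (simp add: injective_resolution_def)
  have \<epsilon>c: "\<epsilon> l \<in> carrier (E 0)" if "l \<in> carrier ?L" for l
    using \<epsilon>(1) that by (auto simp: mod_hom_def self_module_def)
  have \<epsilon>m: "\<epsilon> l = l \<odot>\<^bsub>E 0\<^esub> \<epsilon> \<one>\<^bsub>?L\<^esub>" if "l \<in> carrier ?L" for l
  proof -
    have "\<epsilon> (l \<otimes>\<^bsub>?L\<^esub> \<one>\<^bsub>?L\<^esub>) = l \<odot>\<^bsub>E 0\<^esub> \<epsilon> \<one>\<^bsub>?L\<^esub>"
      using \<epsilon>(1) that L.one_closed by (simp add: mod_hom_def self_module_def del: L.r_one)
    then show ?thesis using that by simp
  qed
  have \<epsilon>z: "\<epsilon> \<zero>\<^bsub>?L\<^esub> = \<zero>\<^bsub>E 0\<^esub>" using \<epsilon>m[OF L.zero_closed] \<epsilon>c[OF L.one_closed] by simp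
  \<comment> \<open>Any injection of the localization into the carrier type of the resolution would
    do; it supplies the test modules for injectivity.\<close>
  define emb :: "('a \<times> 'a) set \<Rightarrow> (('a \<times> 'a) set \<times> ('a \<times> 'a) set \<times> nat) set" where "emb x = {(x, x, 0)}" for x
  have emb: "inj emb" by (auto simp: inj_def emb_def)
  \<comment> \<open>The zero module placed in front, so that the resolution starts in degree
    1.\<close>
  define Z :: "('a, (('a \<times> 'a) set \<times> ('a \<times> 'a) set \<times> nat) set) module"
    where "Z = S.restrict_scalars (E 0) \<lparr>carrier := {\<zero>\<^bsub>E 0\<^esub>}\<rparr>"
  have Z: "carrier Z = {\<zero>\<^bsub>E 0\<^esub>}" "\<zero>\<^bsub>Z\<^esub> = \<zero>\<^bsub>E 0\<^esub>" "x \<oplus>\<^bsub>Z\<^esub> y = x \<oplus>\<^bsub>E 0\<^esub> y"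
    "r \<odot>\<^bsub>Z\<^esub> x = S.loc r \<odot>\<^bsub>E 0\<^esub> x" for x y r by (simp_all add: Z_def S.restrict_scalars_def)
  have ZM: "module R Z"
    by (rule moduleI[OF cring_axioms abelian_groupI]) (auto simp: Z)
  define C where "C i = (case i of 0 \<Rightarrow> Z | Suc j \<Rightarrow> S.restrict_scalars (E j))" for i
  define d' where "d' i = (case i of 0 \<Rightarrow> \<lambda>x. x | Suc j \<Rightarrow> d j)" for i
  have C0: "C 0 = Z" and CS: "C (Suc j) = S.restrict_scalars (E j)" for j by (simp_all add: C_def)
  have d0: "d' 0 = (\<lambda>x. x)" and dS: "d' (Suc j) = d j" for j by (simp_all add: d'_def)
  have dz: "d i \<zero>\<^bsub>E i\<^esub> = \<zero>\<^bsub>E (Suc i)\<^esub>" for i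
  proof -
    have "d i (\<zero>\<^bsub>?L\<^esub> \<odot>\<^bsub>E i\<^esub> \<zero>\<^bsub>E i\<^esub>) = \<zero>\<^bsub>?L\<^esub> \<odot>\<^bsub>E (Suc i)\<^esub> d i \<zero>\<^bsub>E i\<^esub>"
      using dh[of i] by (simp add: mod_hom_def del: E.smult_l_null E.smult_r_null)
    moreover have "d i \<zero>\<^bsub>E i\<^esub> \<in> carrier (E (Suc i))" using dh[of i] by (auto simp: mod_hom_def)
    ultimately show ?thesis by simp
  qed
  have "injective_complex R C d' (tail 1) (\<epsilon> \<one>\<^bsub>?L\<^esub>)"
  proof (rule injective_complex.intro[OF noetherian_cring_axioms], rule injective_complex_axioms.intro)
    fix i
    show "module R (C i)" using ZM S.module_restrict_scalars[OF EM] by (cases i) (simp_all add: C0 CS)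
    show "d' i \<in> mod_hom R (C i) (C (Suc i))"
      using dh[of "i - 1"] by (cases i) (auto simp: C0 CS d0 dS mod_hom_def Z)
    show "d' (Suc i) (d' i e) = \<zero>\<^bsub>C (Suc (Suc i))\<^esub>" if "e \<in> carrier (C i)" for e
    proof (cases i)
      case 0
      then show ?thesis using that by (simp add: C0 CS d0 dS Z dz)
    next
      case (Suc j)
      then show ?thesis using that ex[of j] by (auto simp: CS dS mod_ker_def)
    qed
    show "\<exists>e'\<in>carrier (C i). (\<forall>r\<in>I. r \<odot>\<^bsub>C i\<^esub> e' = \<zero>\<^bsub>C i\<^esub>) \<and> f \<odot>\<^bsub>C i\<^esub> e' = e"
      if I: "ideal I R" and f: "f \<in> carrier R" and e: "e \<in> carrier (C i)"
        and ann: "\<And>r. r \<in> colon I f \<Longrightarrow> r \<odot>\<^bsub>C i\<^esub> e = \<zero>\<^bsub>C i\<^esub>" for I f e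
    proof (cases i)
      case 0
      then show ?thesis using e f ideal_carr[OF I] by (simp add: C0 Z)
    next
      case (Suc j)
      then show ?thesis
        using S.restrict_scalars_lift[OF L inj[of j] emb I f, of e] e ann by (simp add: CS)
    qed
    show "e \<in> d' i ` carrier (C i)"
      if "0 < i" "e \<in> carrier (C (Suc i))" "d' (Suc i) e = \<zero>\<^bsub>C (Suc (Suc i))\<^esub>" for e
      using that ex[of "i - 1"] by (cases i) (simp_all add: CS dS mod_ker_def)
  next
    show "\<exists>n. \<forall>i>n. carrier (C i) = {\<zero>\<^bsub>C i\<^esub>}"
    proof (intro exI allI impI)
      \<comment> \<open>\<open>Suc n\<close> accounts for the shift by one.\<close>
      fix i assume i: "Suc n < i"
      then show "carrier (C i) = {\<zero>\<^bsub>C i\<^esub>}" using n[of "i - 1"] by (cases i) (auto simp: CS)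
    qed
    show "carrier (C 0) = {\<zero>\<^bsub>C 0\<^esub>}" by (simp add: C0 Z)
    show "maximalideal (tail 1) R" by (rule tail_1_maximal)
    show "\<exists>x\<in>tail 1. colon I x = I"
      if depth: "ideal I R" "I \<noteq> carrier R" "\<And>z. z \<in> carrier R \<Longrightarrow> (\<And>x. x \<in> tail 1 \<Longrightarrow> x \<otimes> z \<in> I) \<Longrightarrow> z \<in> I" for I
    proof -
      obtain k x where "k > 0" "x \<in> G k" "colon I x = I" using exists_homogeneous_regular[OF depth] by blast
      then show ?thesis using G_tail[of x k 1] by auto
    qed
    \<comment> \<open>The kernel of the first differential is a copy of the localization, whose
      elements become multiples of 1 after clearing denominators; hence the image of 1 serves as
      generator.\<close>
    show "\<epsilon> \<one>\<^bsub>?L\<^esub> \<in> carrier (C 1)" using \<epsilon>c L.one_closed by (simp add: CS)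
    have "\<epsilon> \<one>\<^bsub>?L\<^esub> \<in> mod_ker (E 0) (E 1) (d 0)" using \<epsilon>(3) L.one_closed by blast
    then show "d' 1 (\<epsilon> \<one>\<^bsub>?L\<^esub>) = \<zero>\<^bsub>C 2\<^esub>" by (simp add: dS CS numeral_2_eq_2 mod_ker_def)
    show "\<exists>v\<in>carrier R - tail 1. \<exists>u\<in>carrier R. v \<odot>\<^bsub>C 1\<^esub> e = u \<odot>\<^bsub>C 1\<^esub> \<epsilon> \<one>\<^bsub>?L\<^esub>"
      if "e \<in> carrier (C 1)" "d' 1 e = \<zero>\<^bsub>C 2\<^esub>" for e
    proof -
      have "e \<in> \<epsilon> ` carrier ?L" unfolding \<epsilon>(3) using that by (simp add: dS CS numeral_2_eq_2 mod_ker_def)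
      then obtain l where l: "l \<in> carrier ?L" "e = \<epsilon> l" by blast
      obtain s a where s: "s \<in> S" "a \<in> carrier R" "S.loc s \<otimes>\<^bsub>?L\<^esub> l = S.loc a"
        using S.loc_denominator[OF l(1)] by blast
      have "S.loc s \<odot>\<^bsub>E 0\<^esub> e = (S.loc s \<otimes>\<^bsub>?L\<^esub> l) \<odot>\<^bsub>E 0\<^esub> \<epsilon> \<one>\<^bsub>?L\<^esub>"
        using l \<epsilon>m[OF l(1)] s(1) S.S_carr \<epsilon>c[OF L.one_closed] by (simp add: E.smult_assoc1)
      then have "s \<odot>\<^bsub>C 1\<^esub> e = a \<odot>\<^bsub>C 1\<^esub> \<epsilon> \<one>\<^bsub>?L\<^esub>" using s(3) by (simp add: CS)
      then show ?thesis using s(1,2) unfolding S_def by blast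
    qed
    show "\<exists>w\<in>carrier R - tail 1. w \<otimes> r = \<zero>" if r: "r \<in> carrier R" "r \<odot>\<^bsub>C 1\<^esub> \<epsilon> \<one>\<^bsub>?L\<^esub> = \<zero>\<^bsub>C 1\<^esub>" for r
    proof -
      have "\<epsilon> (S.loc r) = \<epsilon> (S.loc \<zero>)"
        using r \<epsilon>m[of "S.loc r"] by (simp add: CS S.loc_zero \<epsilon>z)
      then have "S.loc r = S.loc \<zero>" using \<epsilon>(2) r(1) by (simp add: inj_on_eq_iff)
      then show ?thesis using S.loc_eqD[OF r(1) zero_closed] S.S_carr by (auto simp: S_def)
    qed
  qed
  then show thesis by (rule that)
qed

end

section \<open>Krull dimension\<close>

context graded_ring
begin

text \<open>Unlike \<open>homogeneous_induct\<close>, this concerns the components of one fixed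
  \<open>x\<close>, so a bound on its degrees remains usable in the base case.\<close>

lemma component_induct [consumes 1, case_names component add]:
  assumes x: "x \<in> carrier R" and c: "\<And>i. P (component i x)"
    and add: "\<And>u v. u \<in> carrier R \<Longrightarrow> v \<in> carrier R \<Longrightarrow> P u \<Longrightarrow> P v \<Longrightarrow> P (u \<oplus> v)"
  shows "P x"
proof -
  obtain N where N: "x = (\<Oplus>n\<in>{..N}. component n x)" using component_sum[OF x] by blast
  have "P (\<Oplus>n\<in>{..k}. component n x)" for k
  proof (induction k)
    case 0
    then show ?case using c[of 0] x by simp
  next
    case (Suc k)
    then show ?case using c[of "Suc k"] x add by (simp add: finsum_Suc)
  qed
  then show ?thesis using N by metis
qed

definition head :: "nat \<Rightarrow> 'a set" where
  "head n = {x \<in> carrier R. \<forall>i>n. component i x = \<zero>}"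

lemma head_mult:
  assumes x: "x \<in> head a" and y: "y \<in> head b"
  shows "x \<otimes> y \<in> head (a + b)"
proof -
  have yc: "y \<in> carrier R" using y by (simp add: head_def)
  have "x \<in> carrier R" using x by (simp add: head_def)
  then show ?thesis
  proof (induction x rule: component_induct)
    case (component i)
    show ?case
    proof (cases "i \<le> a")
      case True
      then show ?thesis
        using component_mult[OF component_in[OF \<open>x \<in> carrier R\<close>, of i] yc] y yc \<open>x \<in> carrier R\<close>
        by (auto simp: head_def)
    next
      case False
      then show ?thesis using x yc by (simp add: head_def)
    qed
  next
    case (add u v)
    then show ?case using yc by (simp add: head_def l_distr component_add)
  qed
qed

lemma head_mono: "a \<le> b \<Longrightarrow> head a \<subseteq> head b"
  by (auto simp: head_def)

lemma mem_some_head: "x \<in> carrier R \<Longrightarrow> \<exists>n. x \<in> head n"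
  using component_sum unfolding head_def by blast

lemma homogeneous_genideal:
  assumes "finite H" "\<And>h. h \<in> H \<Longrightarrow> \<exists>k. h \<in> G k"
  shows "homogeneous (Idl H)"
  using assms
proof (induction H rule: finite_induct)
  case empty
  have "Idl {} = {\<zero>}" using genideal_minimal[OF zeroideal, of "{}"] ideal_zero[OF genideal_ideal[of "{}"]] by auto
  then show ?case using homogeneous_zero by simp
next
  case (insert h H)
  then obtain k where "h \<in> G k" by blast
  moreover have "H \<subseteq> carrier R" using insert G_carr by blast
  ultimately show ?case
    using insert homogeneous_adjoin[of "Idl H" h k] adjoin_genideal[of H h] G_carr by simp
qed

lemma finite_homogeneous_generators:
  assumes J: "homogeneous J"
  obtains H where "finite H" "H \<subseteq> J" "\<And>h. h \<in> H \<Longrightarrow> \<exists>k. h \<in> G k" "J = Idl H"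
proof -
  note JI = homogeneousD(1)[OF J]
  obtain A where A: "A \<subseteq> carrier R" "finite A" "J = Idl A" using finetely_gen[OF JI] by blast
  have AJ: "A \<subseteq> J" using A genideal_self by blast
  have "\<forall>a. \<exists>n. a \<in> A \<longrightarrow> a \<in> head n" using A(1) mem_some_head by blast
  then obtain N where N: "\<And>a. a \<in> A \<Longrightarrow> a \<in> head (N a)" by metis
  define H where "H = (\<Union>a\<in>A. (\<lambda>n. component n a) ` {..N a})"
  have fin: "finite H" unfolding H_def using A(2) by simp
  have HJ: "H \<subseteq> J" unfolding H_def using homogeneousD(2)[OF J] AJ by blast
  have Hc: "H \<subseteq> carrier R" using HJ ideal_subset[OF JI] by blast
  have hom: "\<exists>k. h \<in> G k" if "h \<in> H" for h using that A(1) component_in unfolding H_def by blast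
  have "a \<in> Idl H" if a: "a \<in> A" for a
  proof (rule mem_if_components[OF genideal_ideal[OF Hc]])
    show "a \<in> carrier R" using A(1) a by blast
    show "component n a \<in> Idl H" for n
    proof (cases "n \<le> N a")
      case True
      then have "component n a \<in> H" unfolding H_def using a by blast
      then show ?thesis using genideal_self[OF Hc] by blast
    next
      case False
      then show ?thesis using N[OF a] ideal_zero[OF genideal_ideal[OF Hc]] by (simp add: head_def)
    qed
  qed
  then have "J = Idl H"
    using A(3) genideal_minimal[OF genideal_ideal[OF Hc], of A] genideal_minimal[OF JI HJ] by blast
  then show thesis using that[OF fin HJ hom] by blast
qed

lemma homogeneous_tail: "homogeneous (tail n)"
proof -
  have "component i x \<in> tail n" if x: "x \<in> tail n" for x i
  proof (cases "n \<le> i")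
    case True
    then show ?thesis using G_tail[OF component_in[OF tail_carr[OF x]]] by blast
  next
    case False
    then have "component i x = \<zero>" using x by (simp add: tail_def)
    then show ?thesis by simp
  qed
  then show ?thesis using tail_ideal by (simp add: homogeneous_def)
qed

section \<open>Dimensions over the base field and growth of the graded components\<close>

lemma Span_mult_map:
  assumes "set Us \<subseteq> carrier R" "h \<in> carrier R" "r \<in> Span (G 0) Us"
  shows "h \<otimes> r \<in> Span (G 0) (map ((\<otimes>) h) Us)"
  using assms(1,3)
proof (induction Us arbitrary: r)
  case (Cons u Us)
  then obtain k v where kv: "k \<in> G 0" "v \<in> Span (G 0) Us" "r = k \<otimes> u \<oplus> v"
    by (auto simp: line_extension_mem_iff)
  have v: "v \<in> carrier R" using Cons.prems(1) kv(2) Span_subgroup_props(1)[OF base_field, of Us] by auto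
  have "h \<otimes> (k \<otimes> u \<oplus> v) = k \<otimes> (h \<otimes> u) \<oplus> h \<otimes> v"
    using assms(2) G_carr[OF kv(1)] v Cons.prems(1) by (simp add: r_distr m_lcomm)
  then show ?case using Cons kv by (auto simp: line_extension_mem_iff)
qed (use assms(2) in simp)

lemma Span_append_add:
  assumes "set Us \<subseteq> carrier R" "set Vs \<subseteq> carrier R" "a \<in> Span (G 0) Us" "b \<in> Span (G 0) Vs"
  shows "a \<oplus> b \<in> Span (G 0) (Us @ Vs)"
proof -
  have "a \<in> Span (G 0) (Us @ Vs)" "b \<in> Span (G 0) (Us @ Vs)"
    using mono_Span_append[OF base_field assms(1,2)] mono_Span_append[OF base_field assms(2,1)] assms(3,4) by blast+
  then show ?thesis using Span_subgroup_props(3)[OF base_field, of "Us @ Vs"] assms(1,2) by simp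
qed

lemma exists_basis_of_Span:
  assumes "set Us \<subseteq> carrier R"
  shows "\<exists>Vs. independent (G 0) Vs \<and> Span (G 0) Vs = Span (G 0) Us \<and> length Vs \<le> length Us"
  using assms
proof (induction Us)
  case (Cons u Us)
  then obtain Vs where Vs: "independent (G 0) Vs" "Span (G 0) Vs = Span (G 0) Us" "length Vs \<le> length Us"
    by auto
  have c: "set Vs \<subseteq> carrier R" using independent_in_carrier[OF Vs(1)] .
  show ?case
  proof (cases "u \<in> Span (G 0) Us")
    case True
    have "Span (G 0) (u # Us) \<subseteq> Span (G 0) Us"
      using mono_Span_subset[OF base_field, of "u # Us" Us] True Cons.prems Span_base_incl[OF base_field, of Us]
      by auto
    then have "Span (G 0) (u # Us) = Span (G 0) Us" using mono_Span[OF base_field, of Us u] Cons.prems by auto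
    then show ?thesis using Vs by (intro exI[of _ Vs]) auto
  next
    case False
    have "independent (G 0) (u # Vs)" using li_Cons[of u "G 0" Vs] False Vs Cons.prems by simp
    moreover have "Span (G 0) (u # Vs) = Span (G 0) (u # Us)" using Vs(2) by simp
    ultimately show ?thesis using Vs(3) by (intro exI[of _ "u # Vs"]) auto
  qed
qed auto

lemma independent_length_le_spanning:
  assumes "independent (G 0) Vs" "set Us \<subseteq> carrier R" "set Vs \<subseteq> Span (G 0) Us"
  shows "length Vs \<le> length Us"
proof -
  obtain Ws where "independent (G 0) Ws" "Span (G 0) Ws = Span (G 0) Us" "length Ws \<le> length Us"
    using exists_basis_of_Span[OF assms(2)] by blast
  then show ?thesis using independent_length_le[OF base_field assms(1), of Ws] assms(3) by simp
qed

text \<open>A dimension bound that makes sense for arbitrary subsets \<open>V\<close> and passes to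
  smaller sets and larger bounds.\<close>

definition spanned :: "nat \<Rightarrow> 'a set \<Rightarrow> bool" where
  "spanned c V \<longleftrightarrow> (\<exists>Us. set Us \<subseteq> carrier R \<and> length Us \<le> c \<and> V \<subseteq> Span (G 0) Us)"

text \<open>The degree \<open>n\<close> part of the ideal is the sum of \<open>h R_(n-k)\<close>
  over the generators \<open>h\<close>, of degree \<open>k > 0\<close>, so only lower components of
  \<open>R\<close> are involved.\<close>

lemma spanned_genideal_component:
  assumes "finite H" "\<And>h. h \<in> H \<Longrightarrow> \<exists>k>0. h \<in> G k" and fd: "\<And>i. i < n \<Longrightarrow> \<exists>c. spanned c (G i)"
  shows "\<exists>c. spanned c (Idl H \<inter> G n)"
  using assms(1,2)
proof (induction H rule: finite_induct)
  case empty
  have "Idl {} = {\<zero>}" using genideal_minimal[OF zeroideal, of "{}"] ideal_zero[OF genideal_ideal[of "{}"]] by auto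
  then show ?case unfolding spanned_def by (intro exI[of _ 0] exI[of _ "[]"]) auto
next
  case (insert h H)
  obtain k where k: "k > 0" "h \<in> G k" using insert.prems by blast
  have hc: "h \<in> carrier R" using G_carr k by blast
  have Hc: "H \<subseteq> carrier R" using insert.prems G_carr by blast
  have hom: "homogeneous (Idl H)" using homogeneous_genideal insert by blast
  obtain Us where Us: "set Us \<subseteq> carrier R" "Idl H \<inter> G n \<subseteq> Span (G 0) Us"
    using insert unfolding spanned_def by blast
  obtain Vs where Vs: "set Vs \<subseteq> carrier R" "k \<le> n \<Longrightarrow> G (n - k) \<subseteq> Span (G 0) Vs"
  proof (cases "k \<le> n")
    case True
    then show thesis using fd[of "n - k"] k(1) that unfolding spanned_def by auto
  qed (use that[of "[]"] in auto)
  let ?Ws = "Us @ map ((\<otimes>) h) Vs"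
  have c: "set (map ((\<otimes>) h) Vs) \<subseteq> carrier R" using Vs(1) hc by auto
  have "Idl (insert h H) \<inter> G n \<subseteq> Span (G 0) ?Ws"
  proof
    fix x assume x: "x \<in> Idl (insert h H) \<inter> G n"
    then have "x \<in> adjoin (Idl H) h" using adjoin_genideal[OF Hc hc] by simp
    then obtain j r where jr: "j \<in> Idl H" "r \<in> carrier R" "x = j \<oplus> r \<otimes> h" by (rule adjoinE)
    have jc: "j \<in> carrier R" using ideal_carr[OF homogeneousD(1)[OF hom] jr(1)] .
    have "x = component n (j \<oplus> h \<otimes> r)" using x component_homogeneous[of x n n] jr hc by (simp add: m_comm)
    also have "\<dots> = component n j \<oplus> component n (h \<otimes> r)" using jc jr(2) hc by (simp add: component_add)
    finally have xe: "x = component n j \<oplus> component n (h \<otimes> r)" .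
    have 1: "component n j \<in> Span (G 0) Us"
      using Us(2) homogeneousD(2)[OF hom jr(1)] component_in[OF jc] by blast
    have 2: "component n (h \<otimes> r) \<in> Span (G 0) (map ((\<otimes>) h) Vs)"
    proof (cases "n < k")
      case True
      then show ?thesis
        using component_mult[OF k(2) jr(2), of n] Span_subgroup_props(2)[OF base_field c] by simp
    next
      case False
      then show ?thesis
        using component_mult[OF k(2) jr(2), of n] Span_mult_map[OF Vs(1) hc] Vs(2) component_in[OF jr(2)] by auto
    qed
    show "x \<in> Span (G 0) ?Ws" unfolding xe by (rule Span_append_add[OF Us(1) c 1 2])
  qed
  then show ?case unfolding spanned_def using Us(1) c by (intro exI[of _ "length ?Ws"] exI[of _ ?Ws]) auto
qed

text \<open>For \<open>n > 0\<close> the component lies in \<open>R_+\<close>, which has finitely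
  many homogeneous generators of positive degree; strong induction then reduces to lower
  degrees.\<close>

lemma component_finite_dimensional: "\<exists>c. spanned c (G n)"
proof (induction n rule: less_induct)
  case (less n)
  show ?case
  proof (cases "n = 0")
    case True
    have "k \<in> Span (G 0) [\<one>]" if k: "k \<in> G 0" for k
      using k G_carr[OF k] by (auto simp: line_extension_mem_iff intro!: bexI[of _ k])
    then show ?thesis unfolding spanned_def True by (intro exI[of _ 1] exI[of _ "[\<one>]"]) auto
  next
    case False
    obtain H where H: "finite H" "H \<subseteq> tail 1" "\<And>h. h \<in> H \<Longrightarrow> \<exists>k. h \<in> G k" "tail 1 = Idl H"
      using finite_homogeneous_generators[OF homogeneous_tail] by blast
    have "\<exists>k>0. h \<in> G k" if h: "h \<in> H" for h
    proof -
      obtain k where k: "h \<in> G k" using H(3)[OF h] by blast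
      show ?thesis
      proof (cases "k = 0")
        case True
        \<comment> \<open>A generator of degree 0 inside \<open>R_+\<close> is zero, and zero also
          has degree 1.\<close>
        then have "h = component 0 h" using component_homogeneous[of h 0 0] k by simp
        also have "\<dots> = \<zero>" using H(2) h by (auto simp: tail_def)
        finally show ?thesis using G_zero[of 1] by auto
      qed (use k in auto)
    qed
    then obtain c where "spanned c (Idl H \<inter> G n)"
      using spanned_genideal_component[OF H(1), of n] less by blast
    moreover have "G n \<subseteq> Idl H" using G_tail[of _ n 1] False H(4) by auto
    ultimately have "spanned c (G n)" by (simp add: Int_absorb1)
    then show ?thesis by blast
  qed
qed

text \<open>From degree \<open>N + k\<close> on, \<open>R_n = x R_(n-k)\<close>, so the bounds for
  the first \<open>N + k\<close> degrees suffice; \<open>b\<close> is their sum.\<close>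

lemma components_bounded:
  assumes x: "x \<in> G k" "0 < k" and N: "tail N \<subseteq> adjoin {\<zero>} x"
  shows "\<exists>c. \<forall>n. spanned c (G n)"
proof -
  obtain c where c: "\<And>n. spanned (c n) (G n)" using component_finite_dimensional by metis
  define b where "b = (\<Sum>n<N + k. c n)"
  have xc: "x \<in> carrier R" using G_carr x by blast
  have "spanned b (G n)" for n
  proof (induction n rule: less_induct)
    case (less n)
    show ?case
    proof (cases "n < N + k")
      case True
      then have "c n \<le> b" unfolding b_def by (intro member_le_sum) auto
      then show ?thesis using c[of n] unfolding spanned_def by (meson order_trans)
    next
      case False
      obtain Us where Us: "set Us \<subseteq> carrier R" "length Us \<le> b" "G (n - k) \<subseteq> Span (G 0) Us"
        using less[of "n - k"] False x(2) unfolding spanned_def by auto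
      have "G n \<subseteq> Span (G 0) (map ((\<otimes>) x) Us)"
      proof
        fix y assume y: "y \<in> G n"
        then have "y \<in> adjoin {\<zero>} x" using N G_tail[OF y, of N] False by auto
        then obtain r where r: "r \<in> carrier R" "y = r \<otimes> x" using xc by (auto simp: adjoin_def)
        have "y = component n (x \<otimes> r)" using component_homogeneous[OF y, of n] r xc by (simp add: m_comm)
        also have "\<dots> = x \<otimes> component (n - k) r" using component_mult[OF x(1) r(1), of n] False by simp
        finally show "y \<in> Span (G 0) (map ((\<otimes>) x) Us)"
          using Span_mult_map[OF Us(1) xc] Us(3) component_in[OF r(1)] by auto
      qed
      moreover have "set (map ((\<otimes>) x) Us) \<subseteq> carrier R" using Us(1) xc by auto
      ultimately show ?thesis unfolding spanned_def using Us(2) by (intro exI[of _ "map ((\<otimes>) x) Us"]) auto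
    qed
  qed
  then show ?thesis by blast
qed

lemma head_spanned:
  assumes c: "\<And>n. spanned c (G n)"
  shows "spanned (c * Suc n) (head n)"
proof (induction n)
  case 0
  have "head 0 \<subseteq> G 0"
  proof
    fix x assume "x \<in> head 0"
    then have x: "x \<in> carrier R" "\<And>i. 0 < i \<Longrightarrow> component i x = \<zero>" by (auto simp: head_def)
    show "x \<in> G 0" using x(1)
    proof (induction x rule: component_induct)
      case (component i)
      then show ?case using x component_in[OF x(1), of 0] by (cases i) auto
    qed (rule G_add)
  qed
  then show ?case using c[of 0] unfolding spanned_def by (metis mult_1_right One_nat_def order_trans)
next
  case (Suc n)
  obtain Us where Us: "set Us \<subseteq> carrier R" "length Us \<le> c * Suc n" "head n \<subseteq> Span (G 0) Us"
    using Suc unfolding spanned_def by blast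
  obtain Vs where Vs: "set Vs \<subseteq> carrier R" "length Vs \<le> c" "G (Suc n) \<subseteq> Span (G 0) Vs"
    using c unfolding spanned_def by blast
  have "head (Suc n) \<subseteq> Span (G 0) (Us @ Vs)"
  proof
    fix x assume x: "x \<in> head (Suc n)"
    then have xc: "x \<in> carrier R" by (simp add: head_def)
    let ?y = "component (Suc n) x"
    have y: "?y \<in> G (Suc n)" using component_in[OF xc] .
    have minus_self: "a \<ominus> a = \<zero>" if "a \<in> carrier R" for a using that by (simp add: a_minus_def r_neg)
    have "component i (x \<ominus> ?y) = \<zero>" if "n < i" for i
      using x xc component_homogeneous[OF y] that by (cases "i = Suc n") (auto simp: component_diff minus_self head_def)
    then have "x \<ominus> ?y \<in> head n" using xc by (simp add: head_def)
    then have "(x \<ominus> ?y) \<oplus> ?y \<in> Span (G 0) (Us @ Vs)" using Us(3) Vs(3) y Span_append_add[OF Us(1) Vs(1)] by blast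
    moreover have "(x \<ominus> ?y) \<oplus> ?y = x" using xc component_carr[OF xc, of "Suc n"] by algebra
    ultimately show "x \<in> Span (G 0) (Us @ Vs)" by simp
  qed
  then show ?case unfolding spanned_def using Us Vs by (intro exI[of _ "Us @ Vs"]) auto
qed

primrec powers :: "'a \<Rightarrow> nat \<Rightarrow> 'a list" where
  "powers h 0 = []"
| "powers h (Suc n) = \<one> # map ((\<otimes>) h) (powers h n)"

text \<open>The products \<open>g^i h^j\<close> with \<open>i < m\<close> and \<open>j < n\<close>
  in Horner form: a linear combination is \<open>a + g b\<close> with \<open>a\<close> a polynomial
  in \<open>h\<close> and \<open>b\<close> of the same shape with smaller \<open>m\<close>.\<close>

primrec monomials :: "'a \<Rightarrow> 'a \<Rightarrow> nat \<Rightarrow> nat \<Rightarrow> 'a list" where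
  "monomials g h n 0 = []"
| "monomials g h n (Suc m) = powers h n @ map ((\<otimes>) g) (monomials g h n m)"

lemma length_powers [simp]: "length (powers h n) = n"
  by (induction n) auto

lemma length_monomials [simp]: "length (monomials g h n m) = m * n"
  by (induction m) auto

lemma powers_carr: "h \<in> carrier R \<Longrightarrow> set (powers h n) \<subseteq> carrier R"
  by (induction n) auto

lemma monomials_carr: "g \<in> carrier R \<Longrightarrow> h \<in> carrier R \<Longrightarrow> set (monomials g h n m) \<subseteq> carrier R"
  using powers_carr by (induction m) auto

lemma powers_head:
  assumes "h \<in> head \<delta>"
  shows "set (powers h n) \<subseteq> head (n * \<delta>)"
proof (induction n)
  case (Suc n)
  have "\<one> \<in> head (Suc n * \<delta>)" using component_homogeneous[OF G_one] by (simp add: head_def)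
  moreover have "h \<otimes> u \<in> head (Suc n * \<delta>)" if "u \<in> set (powers h n)" for u
    using head_mult[OF assms, of u "n * \<delta>"] Suc that by auto
  ultimately show ?case by auto
qed simp

lemma monomials_head:
  assumes "g \<in> head \<delta>" "h \<in> head \<delta>"
  shows "set (monomials g h n m) \<subseteq> head (n * \<delta> + m * \<delta>)"
proof (induction m)
  case (Suc m)
  have "set (powers h n) \<subseteq> head (n * \<delta> + Suc m * \<delta>)"
    using powers_head[OF assms(2), of n] head_mono[of "n * \<delta>" "n * \<delta> + Suc m * \<delta>"] by auto
  moreover have "g \<otimes> u \<in> head (n * \<delta> + Suc m * \<delta>)" if "u \<in> set (monomials g h n m)" for u
    using head_mult[OF assms(1), of u "n * \<delta> + m * \<delta>"] Suc that by (auto simp: algebra_simps)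
  ultimately show ?case by auto
qed simp

lemma combine_map_mult:
  assumes "set Us \<subseteq> carrier R" "set Ks \<subseteq> carrier R" "h \<in> carrier R"
  shows "combine Ks (map ((\<otimes>) h) Us) = h \<otimes> combine Ks Us"
  using assms
proof (induction Ks Us rule: combine.induct)
  case (1 k Ks u Us)
  then show ?case by (simp add: r_distr m_lcomm)
qed auto

lemma combine_zeros: "set Us \<subseteq> carrier R \<Longrightarrow> set Ks \<subseteq> {\<zero>} \<Longrightarrow> combine Ks Us = \<zero>"
  by (induction Ks Us rule: combine.induct) auto

lemma base_inter_prime:
  assumes "primeideal P R" "k \<in> G 0" "k \<in> P"
  shows "k = \<zero>"
proof (rule ccontr)
  assume "k \<noteq> \<zero>"
  then obtain l where "l \<in> G 0" "l \<otimes> k = \<one>" using base_unit assms(2) by blast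
  then have "\<one> \<in> P" using ideal.I_l_closed[OF primeideal.axioms(1)[OF assms(1)] assms(3)] G_carr by metis
  then show False
    using ideal.one_imp_carrier[OF primeideal.axioms(1)[OF assms(1)]] primeideal.I_notcarr[OF assms(1)] by blast
qed

text \<open>Horner's scheme: if \<open>k + h c\<close> is in \<open>P\<close>, hence in
  \<open>Q\<close>, then \<open>h\<close> in \<open>Q\<close> forces the scalar \<open>k\<close>
  into \<open>Q\<close>, so \<open>k = 0\<close>; now \<open>h c\<close> in \<open>P\<close> with
  \<open>h\<close> outside \<open>P\<close> gives \<open>c\<close> in \<open>P\<close>.\<close>

lemma powers_combine_prime:
  assumes P: "primeideal P R" "primeideal Q R" "P \<subseteq> Q" and h: "h \<in> Q" "h \<notin> P"
  shows "\<lbrakk>length Ks = n; set Ks \<subseteq> G 0; combine Ks (powers h n) \<in> P\<rbrakk> \<Longrightarrow> set Ks \<subseteq> {\<zero>}"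
proof (induction n arbitrary: Ks)
  case (Suc n)
  have PI: "ideal P R" and QI: "ideal Q R" using P primeideal.axioms(1) by auto
  have hc: "h \<in> carrier R" using ideal_carr[OF QI h(1)] .
  obtain k Ls where Ks: "Ks = k # Ls" "length Ls = n" using Suc.prems(1) by (cases Ks) auto
  have k: "k \<in> G 0" "set Ls \<subseteq> G 0" using Suc.prems(2) Ks by auto
  have Lc: "set Ls \<subseteq> carrier R" using k(2) G_carr by blast
  let ?c = "combine Ls (powers h n)"
  have c: "?c \<in> carrier R" using combine_in_carrier[OF Lc powers_carr[OF hc]] .
  have e: "combine Ks (powers h (Suc n)) = k \<oplus> h \<otimes> ?c"
    using G_carr[OF k(1)] combine_map_mult[OF powers_carr[OF hc] Lc hc] Ks by simp
  then have "h \<otimes> ?c \<oplus> k \<in> Q" using Suc.prems(3) P(3) G_carr[OF k(1)] c hc by (auto simp: a_comm)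
  then have "k \<in> Q" using ideal_cancel_left[OF QI ideal.I_r_closed[OF QI h(1) c]] G_carr[OF k(1)] by blast
  then have k0: "k = \<zero>" using base_inter_prime[OF P(2) k(1)] by blast
  then have "h \<otimes> ?c \<in> P" using e Suc.prems(3) c hc by simp
  then have "?c \<in> P" using primeideal.I_prime[OF P(1) hc c] h(2) by blast
  then show ?case using Suc.IH[OF Ks(2) k(2)] k0 Ks(1) by simp
qed simp

text \<open>The same scheme in \<open>g\<close>. The leading term \<open>a\<close>, a polynomial in
  \<open>h\<close>, falls into \<open>P'\<close>, where \<open>powers_combine_prime\<close> for
  \<open>P'\<close> and \<open>Q\<close> makes its coefficients vanish.\<close>

lemma monomials_combine_prime:
  assumes P: "primeideal P R" "primeideal P' R" "primeideal Q R" "P \<subseteq> P'" "P' \<subseteq> Q"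
    and g: "g \<in> P'" "g \<notin> P" and h: "h \<in> Q" "h \<notin> P'"
  shows "\<lbrakk>length Ks = m * n; set Ks \<subseteq> G 0; combine Ks (monomials g h n m) \<in> P\<rbrakk> \<Longrightarrow> set Ks \<subseteq> {\<zero>}"
proof (induction m arbitrary: Ks)
  case (Suc m)
  have PI: "ideal P R" and P'I: "ideal P' R" and QI: "ideal Q R" using P primeideal.axioms(1) by auto
  have gc: "g \<in> carrier R" and hc: "h \<in> carrier R" using ideal_carr[OF P'I g(1)] ideal_carr[OF QI h(1)] by auto
  define As Bs where "As = take n Ks" and "Bs = drop n Ks"
  have Ks: "Ks = As @ Bs" "length As = n" "length Bs = m * n"
    using Suc.prems(1) by (auto simp: As_def Bs_def)
  have AB: "set As \<subseteq> G 0" "set Bs \<subseteq> G 0" using Suc.prems(2) Ks(1) by auto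
  have ABc: "set As \<subseteq> carrier R" "set Bs \<subseteq> carrier R" using AB G_carr by blast+
  let ?a = "combine As (powers h n)" and ?b = "combine Bs (monomials g h n m)"
  have c: "?a \<in> carrier R" "?b \<in> carrier R"
    using combine_in_carrier[OF ABc(1) powers_carr[OF hc]] combine_in_carrier[OF ABc(2) monomials_carr[OF gc hc]] .
  have mc: "set (map ((\<otimes>) g) (monomials g h n m)) \<subseteq> carrier R" using monomials_carr[OF gc hc] gc by auto
  have e: "combine Ks (monomials g h n (Suc m)) = ?a \<oplus> g \<otimes> ?b"
    using combine_append[OF _ ABc(1) powers_carr[OF hc] ABc(2) mc, of n] Ks
      combine_map_mult[OF monomials_carr[OF gc hc] ABc(2) gc, of n m] by simp
  then have "g \<otimes> ?b \<oplus> ?a \<in> P'" using Suc.prems(3) P(4) c gc by (auto simp: a_comm)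
  then have "?a \<in> P'" using ideal_cancel_left[OF P'I ideal.I_r_closed[OF P'I g(1) c(2)]] c(1) by blast
  then have A0: "set As \<subseteq> {\<zero>}" using powers_combine_prime[OF P(2,3,5) h Ks(2) AB(1)] by blast
  have "combine As (powers h n) = \<zero>"
    using combine_zeros[OF powers_carr[OF hc] A0] .
  then have "g \<otimes> ?b \<in> P" using e Suc.prems(3) c gc by simp
  then have "?b \<in> P" using primeideal.I_prime[OF P(1) gc c(2)] g(2) by blast
  then show ?case using Suc.IH[OF Ks(3) AB(2)] A0 Ks(1) by simp
qed simp

text \<open>If \<open>R\<close> is finite over \<open>k[x]\<close>, then \<open>dim\<^sub>k R\<^sub>\<le>\<^sub>n\<close> grows linearly, whereas \<open>g \<in> P'\<close>, \<open>h \<in> Q\<close>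
  taken from a chain of three primes are algebraically independent.\<close>

lemma no_chain_of_three_primes:
  assumes x: "x \<in> G k" "0 < k" and N: "tail N \<subseteq> adjoin {\<zero>} x"
    and P: "primeideal P R" "primeideal P' R" "primeideal Q R" "P \<subset> P'" "P' \<subset> Q"
  shows False
proof -
  obtain g h where g: "g \<in> P'" "g \<notin> P" and h: "h \<in> Q" "h \<notin> P'" using P(4,5) by blast
  have gc: "g \<in> carrier R" and hc: "h \<in> carrier R"
    using g h ideal_carr[OF primeideal.axioms(1)[OF P(2)]] ideal_carr[OF primeideal.axioms(1)[OF P(3)]] by auto
  obtain \<delta>1 \<delta>2 where "g \<in> head \<delta>1" "h \<in> head \<delta>2" using mem_some_head gc hc by blast
  then obtain \<delta> where \<delta>: "g \<in> head \<delta>" "h \<in> head \<delta>"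
    using head_mono[of \<delta>1 "max \<delta>1 \<delta>2"] head_mono[of \<delta>2 "max \<delta>1 \<delta>2"] by auto
  obtain c where c: "\<And>n. spanned c (G n)" using components_bounded[OF x N] by blast
  \<comment> \<open>Chosen so that the \<open>n * n\<close> monomials, all of degree at most
    \<open>2 n \<delta>\<close>, outnumber the dimension bound
    \<open>c (2 n \<delta> + 1)\<close>.\<close>
  define n where "n = 2 * c * \<delta> + c + 1"
  let ?M = "monomials g h n n"
  have "independent (G 0) ?M"
  proof (rule ccontr)
    assume "dependent (G 0) ?M"
    then obtain Ks where Ks: "length Ks = length ?M" "combine Ks ?M = \<zero>" "set Ks \<subseteq> G 0" "set Ks \<noteq> {\<zero>}"
      using dependent_imp_non_trivial_combine[OF base_field monomials_carr[OF gc hc]] by blast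
    have "set Ks \<subseteq> {\<zero>}"
      using monomials_combine_prime[OF P(1-3) psubset_imp_subset[OF P(4)] psubset_imp_subset[OF P(5)] g h, of Ks n n]
        Ks ideal_zero[OF primeideal.axioms(1)[OF P(1)]] by simp
    moreover have "Ks \<noteq> []" using Ks(1) by (auto simp: n_def)
    ultimately show False using Ks(4) by (cases Ks) auto
  qed
  moreover obtain Us where "set Us \<subseteq> carrier R" "length Us \<le> c * Suc (n * \<delta> + n * \<delta>)"
      "head (n * \<delta> + n * \<delta>) \<subseteq> Span (G 0) Us"
    using head_spanned[OF c, of "n * \<delta> + n * \<delta>"] unfolding spanned_def by blast
  ultimately have "n * n \<le> c * Suc (n * \<delta> + n * \<delta>)"
    using independent_length_le_spanning[of ?M Us] monomials_head[OF \<delta>, of n n] by fastforce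
  moreover have "c * Suc (n * \<delta> + n * \<delta>) < n * n"
  proof -
    have "c * Suc (n * \<delta> + n * \<delta>) = c + n * (2 * c * \<delta>)" by (simp add: algebra_simps)
    also have "\<dots> < n * (c + 1) + n * (2 * c * \<delta>)" unfolding n_def by simp
    also have "\<dots> = n * n" by (simp add: n_def algebra_simps)
    finally show ?thesis .
  qed
  ultimately show False by simp
qed

lemma krull_dim_less_2:
  assumes x: "x \<in> G k" "0 < k" and N: "tail N \<subseteq> adjoin {\<zero>} x"
  shows "\<not> krull_dim R \<ge> 2"
proof
  assume d: "krull_dim R \<ge> 2"
  have "n \<le> 1" if P: "\<forall>i\<le>n. primeideal (P i) R" "\<forall>i<n. P i \<subset> P (Suc i)" for n :: nat and P
  proof (rule ccontr)
    assume "\<not> n \<le> 1"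
    then have "primeideal (P 0) R" "primeideal (P 1) R" "primeideal (P 2) R" "P 0 \<subset> P 1" "P 1 \<subset> P 2"
      using P(1) P(2)[rule_format, of 0] P(2)[rule_format, of 1] by (auto simp: numeral_2_eq_2)
    then show False using no_chain_of_three_primes[OF x N] by blast
  qed
  then have "krull_dim R \<le> enat 1" unfolding krull_dim_def by (intro SUP_least) auto
  then have "(2::enat) \<le> enat 1" using d by (rule order_trans[rotated])
  then show False by (simp add: numeral_eq_enat)
qed

end

section \<open>Regular sequences in Gorenstein graded rings\<close>

context cring
begin

lemma summands_subset_set_add:
  assumes "ideal I R" "ideal J R"
  shows "I \<subseteq> I <+>\<^bsub>R\<^esub> J" "J \<subseteq> I <+>\<^bsub>R\<^esub> J"
proof -
  have "x \<oplus> y \<in> I <+>\<^bsub>R\<^esub> J" if "x \<in> I" "y \<in> J" for x y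
    using that by (auto simp: set_add_def')
  from this[OF _ ideal_zero[OF assms(2)]] this[OF ideal_zero[OF assms(1)]]
  show "I \<subseteq> I <+>\<^bsub>R\<^esub> J" "J \<subseteq> I <+>\<^bsub>R\<^esub> J"
    using ideal_carr[OF assms(1)] ideal_carr[OF assms(2)] by (metis r_zero subsetI, metis l_zero subsetI)
qed

lemma mult_mem_colon_eq:
  assumes "colon I x = I" "z \<in> carrier R" "x \<in> carrier R" "x \<otimes> z \<in> I"
  shows "z \<in> I"
  using mem_if_colon_eq[OF assms(1,2)] assms(2-4) by (simp add: m_comm)

text \<open>Induction on \<open>m\<close>: writing \<open>z = i + z' f\<close> and cancelling
  \<open>f\<close> modulo \<open>J\<close> leaves \<open>z' g\<close> in \<open>J + f^m\<close>, the
  preceding case.\<close>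

lemma colon_adjoin_pow:
  assumes J: "ideal J R" and f: "f \<in> carrier R" and g: "g \<in> carrier R"
    and Jf: "colon J f = J" and Jg: "colon (adjoin J f) g = adjoin J f"
  shows "colon (adjoin J (f [^] (m::nat))) g = adjoin J (f [^] m)"
proof (rule colon_eqI[OF adjoin_ideal[OF J] g])
  show "f [^] m \<in> carrier R" using f by simp
  show "z \<otimes> g \<in> adjoin J (f [^] m) \<Longrightarrow> z \<in> adjoin J (f [^] m)" if "z \<in> carrier R" for z
    using that
  proof (induction m arbitrary: z)
    case 0
    then show ?case using adjoin_mult_mem[OF J one_closed, of z] by simp
  next
    case (Suc m)
    have fm: "f [^] m \<in> carrier R" using f by simp
    obtain j t where jt: "j \<in> J" "t \<in> carrier R" "z \<otimes> g = j \<oplus> t \<otimes> f [^] Suc m"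
      using Suc.prems(1) by (rule adjoinE)
    have jc: "j \<in> carrier R" using ideal_carr[OF J jt(1)] .
    have "j \<oplus> t \<otimes> f [^] Suc m = j \<oplus> (t \<otimes> f [^] m) \<otimes> f" unfolding nat_pow_Suc using jt(2) f fm by (simp add: m_assoc)
    then have "z \<otimes> g \<in> adjoin J f" using jt adjoinI[OF jt(1), of "t \<otimes> f [^] m" f] fm by simp
    then have "z \<in> adjoin J f" using mem_if_colon_eq[OF Jg Suc.prems(2)] by simp
    then obtain i z' where z: "i \<in> J" "z' \<in> carrier R" "z = i \<oplus> z' \<otimes> f" by (rule adjoinE)
    have ic: "i \<in> carrier R" using ideal_carr[OF J z(1)] .
    have "f \<otimes> (z' \<otimes> g \<ominus> t \<otimes> f [^] m) = (i \<oplus> z' \<otimes> f) \<otimes> g \<ominus> i \<otimes> g \<ominus> t \<otimes> (f [^] m \<otimes> f)"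
      using f z(2) g jt(2) fm ic by algebra
    also have "\<dots> = (j \<oplus> t \<otimes> (f [^] m \<otimes> f)) \<ominus> i \<otimes> g \<ominus> t \<otimes> (f [^] m \<otimes> f)" using jt(3) z(3) by simp
    also have "\<dots> = j \<ominus> i \<otimes> g" using jc jt(2) f fm ic g by algebra
    also have "\<dots> \<in> J" using ideal_diff[OF J jt(1) ideal.I_r_closed[OF J z(1) g]] .
    finally have "z' \<otimes> g \<ominus> t \<otimes> f [^] m \<in> J"
      using mult_mem_colon_eq[OF Jf _ f] z(2) g jt(2) fm by simp
    then have "(z' \<otimes> g \<ominus> t \<otimes> f [^] m) \<oplus> t \<otimes> f [^] m \<in> adjoin J (f [^] m)" using adjoinI jt(2) by blast
    moreover have "(z' \<otimes> g \<ominus> t \<otimes> f [^] m) \<oplus> t \<otimes> f [^] m = z' \<otimes> g" using z(2) g jt(2) fm by algebra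
    ultimately have "z' \<in> adjoin J (f [^] m)" using Suc.IH[OF _ z(2)] by simp
    then obtain i' t' where z': "i' \<in> J" "t' \<in> carrier R" "z' = i' \<oplus> t' \<otimes> f [^] m" by (rule adjoinE)
    have i'c: "i' \<in> carrier R" using ideal_carr[OF J z'(1)] .
    have "z = (i \<oplus> i' \<otimes> f) \<oplus> t' \<otimes> f [^] Suc m"
      unfolding z(3) z'(3) nat_pow_Suc using ic i'c z'(2) f fm by algebra
    then show ?case
      using adjoinI[OF ideal_add[OF J z(1) ideal.I_r_closed[OF J z'(1) f]] z'(2)] by simp
  qed
qed

text \<open>The factors are cancelled in turn: \<open>g^s\<close> modulo
  \<open>(J, f^(r+1))\<close>, then \<open>g\<close> modulo \<open>(J, f^r)\<close>, then
  \<open>f^r\<close> modulo \<open>J\<close>. This makes multiplication by \<open>f^r g^s\<close>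
  injective from \<open>R/(J, f, g)\<close> to \<open>R/(J, f^(r+1), g^(s+1))\<close>.\<close>

lemma regular_pair_pow_colon:
  assumes J: "ideal J R" and f: "f \<in> carrier R" and g: "g \<in> carrier R"
    and Jf: "colon J f = J" and Jg: "colon (adjoin J f) g = adjoin J f" and w: "w \<in> carrier R"
    and mem: "f [^] (r::nat) \<otimes> g [^] (s::nat) \<otimes> w \<in> adjoin (adjoin J (f [^] Suc r)) (g [^] Suc s)"
  shows "w \<in> adjoin (adjoin J f) g"
proof -
  define F H where "F = f [^] r" and "H = g [^] s"
  have FH: "F \<in> carrier R" "H \<in> carrier R" using f g by (auto simp: F_def H_def)
  have FS: "f [^] Suc r = F \<otimes> f" "g [^] Suc s = H \<otimes> g" by (simp_all add: F_def H_def)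
  let ?J1 = "adjoin J (F \<otimes> f)"
  have J1: "ideal ?J1 R" using adjoin_ideal[OF J] FH f by simp
  obtain j t where jt: "j \<in> ?J1" "t \<in> carrier R" "F \<otimes> H \<otimes> w = j \<oplus> t \<otimes> (H \<otimes> g)"
    using mem unfolding F_def[symmetric] H_def[symmetric] FS by (rule adjoinE)
  have jc: "j \<in> carrier R" using ideal_carr[OF J1 jt(1)] .
  have "H \<otimes> (F \<otimes> w \<ominus> t \<otimes> g) = F \<otimes> H \<otimes> w \<ominus> t \<otimes> (H \<otimes> g)" using FH w jt(2) g by algebra
  also have "\<dots> = (j \<oplus> t \<otimes> (H \<otimes> g)) \<ominus> t \<otimes> (H \<otimes> g)" using jt(3) by simp
  also have "\<dots> = j" using jc jt(2) FH g by algebra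
  finally have "H \<otimes> (F \<otimes> w \<ominus> t \<otimes> g) \<in> ?J1" using jt(1) by simp
  moreover have "colon ?J1 H = ?J1"
    using colon_pow_eq[OF J1 g, of s] colon_adjoin_pow[OF J f g Jf Jg, of "Suc r"] unfolding FS H_def by blast
  ultimately have "F \<otimes> w \<ominus> t \<otimes> g \<in> ?J1"
    using mult_mem_colon_eq[of ?J1 H] jt(2) w FH g by simp
  then obtain j0 t' where j0: "j0 \<in> J" "t' \<in> carrier R" "F \<otimes> w \<ominus> t \<otimes> g = j0 \<oplus> t' \<otimes> (F \<otimes> f)" by (rule adjoinE)
  have j0c: "j0 \<in> carrier R" using ideal_carr[OF J j0(1)] .
  have "t \<otimes> g = (\<ominus> (F \<otimes> w \<ominus> t \<otimes> g)) \<oplus> w \<otimes> F" using FH w jt(2) g by algebra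
  also have "\<dots> = (\<ominus> (j0 \<oplus> t' \<otimes> (F \<otimes> f))) \<oplus> w \<otimes> F" using j0(3) by simp
  also have "\<dots> = (\<ominus> j0) \<oplus> (w \<ominus> t' \<otimes> f) \<otimes> F" using j0c j0(2) FH f w by algebra
  also have "\<dots> \<in> adjoin J F" by (rule adjoinI) (use ideal_neg[OF J j0(1)] w j0(2) f in auto)
  finally have "t \<in> adjoin J F"
    using mem_if_colon_eq[OF colon_adjoin_pow[OF J f g Jf Jg, of r] jt(2)] by (simp add: F_def)
  then obtain j1 t1 where t: "j1 \<in> J" "t1 \<in> carrier R" "t = j1 \<oplus> t1 \<otimes> F" by (rule adjoinE)
  have j1c: "j1 \<in> carrier R" using ideal_carr[OF J t(1)] .
  have "F \<otimes> (w \<ominus> t' \<otimes> f \<ominus> t1 \<otimes> g) = (F \<otimes> w \<ominus> (j1 \<oplus> t1 \<otimes> F) \<otimes> g) \<ominus> t' \<otimes> (F \<otimes> f) \<oplus> j1 \<otimes> g"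
    using FH w j0(2) f t(2) g j1c by algebra
  also have "\<dots> = (j0 \<oplus> t' \<otimes> (F \<otimes> f)) \<ominus> t' \<otimes> (F \<otimes> f) \<oplus> j1 \<otimes> g" using j0(3) t(3) by simp
  also have "\<dots> = j0 \<oplus> j1 \<otimes> g" using j0c j0(2) FH f j1c g by algebra
  also have "\<dots> \<in> J" using ideal_add[OF J j0(1) ideal.I_r_closed[OF J t(1) g]] .
  finally have "w \<ominus> t' \<otimes> f \<ominus> t1 \<otimes> g \<in> J"
    using mult_mem_colon_eq[OF colon_pow_eq[OF J f Jf, of r]] w j0(2) f t(2) g by (simp add: F_def)
  then have "((w \<ominus> t' \<otimes> f \<ominus> t1 \<otimes> g) \<oplus> t' \<otimes> f) \<oplus> t1 \<otimes> g \<in> adjoin (adjoin J f) g"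
    by (intro adjoinI) (use j0(2) t(2) in auto)
  moreover have "((w \<ominus> t' \<otimes> f \<ominus> t1 \<otimes> g) \<oplus> t' \<otimes> f) \<oplus> t1 \<otimes> g = w" using w j0(2) f t(2) g by algebra
  ultimately show ?thesis by simp
qed

text \<open>Well-definedness of the multiplication map whose injectivity is
  \<open>regular_pair_pow_colon\<close>.\<close>

lemma pow_mult_adjoin_adjoin:
  assumes J: "ideal J R" and f: "f \<in> carrier R" and g: "g \<in> carrier R" and j: "j \<in> adjoin (adjoin J f) g"
  shows "f [^] (r::nat) \<otimes> g [^] (s::nat) \<otimes> j \<in> adjoin (adjoin J (f [^] Suc r)) (g [^] Suc s)"
proof -
  have FH: "f [^] r \<in> carrier R" "g [^] s \<in> carrier R" using f g by auto
  obtain i b where i: "i \<in> adjoin J f" "b \<in> carrier R" "j = i \<oplus> b \<otimes> g" using j by (rule adjoinE)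
  obtain j0 a where j0: "j0 \<in> J" "a \<in> carrier R" "i = j0 \<oplus> a \<otimes> f" using i(1) by (rule adjoinE)
  have j0c: "j0 \<in> carrier R" using ideal_carr[OF J j0(1)] .
  have "f [^] r \<otimes> g [^] s \<otimes> j = (f [^] r \<otimes> g [^] s \<otimes> j0 \<oplus> (g [^] s \<otimes> a) \<otimes> f [^] Suc r) \<oplus> (f [^] r \<otimes> b) \<otimes> g [^] Suc s"
    unfolding i(3) j0(3) nat_pow_Suc using FH j0c j0(2) i(2) f g by algebra
  also have "\<dots> \<in> adjoin (adjoin J (f [^] Suc r)) (g [^] Suc s)"
    by (intro adjoinI ideal.I_l_closed[OF J j0(1)]) (use FH j0(2) i(2) in auto)
  finally show ?thesis .
qed

end

context graded_ring
begin

section \<open>Homogeneous regular sequences in an ideal containing powers of the elements of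
  \<open>R_+\<close>\<close>

lemma regseq_homogeneous:
  "regseq T n J \<Longrightarrow> T \<subseteq> (\<Union>k\<in>{0<..}. G k) \<Longrightarrow> homogeneous J"
proof (induction rule: regseq.induct)
  case zero
  then show ?case using homogeneous_zero by simp
next
  case (Suc n J x)
  then obtain k where "x \<in> G k" by blast
  then show ?case using homogeneous_adjoin Suc by blast
qed

lemma gorenstein_duality:
  assumes gor: "gorenstein_ring R" and J: "regseq T n J" and T: "T \<subseteq> (\<Union>k\<in>{0<..}. G k)"
    and s: "s \<in> carrier R" "s \<notin> J" "\<And>x. x \<in> tail 1 \<Longrightarrow> x \<otimes> s \<in> J"
    and I: "ideal I R" "J \<subseteq> I" and y: "y \<in> carrier R" "y \<notin> I" "\<And>x. x \<in> tail 1 \<Longrightarrow> x \<otimes> y \<in> I"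
    and rad: "\<And>x. x \<in> tail 1 \<Longrightarrow> \<exists>j::nat. x [^] j \<in> I"
  shows "\<exists>u\<in>carrier R. (\<forall>i\<in>I. u \<otimes> i \<in> J) \<and> u \<otimes> y \<notin> J"
proof -
  obtain C :: "nat \<Rightarrow> ('a, (('a \<times> 'a) set \<times> ('a \<times> 'a) set \<times> nat) set) module" and d \<theta>
    where C: "injective_complex R C d (tail 1) \<theta>" using gorenstein_injective_complex[OF gor] .
  have "\<forall>n J. regseq T n J \<longrightarrow> saturated (tail 1) J"
    using regseq_homogeneous T homogeneous_saturated by blast
  then show ?thesis by (rule injective_complex.irreducible_duality[OF C J _ s I y rad])
qed

text \<open>As long as \<open>R_+\<close> annihilates no nonzero element of \<open>R/J\<close>,
  there is a homogeneous regular element; a power of it lies in \<open>I\<close> and is still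
  regular. Since \<open>J\<close> grows strictly, the process ends with a socle element
  \<open>s\<close>.\<close>

lemma exists_maximal_regseq:
  assumes I: "ideal I R" and rad: "\<And>x. x \<in> tail 1 \<Longrightarrow> \<exists>j::nat. x [^] j \<in> I"
  defines "T \<equiv> I \<inter> (\<Union>k\<in>{0<..}. G k)"
  obtains n J s where "regseq T n J" "s \<in> carrier R" "s \<notin> J" "\<And>x. x \<in> tail 1 \<Longrightarrow> x \<otimes> s \<in> J"
proof -
  have T1: "T \<subseteq> tail 1" unfolding T_def using G_tail[of _ _ 1] by force
  have "\<forall>n. regseq T n J \<longrightarrow>
    (\<exists>n J s. regseq T n J \<and> s \<in> carrier R \<and> s \<notin> J \<and> (\<forall>x\<in>tail 1. x \<otimes> s \<in> J))" if "ideal J R" for J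
    using that
  proof (induction rule: noetherian_induct)
    case (step J)
    show ?case
    proof (intro allI impI)
      fix n assume J: "regseq T n J"
      show "\<exists>n J s. regseq T n J \<and> s \<in> carrier R \<and> s \<notin> J \<and> (\<forall>x\<in>tail 1. x \<otimes> s \<in> J)"
      proof (cases "\<exists>s\<in>carrier R. s \<notin> J \<and> (\<forall>x\<in>tail 1. x \<otimes> s \<in> J)")
        case False
        have J1: "J \<subseteq> tail 1" using regseq_subset[OF J tail_ideal T1] .
        then have Jc: "J \<noteq> carrier R" using one_notin_tail one_closed by blast
        have "\<exists>k>0. \<exists>x\<in>G k. colon J x = J"
          by (rule exists_homogeneous_regular[OF step(1) Jc]) (use False in blast)
        then obtain k x where x: "k > 0" "x \<in> G k" "colon J x = J" by blast
        have xc: "x \<in> carrier R" using G_carr x(2) by blast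
        obtain j :: nat where j: "x [^] j \<in> I" using rad G_tail[OF x(2), of 1] x(1) by auto
        \<comment> \<open>\<open>Suc j\<close> instead of \<open>j\<close> keeps the degree positive
          even if \<open>j = 0\<close>.\<close>
        define z where "z = x [^] Suc j"
        have zc: "z \<in> carrier R" using xc by (simp add: z_def)
        have "z \<in> G (Suc j * k)" unfolding z_def by (rule G_pow[OF x(2)])
        moreover have "z \<in> I" using ideal.I_r_closed[OF I j xc] by (simp add: z_def)
        ultimately have zT: "z \<in> T" unfolding T_def using x(1) by force
        have zJ: "colon J z = J" unfolding z_def by (rule colon_pow_eq[OF step(1) xc x(3)])
        have "z \<notin> J" using colon_eq_carrier[OF step(1), of z] zJ Jc by auto
        then show ?thesis
          using step(2)[OF adjoin_ideal[OF step(1) zc] adjoin_strict[OF step(1) zc]]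
            regseq.Suc[OF J zT zc zJ] by blast
      qed (use J in blast)
    qed
  qed
  then have "\<exists>n J s. regseq T n J \<and> s \<in> carrier R \<and> s \<notin> J \<and> (\<forall>x\<in>tail 1. x \<otimes> s \<in> J)"
    using regseq.zero[of T] zeroideal by blast
  then show thesis using that by blast
qed

text \<open>By duality \<open>J : (J : Q) = Q\<close> for the \<open>R\<^sub>+\<close>-primary ideals \<open>Q = J + R\<^sub>>\<^sub>e\<close>, while \<open>J : Q\<close> is
  independent of \<open>e\<close> for large \<open>e\<close>.\<close>

lemma maximal_regseq_contains_tail:
  assumes gor: "gorenstein_ring R" and J: "regseq T n J" and T: "T \<subseteq> (\<Union>k\<in>{0<..}. G k)"
    and s: "s \<in> carrier R" "s \<notin> J" "\<And>x. x \<in> tail 1 \<Longrightarrow> x \<otimes> s \<in> J"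
  shows "\<exists>N. tail N \<subseteq> J"
proof -
  have JI: "ideal J R" using regseq_ideal[OF J] .
  have Jhom: "homogeneous J" using regseq_homogeneous[OF J T] .
  \<comment> \<open>\<open>F m\<close> is \<open>J : R_(>=m)\<close>; these ideals increase with
    \<open>m\<close>.\<close>
  define F where "F m = {u \<in> carrier R. \<forall>f\<in>tail m. u \<otimes> f \<in> J}" for m
  have "\<exists>N. \<forall>m\<ge>N. F m = F N"
  proof (rule ascending_chain_stable)
    show "ideal (F m) R" for m
    proof (rule idealI_cring)
      show "\<zero> \<in> F m" using ideal_zero[OF JI] tail_carr by (simp add: F_def)
      show "\<And>x y. x \<in> F m \<Longrightarrow> y \<in> F m \<Longrightarrow> x \<oplus> y \<in> F m"
        using tail_carr ideal_add[OF JI] by (simp add: F_def l_distr)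
      show "\<And>r x. r \<in> carrier R \<Longrightarrow> x \<in> F m \<Longrightarrow> r \<otimes> x \<in> F m"
        using tail_carr ideal.I_l_closed[OF JI] by (simp add: F_def m_assoc)
    qed (auto simp: F_def)
    show "F m \<subseteq> F (Suc m)" for m using tail_antimono[of m "Suc m"] by (auto simp: F_def)
  qed
  then obtain N where N: "\<And>m. N \<le> m \<Longrightarrow> F m = F N" by blast
  have "f \<in> J" if f: "f \<in> tail N" for f
    using f
  proof (induction f rule: tail_induct)
    case (homogeneous e f)
    show ?case
    proof (rule ccontr)
      assume fJ: "f \<notin> J"
      \<comment> \<open>Large enough to contain \<open>R_+ f\<close>, yet missing \<open>f\<close>,
        because \<open>J\<close> is homogeneous and does not contain \<open>f\<close>.\<close>
      define Q where "Q = J <+>\<^bsub>R\<^esub> tail (Suc e)"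
      have QI: "ideal Q R" unfolding Q_def by (rule add_ideals[OF JI tail_ideal])
      have JQ: "J \<subseteq> Q" and tQ: "tail (Suc e) \<subseteq> Q"
        unfolding Q_def using summands_subset_set_add[OF JI tail_ideal] by blast+
      have fQ: "f \<notin> Q"
      proof
        assume "f \<in> Q"
        then obtain j t where jt: "j \<in> J" "t \<in> tail (Suc e)" "f = j \<oplus> t"
          unfolding Q_def by (auto simp: set_add_def')
        have c: "j \<in> carrier R" "t \<in> carrier R" using ideal_carr[OF JI jt(1)] tail_carr[OF jt(2)] .
        have "f = component e (j \<oplus> t)" using component_homogeneous[OF homogeneous(2), of e] jt(3) by simp
        also have "\<dots> = component e j" using c jt(2) by (simp add: component_add tail_def)
        finally show False using homogeneousD(2)[OF Jhom jt(1), of e] fJ by simp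
      qed
      have "\<exists>u\<in>carrier R. (\<forall>i\<in>Q. u \<otimes> i \<in> J) \<and> u \<otimes> f \<notin> J"
      proof (rule gorenstein_duality[OF gor J T s QI JQ homogeneous(3) fQ])
        fix x assume x: "x \<in> tail 1"
        show "x \<otimes> f \<in> Q" using tail_mult[OF x G_tail[OF homogeneous(2), of e]] tQ by auto
        show "\<exists>j::nat. x [^] j \<in> Q"
          using subsetD[OF tQ, of "x [^] Suc e"] tail_pow[OF x, of "Suc e"] by (intro exI[of _ "Suc e"]) simp
      qed
      then obtain u where u: "u \<in> carrier R" "\<And>i. i \<in> Q \<Longrightarrow> u \<otimes> i \<in> J" "u \<otimes> f \<notin> J" by blast
      \<comment> \<open>Modulo \<open>J\<close>, \<open>u\<close> kills everything of order above
        \<open>e\<close> but not \<open>f\<close> of degree \<open>e\<close>, against the stability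
        of \<open>F\<close> from \<open>N\<close> on.\<close>
      have "u \<in> F (Suc e)" using u tQ by (auto simp: F_def)
      then have "u \<in> F N" using N[of "Suc e"] homogeneous(1) by simp
      then show False using u(3) G_tail[OF homogeneous(2,1)] by (simp add: F_def)
    qed
  qed (rule ideal_add[OF JI])
  then show ?thesis by blast
qed

lemma regseq_bounded_generators:
  assumes "regseq T n J" "T \<subseteq> (\<Union>k\<in>{0<..}. G k)"
  shows "\<exists>H B. H \<subseteq> (\<Union>k\<in>{..B}. G k) \<and> J = Idl H"
  using assms
proof (induction rule: regseq.induct)
  case zero
  have "{\<zero>} \<subseteq> (\<Union>k\<in>{..0}. G k)" by simp
  moreover have "{\<zero>} = Idl {\<zero>}" using genideal_zero by simp
  ultimately show ?case by blast
next
  case (Suc n J x)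
  then obtain H B where H: "H \<subseteq> (\<Union>k\<in>{..B}. G k)" "J = Idl H" by blast
  obtain k where k: "x \<in> G k" using Suc by blast
  have "H \<subseteq> carrier R" using H(1) G_carr by blast
  then have "adjoin J x = Idl (insert x H)" using adjoin_genideal H(2) Suc.hyps(3) by simp
  moreover have "insert x H \<subseteq> (\<Union>i\<in>{..max B k}. G i)" using H(1) k by force
  ultimately show ?case by blast
qed

text \<open>Since the depth is at least \<open>2\<close>, raising the last two elements \<open>f, g\<close> of the regular sequence to
  powers \<open>f\<^sup>r\<^sup>+\<^sup>1, g\<^sup>s\<^sup>+\<^sup>1\<close> and multiplying \<open>u\<close> by \<open>f\<^sup>r g\<^sup>s\<close> makes the order of \<open>u\<close> exceed the degrees of the
  generators by any prescribed amount.\<close>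

lemma gorenstein_high_order_embedding:
  assumes gor: "gorenstein_ring R" and dim: "krull_dim R \<ge> 2"
    and I: "ideal I R" and y: "y \<in> carrier R" "y \<notin> I" "\<And>x. x \<in> tail 1 \<Longrightarrow> x \<otimes> y \<in> I"
    and rad: "\<And>x. x \<in> tail 1 \<Longrightarrow> \<exists>j::nat. x [^] j \<in> I"
  shows "\<exists>H B u. H \<subseteq> (\<Union>k\<in>{..B}. G k) \<and> u \<in> tail (B + K) \<and> (\<forall>i\<in>I. u \<otimes> i \<in> Idl H) \<and> u \<otimes> y \<notin> Idl H"
proof -
  define T where "T = I \<inter> (\<Union>k\<in>{0<..}. G k)"
  obtain n J s where J: "regseq T n J" and s: "s \<in> carrier R" "s \<notin> J" "\<And>x. x \<in> tail 1 \<Longrightarrow> x \<otimes> s \<in> J"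
    using exists_maximal_regseq[OF I rad] unfolding T_def by blast
  have T: "T \<subseteq> (\<Union>k\<in>{0<..}. G k)" and TI: "T \<subseteq> I" by (auto simp: T_def)
  obtain N where N: "tail N \<subseteq> J" using maximal_regseq_contains_tail[OF gor J T s] by blast
  have JI: "J \<subseteq> I" using regseq_subset[OF J I TI] .
  obtain u0 where u0: "u0 \<in> carrier R" "\<And>i. i \<in> I \<Longrightarrow> u0 \<otimes> i \<in> J" "u0 \<otimes> y \<notin> J"
    using gorenstein_duality[OF gor J T s I JI y rad] by blast
  \<comment> \<open>A sequence of length 0 or 1 would put \<open>tail N\<close> into the principal
    ideal of a homogeneous element of positive degree, contradicting the dimension; in length 0 that
    element is zero, viewed in degree 1.\<close>
  from J show ?thesis
  proof cases
    case zero
    have "tail N \<subseteq> adjoin {\<zero>} \<zero>" using N zero adjoin_incl[OF zeroideal zero_closed] by auto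
    then show ?thesis using krull_dim_less_2[of \<zero> 1 N] dim by simp
  next
    case (Suc n' J1 g)
    have gT: "g \<in> T" using Suc by simp
    then obtain b where b: "0 < b" "g \<in> G b" using T by blast
    from \<open>regseq T n' J1\<close> show ?thesis
    proof cases
      case zero
      then show ?thesis using krull_dim_less_2[OF b(2,1), of N] dim N Suc by simp
    next
      case (Suc n'' J0 f)
      have fT: "f \<in> T" using Suc by simp
      then obtain a where a: "0 < a" "f \<in> G a" using T by blast
      have J0: "regseq T n'' J0" using Suc by simp
      have J0I: "ideal J0 R" using regseq_ideal[OF J0] .
      have fg: "f \<in> carrier R" "g \<in> carrier R" using G_carr a(2) b(2) by auto
      have Jeq: "J = adjoin (adjoin J0 f) g" and cf: "colon J0 f = J0"
        and cg: "colon (adjoin J0 f) g = adjoin J0 f"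
        using \<open>J = adjoin J1 g\<close> \<open>colon J1 g = J1\<close> Suc by auto
      obtain H0 B0 where H0: "H0 \<subseteq> (\<Union>k\<in>{..B0}. G k)" "J0 = Idl H0"
        using regseq_bounded_generators[OF J0 T] by blast
      \<comment> \<open>These exponents give \<open>r a \<ge> b + K\<close> and
        \<open>t b \<ge> a + B0 + K\<close>. Hence the subtraction in \<open>B\<close> is exact,
        \<open>B\<close> dominates the generator degrees \<open>B0\<close>, \<open>(r+1) a\<close>
        and \<open>(t+1) b\<close>, and \<open>u\<close> has order at least
        \<open>B + K\<close>.\<close>
      define r t where "r = b + K" and "t = a + B0 + K"
      define B where "B = r * a + t * b - K"
      define H where "H = insert (g [^] Suc t) (insert (f [^] Suc r) H0)"
      define u where "u = f [^] r \<otimes> g [^] t \<otimes> u0"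
      have ra: "b + K \<le> r * a" using a(1) by (simp add: r_def)
      have tb: "a + B0 + K \<le> t * b" using b(1) by (simp add: t_def)
      have BK: "B + K = r * a + t * b" using ra by (simp add: B_def)
      have deg: "B0 \<le> B" "Suc r * a \<le> B" "Suc t * b \<le> B" using ra tb by (auto simp: B_def)
      have H0c: "H0 \<subseteq> carrier R" using H0(1) G_carr by blast
      have Hidl: "Idl H = adjoin (adjoin J0 (f [^] Suc r)) (g [^] Suc t)"
        unfolding H_def H0(2) using adjoin_genideal[OF H0c, of "f [^] Suc r"]
          adjoin_genideal[of "insert (f [^] Suc r) H0" "g [^] Suc t"] fg H0c by simp
      have "f [^] Suc r \<in> G (Suc r * a)" "g [^] Suc t \<in> G (Suc t * b)"
        using G_pow[OF a(2), of "Suc r"] G_pow[OF b(2), of "Suc t"] .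
      then have "H \<subseteq> (\<Union>k\<in>{..B}. G k)" unfolding H_def using H0(1) deg by force
      moreover have "u \<in> tail (B + K)"
      proof -
        have "f [^] r \<in> tail (r * a)" "g [^] t \<in> tail (t * b)"
          using G_tail[OF G_pow[OF a(2)]] G_tail[OF G_pow[OF b(2)]] by auto
        then have "u \<in> tail (r * a + t * b + 0)" unfolding u_def using tail_mult u0(1) by (metis tail_0)
        then show ?thesis using BK by simp
      qed
      moreover have "u \<otimes> i \<in> Idl H" if i: "i \<in> I" for i
      proof -
        have "u \<otimes> i = f [^] r \<otimes> g [^] t \<otimes> (u0 \<otimes> i)"
          using fg u0(1) ideal_carr[OF I i] by (simp add: u_def m_assoc)
        then show ?thesis
          unfolding Hidl using pow_mult_adjoin_adjoin[OF J0I fg, of "u0 \<otimes> i" r t] u0(2)[OF i] Jeq by simp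
      qed
      moreover have "u \<otimes> y \<notin> Idl H"
      proof
        assume "u \<otimes> y \<in> Idl H"
        moreover have "u \<otimes> y = f [^] r \<otimes> g [^] t \<otimes> (u0 \<otimes> y)" using fg u0(1) y(1) by (simp add: u_def m_assoc)
        ultimately show False
          using regular_pair_pow_colon[OF J0I fg cf cg, of "u0 \<otimes> y" r t] u0(1,3) y(1) Jeq unfolding Hidl by simp
      qed
      ultimately show ?thesis by blast
    qed
  qed
qed

end

section \<open>Frobenius powers and test ideals\<close>

context cring
begin

lemma binomial_theorem:
  assumes x: "x \<in> carrier R" and y: "y \<in> carrier R"
  shows "(x \<oplus> y) [^] (n::nat) = (\<Oplus>k\<in>{..n}. add_pow R (n choose k) (x [^] k \<otimes> y [^] (n - k)))"
proof (induction n)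
  case 0
  then show ?case using x y by simp
next
  case (Suc n)
  define F where "F j k = add_pow R (n choose k) (x [^] k \<otimes> y [^] (j - k))" for j k
  define E where "E k = add_pow R (n choose Suc k) (x [^] Suc k \<otimes> y [^] (n - k))" for k
  have Fc: "F j k \<in> carrier R" for j k using x y by (simp add: F_def)
  have Ec: "E k \<in> carrier R" for k using x y by (simp add: E_def)
  have IH: "(x \<oplus> y) [^] n = (\<Oplus>k\<in>{..n}. F n k)" using Suc by (simp add: F_def)
  have sc: "(\<Oplus>k\<in>{..n}. F n k) \<in> carrier R" using Fc by simp
  have "(\<Oplus>k\<in>{..Suc n}. add_pow R (Suc n choose k) (x [^] k \<otimes> y [^] (Suc n - k)))
      = (\<Oplus>k\<in>{..n}. add_pow R (Suc n choose Suc k) (x [^] Suc k \<otimes> y [^] (n - k))) \<oplus> y [^] Suc n"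
    using x y by (subst finsum_Suc2) simp_all
  also have "(\<Oplus>k\<in>{..n}. add_pow R (Suc n choose Suc k) (x [^] Suc k \<otimes> y [^] (n - k)))
      = (\<Oplus>k\<in>{..n}. x \<otimes> F n k \<oplus> E k)"
  proof (rule finsum_cong')
    fix k assume "k \<in> {..n}"
    have "x \<otimes> F n k = add_pow R (n choose k) (x [^] Suc k \<otimes> y [^] (n - k))"
      using x y by (simp add: F_def add_pow_rdistr m_ac)
    then show "add_pow R (Suc n choose Suc k) (x [^] Suc k \<otimes> y [^] (n - k)) = x \<otimes> F n k \<oplus> E k"
      using x y by (simp add: E_def add.nat_pow_mult)
  qed (use x Fc Ec in auto)
  also have "\<dots> = (\<Oplus>k\<in>{..n}. x \<otimes> F n k) \<oplus> (\<Oplus>k\<in>{..n}. E k)"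
    using x Fc Ec by (intro finsum_addf) auto
  also have "(\<Oplus>k\<in>{..n}. x \<otimes> F n k) = x \<otimes> (x \<oplus> y) [^] n"
    unfolding IH using x Fc by (intro finsum_rdistr[symmetric]) auto
  also have "(x \<otimes> (x \<oplus> y) [^] n \<oplus> (\<Oplus>k\<in>{..n}. E k)) \<oplus> y [^] Suc n
      = x \<otimes> (x \<oplus> y) [^] n \<oplus> ((\<Oplus>k\<in>{..n}. E k) \<oplus> y [^] Suc n)"
    using x y Ec by (simp add: a_assoc)
  also have "(\<Oplus>k\<in>{..n}. E k) \<oplus> y [^] Suc n = (\<Oplus>k\<in>{..Suc n}. F (Suc n) k)"
  proof -
    have "(\<Oplus>k\<in>{..n}. E k) = (\<Oplus>k\<in>{..n}. F (Suc n) (Suc k))"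
      using x y by (intro finsum_cong') (simp_all add: E_def F_def)
    moreover have "F (Suc n) 0 = y [^] Suc n" using x y by (simp add: F_def)
    ultimately show ?thesis using Fc by (subst finsum_Suc2) simp_all
  qed
  also have "\<dots> = (\<Oplus>k\<in>{..n}. F (Suc n) k)"
    using x y Fc by (subst finsum_Suc) (simp_all add: F_def[of _ "Suc n"] binomial_eq_0)
  also have "\<dots> = (\<Oplus>k\<in>{..n}. y \<otimes> F n k)"
  proof (rule finsum_cong')
    fix k assume "k \<in> {..n}"
    then have "y [^] (Suc n - k) = y [^] (n - k) \<otimes> y" by (simp add: Suc_diff_le)
    then show "F (Suc n) k = y \<otimes> F n k"
      using x y by (simp add: F_def add_pow_rdistr m_ac)
  qed (use y Fc in auto)
  also have "\<dots> = y \<otimes> (x \<oplus> y) [^] n"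
    unfolding IH using y Fc by (intro finsum_rdistr[symmetric]) auto
  also have "x \<otimes> (x \<oplus> y) [^] n \<oplus> y \<otimes> (x \<oplus> y) [^] n = (x \<oplus> y) [^] Suc n"
    using x y by (simp add: l_distr m_comm)
  finally show ?case by simp
qed

lemma frobenius_add:
  fixes p :: nat
  assumes p: "Factorial_Ring.prime p" "add_pow R p \<one> = \<zero>" and x: "x \<in> carrier R" and y: "y \<in> carrier R"
  shows "(x \<oplus> y) [^] p = x [^] p \<oplus> y [^] p"
proof -
  have z: "add_pow R (p choose k) a = \<zero>" if "0 < k" "k < p" "a \<in> carrier R" for k a
  proof -
    have "p dvd (p choose k)" using that(1,2) p(1) by (intro dvd_choose_prime) auto
    then obtain m where m: "p choose k = p * m" by (rule dvdE)
    have "add_pow R p a = (add_pow R p \<one>) \<otimes> a" using that(3) by (simp add: add_pow_ldistr)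
    then have "add_pow R p a = \<zero>" using p(2) that(3) by simp
    then show ?thesis using m that(3) add.nat_pow_pow[of a m p] by (simp add: add.nat_pow_one)
  qed
  have "(x \<oplus> y) [^] p = (\<Oplus>k\<in>{..p}. add_pow R (p choose k) (x [^] k \<otimes> y [^] (p - k)))"
    by (rule binomial_theorem[OF x y])
  also have "\<dots> = (\<Oplus>k\<in>{0, p}. add_pow R (p choose k) (x [^] k \<otimes> y [^] (p - k)))"
    by (rule add.finprod_mono_neutral_cong_right) (use z x y in auto)
  also have "\<dots> = y [^] p \<oplus> x [^] p" using prime_gt_0_nat[OF p(1)] x y by (subst finsum_insert) auto
  finally show ?thesis using x y by (simp add: a_comm)
qed

lemma frobenius_power_add:
  fixes p :: nat
  assumes p: "Factorial_Ring.prime p" "add_pow R p \<one> = \<zero>" and x: "x \<in> carrier R" and y: "y \<in> carrier R"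
  shows "(x \<oplus> y) [^] (p ^ e) = x [^] (p ^ e) \<oplus> y [^] (p ^ e)"
proof (induction e)
  case (Suc e)
  have "(x \<oplus> y) [^] (p ^ Suc e) = ((x \<oplus> y) [^] (p ^ e)) [^] p"
    using nat_pow_pow[of "x \<oplus> y" "p ^ e" p] x y by (simp add: mult.commute)
  also have "\<dots> = (x [^] (p ^ e)) [^] p \<oplus> (y [^] (p ^ e)) [^] p"
    unfolding Suc using frobenius_add[OF p] x y by simp
  finally show ?case
    using nat_pow_pow[of x "p ^ e" p] nat_pow_pow[of y "p ^ e" p] x y by (simp add: mult.commute)
qed (use x y in simp)

section \<open>Frobenius powers and ordinary powers of ideals\<close>

lemma frobenius_power_ideal: "I \<subseteq> carrier R \<Longrightarrow> ideal (frobenius_power R I q) R"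
  unfolding frobenius_power_def by (rule genideal_ideal) auto

lemma pow_mem_frobenius_power: "I \<subseteq> carrier R \<Longrightarrow> i \<in> I \<Longrightarrow> i [^] q \<in> frobenius_power R I q"
  unfolding frobenius_power_def using genideal_self[of "{i [^] q |i. i \<in> I}"] by blast

lemma frobenius_power_least:
  "ideal K R \<Longrightarrow> (\<And>i. i \<in> I \<Longrightarrow> i [^] q \<in> K) \<Longrightarrow> frobenius_power R I q \<subseteq> K"
  unfolding frobenius_power_def by (rule genideal_minimal) auto

lemma frobenius_power_mono: "I \<subseteq> J \<Longrightarrow> J \<subseteq> carrier R \<Longrightarrow> frobenius_power R I q \<subseteq> frobenius_power R J q"
  by (rule frobenius_power_least[OF frobenius_power_ideal]) (auto intro: pow_mem_frobenius_power)

text \<open>Additivity of the \<open>q\<close>-th power map makes the elements whose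
  \<open>q\<close>-th power lies in the right-hand side an ideal, and this ideal contains
  \<open>H\<close>.\<close>

lemma frobenius_power_genideal:
  fixes p :: nat
  assumes p: "Factorial_Ring.prime p" "add_pow R p \<one> = \<zero>" and H: "H \<subseteq> carrier R"
  shows "frobenius_power R (Idl H) (p ^ e) = Idl {h [^] (p ^ e) | h. h \<in> H}"
proof
  let ?K = "Idl {h [^] (p ^ e) | h. h \<in> H}"
  have Hq: "{h [^] (p ^ e) | h. h \<in> H} \<subseteq> carrier R" using H by auto
  have K: "ideal ?K R" by (rule genideal_ideal[OF Hq])
  have "Idl H \<subseteq> {x \<in> carrier R. x [^] (p ^ e) \<in> ?K}"
  proof (rule genideal_minimal[OF idealI_cring])
    show "\<zero> \<in> {x \<in> carrier R. x [^] (p ^ e) \<in> ?K}"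
      using ideal_zero[OF K] prime_gt_0_nat[OF p(1)] by (simp add: nat_pow_zero)
    show "H \<subseteq> {x \<in> carrier R. x [^] (p ^ e) \<in> ?K}" using H genideal_self[OF Hq] by blast
    fix x y assume xy: "x \<in> {x \<in> carrier R. x [^] (p ^ e) \<in> ?K}" "y \<in> {x \<in> carrier R. x [^] (p ^ e) \<in> ?K}"
    then show "x \<oplus> y \<in> {x \<in> carrier R. x [^] (p ^ e) \<in> ?K}"
      using frobenius_power_add[OF p, of x y e] ideal_add[OF K] by simp
  next
    fix r x assume "r \<in> carrier R" "x \<in> {x \<in> carrier R. x [^] (p ^ e) \<in> ?K}"
    then show "r \<otimes> x \<in> {x \<in> carrier R. x [^] (p ^ e) \<in> ?K}"
      using ideal.I_l_closed[OF K] by (simp add: nat_pow_distrib)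
  qed auto
  then show "frobenius_power R (Idl H) (p ^ e) \<subseteq> ?K" by (intro frobenius_power_least[OF K]) blast
  have "Idl H \<subseteq> carrier R" using ideal_subset[OF genideal_ideal[OF H]] .
  then show "?K \<subseteq> frobenius_power R (Idl H) (p ^ e)"
    using genideal_self[OF H] pow_mem_frobenius_power
    by (intro genideal_minimal[OF frobenius_power_ideal]) auto
qed

lemma ideal_prod_mono: "I \<subseteq> I' \<Longrightarrow> J \<subseteq> J' \<Longrightarrow> ideal_prod R I J \<subseteq> ideal_prod R I' J'"
proof
  fix x assume IJ: "I \<subseteq> I'" "J \<subseteq> J'" and "x \<in> ideal_prod R I J"
  from this(3) show "x \<in> ideal_prod R I' J'"
    by (induction x rule: ideal_prod.induct) (use IJ in \<open>auto intro: ideal_prod.intros\<close>)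
qed

lemma ideal_prod_least:
  "ideal K R \<Longrightarrow> (\<And>i j. i \<in> I \<Longrightarrow> j \<in> J \<Longrightarrow> i \<otimes> j \<in> K) \<Longrightarrow> ideal_prod R I J \<subseteq> K"
proof
  fix x assume K: "ideal K R" "\<And>i j. i \<in> I \<Longrightarrow> j \<in> J \<Longrightarrow> i \<otimes> j \<in> K" and "x \<in> ideal_prod R I J"
  from this(3) show "x \<in> K"
    by (induction x rule: ideal_prod.induct) (use K ideal_add[OF K(1)] in auto)
qed

lemma ideal_power_0: "ideal_power R A (0::nat) = carrier R"
  and ideal_power_Suc: "ideal_power R A (Suc n) = ideal_prod R (ideal_power R A n) A"
  by (simp_all add: ideals_set_def nat_pow_def)

lemma ideal_power_ideal: "ideal A R \<Longrightarrow> ideal (ideal_power R A (n::nat)) R"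
proof (induction n)
  case (Suc n)
  then show ?case unfolding ideal_power_Suc by (intro ideal_prod_is_ideal)
qed (unfold ideal_power_0, rule oneideal)

lemma pow_mem_ideal_power: "x \<in> A \<Longrightarrow> x [^] (n::nat) \<in> ideal_power R A n"
proof (induction n)
  case (Suc n)
  then show ?case unfolding ideal_power_Suc nat_pow_Suc by (intro ideal_prod.prod)
qed (unfold ideal_power_0, simp)

text \<open>From \<open>i = 1 - a\<close> one gets \<open>i^q = 1 - a w\<close> in the Frobenius
  power, hence also \<open>1 - b\<close> with \<open>b = (a w)^q\<close> in the ordinary power. The
  two powers are again comaximal, and \<open>y = y (1 - b) + b y\<close>.\<close>

lemma comaximal_frobenius_power:
  assumes I: "ideal I R" and A: "ideal A R" and c: "i \<in> I" "a \<in> A" "i \<oplus> a = \<one>"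
    and y: "y \<in> frobenius_power R I (q::nat)" "y \<in> ideal_power R A q"
  shows "y \<in> ideal_prod R (ideal_power R A q) (frobenius_power R I q)"
proof -
  let ?F = "frobenius_power R I q" and ?P = "ideal_power R A q"
  have F: "ideal ?F R" using frobenius_power_ideal[OF ideal_subset[OF I]] .
  have P: "ideal ?P R" using ideal_power_ideal[OF A] .
  have PF: "ideal (ideal_prod R ?P ?F) R" using ideal_prod_is_ideal[OF P F] .
  have ic: "i \<in> carrier R" and ac: "a \<in> carrier R" and yc: "y \<in> carrier R"
    using ideal_carr[OF I c(1)] ideal_carr[OF A c(2)] ideal_carr[OF F y(1)] .
  have "(i \<oplus> a) \<ominus> a = i" using ic ac by algebra
  then have ia: "\<one> \<ominus> a = i" using c(3) by simp
  obtain w where w: "w \<in> carrier R" "i [^] q = \<one> \<ominus> a \<otimes> w" using one_minus_pow_eq[OF ac, of q] ia by auto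
  define b where "b = (a \<otimes> w) [^] q"
  have bc: "b \<in> carrier R" using ac w(1) by (simp add: b_def)
  have 1: "\<one> \<ominus> b \<in> ?F"
    unfolding b_def using one_minus_pow_mem[OF F, of "a \<otimes> w" q] w ac
      pow_mem_frobenius_power[OF ideal_subset[OF I] c(1), of q] by simp
  have 2: "b \<in> ?P"
    using ideal.I_r_closed[OF P pow_mem_ideal_power[OF c(2)]] w ac by (simp add: b_def nat_pow_distrib)
  have "y = y \<otimes> (\<one> \<ominus> b) \<oplus> b \<otimes> y" using yc bc by algebra
  moreover have "y \<otimes> (\<one> \<ominus> b) \<oplus> b \<otimes> y \<in> ideal_prod R ?P ?F"
    by (intro ideal_add[OF PF] ideal_prod.prod y 1 2)
  ultimately show ?thesis by simp
qed

end

context graded_ring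
begin

section \<open>Orders of elements and products of ideals\<close>

lemma ideal_prod_tail_mult:
  assumes "r \<in> G k" "x \<in> ideal_prod R J (tail a)" "ideal J R"
  shows "r \<otimes> x \<in> ideal_prod R J (tail (a + k))"
  using assms(2)
proof (induction x rule: ideal_prod.induct)
  case (prod i j)
  have c: "r \<in> carrier R" "i \<in> carrier R" "j \<in> carrier R"
    using G_carr[OF assms(1)] ideal_carr[OF assms(3) prod(1)] tail_carr[OF prod(2)] .
  have "r \<otimes> (i \<otimes> j) = i \<otimes> (j \<otimes> r)" using c by algebra
  then show ?case using ideal_prod.prod[OF prod(1) tail_mult[OF prod(2) G_tail[OF assms(1) order_refl]]] by simp
next
  case (sum s t)
  then have "s \<in> carrier R" "t \<in> carrier R"
    using ideal_carr[OF ideal_prod_is_ideal[OF assms(3) tail_ideal]] by blast+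
  then show ?case using sum G_carr[OF assms(1)] by (simp add: r_distr ideal_prod.sum)
qed

text \<open>In degree \<open>n\<close> the coefficients of generators of degree at most
  \<open>B\<close> can be taken of order at least \<open>n - B\<close>. Instead of choosing
  coefficients, the proof checks that the elements with this property in every degree form an ideal
  \<open>A\<close> containing \<open>H\<close>.\<close>

lemma genideal_inter_tail:
  assumes H: "H \<subseteq> (\<Union>k\<in>{..B}. G k)" and x: "x \<in> Idl H" "x \<in> tail n"
  shows "x \<in> ideal_prod R (Idl H) (tail (n - B))"
proof -
  have Hc: "H \<subseteq> carrier R" using H G_carr by blast
  have J: "ideal (Idl H) R" using genideal_ideal[OF Hc] .
  have Pi: "ideal (ideal_prod R (Idl H) (tail a)) R" for a by (rule ideal_prod_is_ideal[OF J tail_ideal])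
  have mono: "ideal_prod R (Idl H) (tail a) \<subseteq> ideal_prod R (Idl H) (tail b)" if "b \<le> a" for a b
    by (rule ideal_prod_mono[OF order_refl tail_antimono[OF that]])
  define A where "A = {x \<in> carrier R. \<forall>n. component n x \<in> ideal_prod R (Idl H) (tail (n - B))}"
  have "ideal A R"
  proof (rule idealI_cring)
    show "A \<subseteq> carrier R" by (auto simp: A_def)
    show "\<zero> \<in> A" using ideal_zero[OF Pi] by (simp add: A_def)
    show "\<And>x y. x \<in> A \<Longrightarrow> y \<in> A \<Longrightarrow> x \<oplus> y \<in> A" by (simp add: A_def component_add ideal_prod.sum)
    fix r x assume r: "r \<in> carrier R" and x: "x \<in> A"
    have xc: "x \<in> carrier R" using x by (simp add: A_def)
    show "r \<otimes> x \<in> A" using r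
    proof (induction r rule: homogeneous_induct)
      case (homogeneous k h)
      have "component n (h \<otimes> x) \<in> ideal_prod R (Idl H) (tail (n - B))" for n
      proof (cases "n < k")
        case True
        then show ?thesis using component_mult[OF homogeneous(1) xc] ideal_zero[OF Pi] by simp
      next
        case False
        have "h \<otimes> component (n - k) x \<in> ideal_prod R (Idl H) (tail (n - k - B + k))"
          by (rule ideal_prod_tail_mult[OF homogeneous(1) _ J]) (use x in \<open>unfold A_def, blast\<close>)
        \<comment> \<open>An inequality only, since \<open>n - k - B\<close> may be truncated to
          0.\<close>
        moreover have "n - B \<le> n - k - B + k" by linarith
        ultimately show ?thesis
          using component_mult[OF homogeneous(1) xc, of n] False subsetD[OF mono] by simp
      qed
      then show ?case using homogeneous xc by (simp add: A_def)
    next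
      case (add r s)
      then show ?case using xc by (simp add: A_def l_distr component_add ideal_prod.sum)
    qed
  qed
  moreover have "H \<subseteq> A"
  proof
    fix h assume h: "h \<in> H"
    then obtain k where k: "k \<le> B" "h \<in> G k" using H by auto
    have "h \<otimes> \<one> \<in> ideal_prod R (Idl H) (tail 0)"
      using ideal_prod.prod[of h "Idl H" \<one> "tail 0"] genideal_self[OF Hc] h by auto
    then show "h \<in> A"
      using k G_carr[OF k(2)] component_homogeneous[OF k(2)] ideal_zero[OF Pi] by (auto simp: A_def simp del: tail_0)
  qed
  ultimately have "x \<in> A" using genideal_minimal x(1) by blast
  then have xA: "\<And>i. component i x \<in> ideal_prod R (Idl H) (tail (i - B))" and xc: "x \<in> carrier R"
    by (auto simp: A_def)
  show ?thesis
  proof (rule mem_if_components[OF Pi xc])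
    show "component i x \<in> ideal_prod R (Idl H) (tail (n - B))" for i
    proof (cases "n \<le> i")
      case True
      then show ?thesis using subsetD[OF mono xA, of "n - B" i] by (simp add: diff_le_mono)
    next
      case False
      then show ?thesis using x(2) ideal_zero[OF Pi] by (simp add: tail_def)
    qed
  qed
qed

text \<open>The constant \<open>K\<close> is independent of \<open>e\<close>; iteration therefore
  puts \<open>R_(>=nK)\<close> inside the \<open>n\<close>-th power of \<open>A\<close>, with a
  bound linear in \<open>n\<close>.\<close>

definition absorbs_tail :: "'a set \<Rightarrow> nat \<Rightarrow> bool" where
  "absorbs_tail A K \<longleftrightarrow> (\<forall>e. tail (e + K) \<subseteq> ideal_prod R A (tail e))"

lemma absorbs_tail_1: "\<exists>K. absorbs_tail (tail 1) K"
proof -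
  obtain H where H: "finite H" "H \<subseteq> tail 1" "\<And>h. h \<in> H \<Longrightarrow> \<exists>k. h \<in> G k" "tail 1 = Idl H"
    using finite_homogeneous_generators[OF homogeneous_tail] by blast
  obtain k where k: "\<And>h. h \<in> H \<Longrightarrow> h \<in> G (k h)" using H(3) by metis
  define B where "B = Max (insert 0 (k ` H))"
  have "h \<in> (\<Union>k\<in>{..B}. G k)" if "h \<in> H" for h
    using k[OF that] H(1) that unfolding B_def by (intro UN_I[of "k h"]) auto
  then have HB: "H \<subseteq> (\<Union>k\<in>{..B}. G k)" by blast
  \<comment> \<open>The summand 1 places the elements in \<open>R_+\<close> even when
    \<open>e\<close> and \<open>B\<close> are 0.\<close>
  have "tail (e + (B + 1)) \<subseteq> ideal_prod R (tail 1) (tail e)" for e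
  proof
    fix x assume x: "x \<in> tail (e + (B + 1))"
    then have "x \<in> Idl H" using tail_antimono[of 1 "e + (B + 1)"] H(4) by auto
    then have "x \<in> ideal_prod R (tail 1) (tail (e + (B + 1) - B))"
      using genideal_inter_tail[OF HB _ x] H(4) by simp
    then show "x \<in> ideal_prod R (tail 1) (tail e)"
      using ideal_prod_mono[OF order_refl tail_antimono[of e "e + 1"], of "tail 1"] by auto
  qed
  then show ?thesis unfolding absorbs_tail_def by blast
qed

lemma absorbs_tail_mono: "absorbs_tail A K \<Longrightarrow> A \<subseteq> A' \<Longrightarrow> absorbs_tail A' K"
  unfolding absorbs_tail_def using ideal_prod_mono[OF _ order_refl] by blast

lemma absorbs_tail_prod:
  assumes "ideal A R" "ideal B R" "absorbs_tail A K" "absorbs_tail B L"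
  shows "absorbs_tail (ideal_prod R A B) (L + K)"
  unfolding absorbs_tail_def
proof
  fix e
  have "tail (e + L + K) \<subseteq> ideal_prod R A (tail (e + L))" using assms(3) by (simp add: absorbs_tail_def)
  also have "\<dots> \<subseteq> ideal_prod R A (ideal_prod R B (tail e))"
    by (rule ideal_prod_mono) (use assms(4) in \<open>auto simp: absorbs_tail_def\<close>)
  also have "\<dots> = ideal_prod R (ideal_prod R A B) (tail e)"
    using ideal_prod_assoc[OF assms(1,2) tail_ideal] by simp
  finally show "tail (e + (L + K)) \<subseteq> ideal_prod R (ideal_prod R A B) (tail e)" by (simp add: add.assoc)
qed

text \<open>An ideal \<open>I\<close> maximal among those above \<open>A\<close> without the
  property is closed under roots and prime: if \<open>x y\<close> is in \<open>I\<close>, then the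
  product of \<open>I + x\<close> and \<open>I + y\<close> lies in \<open>I\<close>, and products
  inherit the property. Hence \<open>I\<close> contains \<open>R_+\<close>, which does have it by
  \<open>absorbs_tail_1\<close>.\<close>

lemma absorbs_tail_primary:
  assumes A: "ideal A R" and rad: "\<And>x. x \<in> tail 1 \<Longrightarrow> \<exists>j::nat. x [^] j \<in> A"
  shows "\<exists>K. absorbs_tail A K"
proof (rule ccontr)
  assume "\<not> ?thesis"
  then obtain I where I: "ideal I R" "A \<subseteq> I" "\<not> (\<exists>K. absorbs_tail I K)"
    and max: "\<And>J. ideal J R \<Longrightarrow> I \<subset> J \<Longrightarrow> \<not> \<not> (\<exists>K. absorbs_tail J K)"
    using noetherian_maximal[OF A, of "\<lambda>I. \<not> (\<exists>K. absorbs_tail I K)"] by blast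
  have prime: "x \<in> I \<or> y \<in> I" if xy: "x \<in> carrier R" "y \<in> carrier R" "x \<otimes> y \<in> I" for x y
  proof (rule ccontr)
    assume n: "\<not> (x \<in> I \<or> y \<in> I)"
    have ax: "ideal (adjoin I x) R" "ideal (adjoin I y) R" using adjoin_ideal[OF I(1)] xy by auto
    obtain K where "absorbs_tail (adjoin I x) K" using max[OF ax(1)] adjoin_strict[OF I(1) xy(1)] n by blast
    moreover obtain L where "absorbs_tail (adjoin I y) L" using max[OF ax(2)] adjoin_strict[OF I(1) xy(2)] n by blast
    ultimately have "absorbs_tail (ideal_prod R (adjoin I x) (adjoin I y)) (L + K)"
      using absorbs_tail_prod[OF ax] by blast
    moreover have "ideal_prod R (adjoin I x) (adjoin I y) \<subseteq> I"
    proof (rule ideal_prod_least[OF I(1)])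
      fix a b assume "a \<in> adjoin I x" "b \<in> adjoin I y"
      then obtain i r j s where a: "i \<in> I" "r \<in> carrier R" "a = i \<oplus> r \<otimes> x"
        and b: "j \<in> I" "s \<in> carrier R" "b = j \<oplus> s \<otimes> y" by (metis adjoinE)
      have c: "i \<in> carrier R" "j \<in> carrier R" using ideal_carr[OF I(1)] a(1) b(1) by auto
      have "a \<otimes> b = (j \<oplus> s \<otimes> y) \<otimes> i \<oplus> (r \<otimes> x) \<otimes> j \<oplus> (r \<otimes> s) \<otimes> (x \<otimes> y)"
        unfolding a(3) b(3) using c a(2) b(2) xy(1,2) by algebra
      also have "\<dots> \<in> I"
        by (intro ideal_add[OF I(1)] ideal.I_l_closed[OF I(1)] a(1) b(1) xy(3)) (use c a(2) b(2) xy in auto)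
      finally show "a \<otimes> b \<in> I" .
    qed
    ultimately show False using I(3) absorbs_tail_mono by blast
  qed
  have "I \<noteq> carrier R"
  proof
    assume "I = carrier R"
    then have "tail 1 \<subseteq> I" using tail_carr by blast
    then show False using I(3) absorbs_tail_1 absorbs_tail_mono by blast
  qed
  then have one: "\<one> \<notin> I" using ideal.one_imp_carrier[OF I(1)] by blast
  have pow: "x [^] (j::nat) \<in> I \<Longrightarrow> x \<in> I" if "x \<in> carrier R" for x j
  proof (induction j)
    case (Suc j)
    then show ?case using prime[of "x [^] j" x] that by auto
  qed (use one in simp)
  have "tail 1 \<subseteq> I" using rad pow tail_carr I(2) by blast
  then show False using I(3) absorbs_tail_1 absorbs_tail_mono by blast
qed

lemma tail_subset_ideal_power:
  assumes A: "ideal A R" and K: "absorbs_tail A K"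
  shows "tail (n * K) \<subseteq> ideal_power R A n"
proof (induction n)
  case 0
  show ?case unfolding ideal_power_0 by (auto dest: tail_carr)
next
  case (Suc n)
  have "tail (n * K + K) \<subseteq> ideal_prod R A (tail (n * K))" using K by (simp add: absorbs_tail_def)
  also have "\<dots> \<subseteq> ideal_prod R A (ideal_power R A n)" by (rule ideal_prod_mono[OF order_refl Suc])
  also have "\<dots> = ideal_power R A (Suc n)"
    unfolding ideal_power_Suc by (rule ideal_prod_commute[OF A ideal_power_ideal[OF A]])
  finally show ?case by (simp add: add.commute)
qed

text \<open>If \<open>p\<close> divided \<open>m k\<close> but neither factor, then \<open>m\<close>
  times 1 would be invertible in the base field and \<open>k\<close> times 1 nonzero, although their
  product is zero.\<close>

lemma ring_char_base_field:
  fixes p :: nat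
  assumes "ring_char (R\<lparr>carrier := G 0\<rparr>) = p" "p > 0"
  shows "Factorial_Ring.prime p" "add_pow R p \<one> = \<zero>"
proof -
  have eq: "add_pow (R\<lparr>carrier := G 0\<rparr>) (n::nat) \<one> = add_pow R n \<one>" for n
    by (simp add: add_pow_def nat_pow_def)
  have ex: "\<exists>n::nat>0. add_pow R n \<one> = \<zero>"
    using assms by (auto simp: ring_char_def eq split: if_splits)
  then have p: "p = (LEAST n. 0 < n \<and> add_pow R n \<one> = \<zero>)"
    using assms(1) by (simp add: ring_char_def eq)
  show p0: "add_pow R p \<one> = \<zero>" using ex LeastI_ex[of "\<lambda>n. 0 < n \<and> add_pow R n \<one> = \<zero>"] p by auto
  have least: "add_pow R m \<one> \<noteq> \<zero>" if "0 < m" "m < p" for m :: nat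
    using not_less_Least[of m "\<lambda>n. 0 < n \<and> add_pow R n \<one> = \<zero>"] that p by auto
  have G0: "add_pow R m \<one> \<in> G 0" for m :: nat
    by (induction m) (auto simp: G_add G_one)
  show "Factorial_Ring.prime p"
  proof (rule prime_natI)
    show "2 \<le> p"
    proof (rule ccontr)
      assume "\<not> 2 \<le> p"
      then have "p = 1" using assms(2) by simp
      then show False using p0 one_not_zero by simp
    qed
    fix m k assume mk: "p dvd m * k"
    show "p dvd m \<or> p dvd k"
    proof (rule ccontr)
      assume n: "\<not> (p dvd m \<or> p dvd k)"
      have mod: "add_pow R m \<one> = add_pow R (m mod p) \<one>" for m :: nat
      proof -
        have "add_pow R m \<one> = add_pow R (m div p * p + m mod p) \<one>" by simp
        also have "\<dots> = add_pow R (m div p * p) \<one> \<oplus> add_pow R (m mod p) \<one>" by (simp add: add.nat_pow_mult)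
        also have "add_pow R (m div p * p) \<one> = \<zero>"
          using add.nat_pow_pow[of \<one> "m div p" p] p0 by (simp add: mult.commute)
        finally show ?thesis by simp
      qed
      have nz: "add_pow R j \<one> \<noteq> \<zero>" if "\<not> p dvd j" for j :: nat
        using least[of "j mod p"] mod[of j] that assms(2) by (simp add: dvd_eq_mod_eq_0)
      obtain u where u: "u \<in> G 0" "u \<otimes> add_pow R m \<one> = \<one>" using base_unit[OF G0 nz] n by blast
      have "add_pow R m \<one> \<otimes> add_pow R k \<one> = add_pow R (m * k) \<one>"
        using add.nat_pow_pow[of \<one> m k] by (simp add: add_pow_ldistr mult.commute)
      also have "\<dots> = \<zero>" using mod[of "m * k"] mk by simp
      finally have "u \<otimes> (add_pow R m \<one> \<otimes> add_pow R k \<one>) = \<zero>" using G_carr[OF u(1)] by simp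
      then have "add_pow R k \<one> = \<zero>" using u G_carr[OF u(1)] by (simp flip: m_assoc)
      then show False using nz n by blast
    qed
  qed
qed

section \<open>Comparison of the two closures\<close>

lemma tc_right_mono:
  assumes "I \<subseteq> I'" "ideal I' R"
  shows "tc_right R p A I \<subseteq> tc_right R p A I'"
proof
  fix x assume "x \<in> tc_right R p A I"
  then obtain c where c: "x \<in> carrier R" "c \<in> ring_o R"
    "\<forall>\<^sub>F e in sequentially. \<forall>y\<in>ideal_power R A (p ^ e). c \<otimes> y \<otimes> x [^] (p ^ e) \<in> frobenius_power R I (p ^ e)"
    unfolding tc_right_def by blast
  have "\<forall>\<^sub>F e in sequentially. \<forall>y\<in>ideal_power R A (p ^ e). c \<otimes> y \<otimes> x [^] (p ^ e) \<in> frobenius_power R I' (p ^ e)"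
    using c(3) by (rule eventually_mono) (use frobenius_power_mono[OF assms(1) ideal_subset[OF assms(2)]] in blast)
  then show "x \<in> tc_right R p A I'" unfolding tc_right_def using c(1,2) by blast
qed

lemma tc_left_subset_tc_right:
  assumes "ideal A R" "ideal I R"
  shows "tc_left R p A I \<subseteq> tc_right R p A I"
proof
  fix x assume "x \<in> tc_left R p A I"
  then obtain c where c: "x \<in> carrier R" "c \<in> ring_o R"
    "\<forall>\<^sub>F e in sequentially. \<forall>y\<in>ideal_power R A (p ^ e).
       c \<otimes> y \<otimes> x [^] (p ^ e) \<in> ideal_prod R (ideal_power R A (p ^ e)) (frobenius_power R I (p ^ e))"
    unfolding tc_left_def by blast
  have "\<forall>\<^sub>F e in sequentially. \<forall>y\<in>ideal_power R A (p ^ e). c \<otimes> y \<otimes> x [^] (p ^ e) \<in> frobenius_power R I (p ^ e)"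
    using c(3)
    by (rule eventually_mono)
      (use ideal_prod_inter[OF ideal_power_ideal[OF assms(1)] frobenius_power_ideal[OF ideal_subset[OF assms(2)]]] in blast)
  then show "x \<in> tc_right R p A I" unfolding tc_right_def using c(1,2) by blast
qed

lemma ring_o_carr: "c \<in> ring_o R \<Longrightarrow> c \<in> carrier R"
  by (simp add: ring_o_def)

text \<open>The multiplier \<open>c'\<close> is kept: \<open>c' y x^q\<close> lies in the power of
  \<open>A\<close> because \<open>y\<close> does, and comaximality turns the intersection with the
  Frobenius power into a product.\<close>

lemma tc_right_subset_tc_left_comaximal:
  assumes A: "ideal A R" and I: "ideal I R" and c: "i \<in> I" "a \<in> A" "i \<oplus> a = \<one>"
  shows "tc_right R p A I \<subseteq> tc_left R p A I"
proof
  fix x assume "x \<in> tc_right R p A I"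
  then obtain c' where c': "x \<in> carrier R" "c' \<in> ring_o R"
    "\<forall>\<^sub>F e in sequentially. \<forall>y\<in>ideal_power R A (p ^ e). c' \<otimes> y \<otimes> x [^] (p ^ e) \<in> frobenius_power R I (p ^ e)"
    unfolding tc_right_def by blast
  have "\<forall>\<^sub>F e in sequentially. \<forall>y\<in>ideal_power R A (p ^ e).
       c' \<otimes> y \<otimes> x [^] (p ^ e) \<in> ideal_prod R (ideal_power R A (p ^ e)) (frobenius_power R I (p ^ e))"
    using c'(3)
  proof (rule eventually_mono, intro ballI)
    fix e y assume h: "\<forall>y\<in>ideal_power R A (p ^ e). c' \<otimes> y \<otimes> x [^] (p ^ e) \<in> frobenius_power R I (p ^ e)"
      and y: "y \<in> ideal_power R A (p ^ e)"
    have P: "ideal (ideal_power R A (p ^ e)) R" by (rule ideal_power_ideal[OF A])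
    have "c' \<otimes> y \<otimes> x [^] (p ^ e) \<in> ideal_power R A (p ^ e)"
      by (intro ideal.I_r_closed[OF P] ideal.I_l_closed[OF P] y) (use ring_o_carr[OF c'(2)] c'(1) in auto)
    then show "c' \<otimes> y \<otimes> x [^] (p ^ e) \<in> ideal_prod R (ideal_power R A (p ^ e)) (frobenius_power R I (p ^ e))"
      using comaximal_frobenius_power[OF I A c] h y by blast
  qed
  then show "x \<in> tc_left R p A I" unfolding tc_left_def using c'(1,2) by blast
qed

text \<open>An element of \<open>J\<^sup>[\<^sup>q\<^sup>]\<close>, \<open>J = Idl H\<close>, whose order exceeds the degrees \<open>\<le> q B\<close> of the generators by
  \<open>q K\<close> has coefficients in \<open>R\<^sub>\<ge>\<^sub>q\<^sub>K \<subseteq> A\<^sup>q\<close>.\<close>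

lemma mult_tc_right_subset_tc_left:
  fixes p :: nat
  assumes p: "Factorial_Ring.prime p" "add_pow R p \<one> = \<zero>" and A: "ideal A R" and K: "absorbs_tail A K"
    and I: "ideal I R" and H: "H \<subseteq> (\<Union>k\<in>{..B}. G k)" and u: "u \<in> tail (B + K)" "\<And>i. i \<in> I \<Longrightarrow> u \<otimes> i \<in> Idl H"
    and z: "z \<in> tc_right R p A I"
  shows "u \<otimes> z \<in> tc_left R p A (Idl H)"
proof -
  have Hc: "H \<subseteq> carrier R" using H G_carr by blast
  have J: "ideal (Idl H) R" using genideal_ideal[OF Hc] .
  have uc: "u \<in> carrier R" using tail_carr[OF u(1)] .
  obtain c where c: "z \<in> carrier R" "c \<in> ring_o R"
    "\<forall>\<^sub>F e in sequentially. \<forall>y\<in>ideal_power R A (p ^ e). c \<otimes> y \<otimes> z [^] (p ^ e) \<in> frobenius_power R I (p ^ e)"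
    using z unfolding tc_right_def by blast
  have cc: "c \<in> carrier R" using ring_o_carr[OF c(2)] .
  have "\<forall>\<^sub>F e in sequentially. \<forall>y\<in>ideal_power R A (p ^ e). c \<otimes> y \<otimes> (u \<otimes> z) [^] (p ^ e)
      \<in> ideal_prod R (ideal_power R A (p ^ e)) (frobenius_power R (Idl H) (p ^ e))"
    using c(3)
  proof (rule eventually_mono, intro ballI)
    fix e y assume h: "\<forall>y\<in>ideal_power R A (p ^ e). c \<otimes> y \<otimes> z [^] (p ^ e) \<in> frobenius_power R I (p ^ e)"
      and y: "y \<in> ideal_power R A (p ^ e)"
    define q where "q = p ^ e"
    define Hq where "Hq = {h [^] q | h. h \<in> H}"
    have P: "ideal (ideal_power R A q) R" by (rule ideal_power_ideal[OF A])
    have yc: "y \<in> carrier R" using ideal_carr[OF P] y by (simp add: q_def)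
    have FH: "frobenius_power R (Idl H) q = Idl Hq"
      unfolding q_def Hq_def by (rule frobenius_power_genideal[OF p Hc])
    have F: "ideal (Idl Hq) R" using frobenius_power_ideal[OF ideal_subset[OF J], of q] FH by simp
    have uq: "u [^] q \<in> carrier R" using uc by simp
    \<comment> \<open>Raising \<open>u I\<close> inside \<open>Idl H\<close> to \<open>q\<close>-th
      powers: \<open>u^q\<close> carries the Frobenius power of \<open>I\<close> into that of
      \<open>Idl H\<close>.\<close>
    have "frobenius_power R I q \<subseteq> colon (Idl Hq) (u [^] q)"
    proof (rule frobenius_power_least[OF colon_ideal[OF F uq]])
      fix i assume i: "i \<in> I"
      have ic: "i \<in> carrier R" using ideal_carr[OF I i] .
      have "(u \<otimes> i) [^] q \<in> Idl Hq" using pow_mem_frobenius_power[OF ideal_subset[OF J] u(2)[OF i]] FH by blast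
      then show "i [^] q \<in> colon (Idl Hq) (u [^] q)"
        using ic uc by (simp add: colon_def nat_pow_distrib m_comm)
    qed
    then have "(c \<otimes> y \<otimes> z [^] q) \<otimes> u [^] q \<in> Idl Hq" using h y by (auto simp: colon_def q_def)
    moreover have "(c \<otimes> y \<otimes> z [^] q) \<otimes> u [^] q = c \<otimes> y \<otimes> (u \<otimes> z) [^] q"
      using cc yc c(1) uc by (simp add: nat_pow_distrib m_ac)
    ultimately have mem: "c \<otimes> y \<otimes> (u \<otimes> z) [^] q \<in> Idl Hq" by simp
    \<comment> \<open>The whole order comes from \<open>u\<close>; the factors \<open>z\<close>,
      \<open>c\<close> and \<open>y\<close> are counted with order 0.\<close>
    have "u \<otimes> z \<in> tail (B + K + 0)" using tail_mult[OF u(1), of z 0] c(1) by simp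
    then have "(u \<otimes> z) [^] q \<in> tail (q * (B + K))" using tail_pow[of "u \<otimes> z" "B + K" q] by simp
    then have "c \<otimes> y \<otimes> (u \<otimes> z) [^] q \<in> tail (0 + q * (B + K))" using tail_mult[of "c \<otimes> y" 0] cc yc by simp
    then have t: "c \<otimes> y \<otimes> (u \<otimes> z) [^] q \<in> tail (q * (B + K))" by simp
    have HqB: "Hq \<subseteq> (\<Union>k\<in>{..q * B}. G k)"
    proof
      fix g assume "g \<in> Hq"
      then obtain h where h: "h \<in> H" "g = h [^] q" by (auto simp: Hq_def)
      then obtain k where "k \<le> B" "h \<in> G k" using H by auto
      then show "g \<in> (\<Union>k\<in>{..q * B}. G k)" using G_pow[of h k q] h(2) by (intro UN_I[of "q * k"]) auto
    qed
    have "q * (B + K) - q * B = q * K" by (simp add: algebra_simps)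
    then have "c \<otimes> y \<otimes> (u \<otimes> z) [^] q \<in> ideal_prod R (Idl Hq) (tail (q * K))"
      using genideal_inter_tail[OF HqB mem t] by simp
    also have "\<dots> \<subseteq> ideal_prod R (Idl Hq) (ideal_power R A q)"
      by (rule ideal_prod_mono[OF order_refl tail_subset_ideal_power[OF A K]])
    also have "\<dots> = ideal_prod R (ideal_power R A q) (frobenius_power R (Idl H) q)"
      unfolding FH by (rule ideal_prod_commute[OF F P])
    finally show "c \<otimes> y \<otimes> (u \<otimes> z) [^] (p ^ e)
      \<in> ideal_prod R (ideal_power R A (p ^ e)) (frobenius_power R (Idl H) (p ^ e))" by (simp add: q_def)
  qed
  then show ?thesis unfolding tc_left_def using c(1,2) uc by blast
qed

text \<open>Maximality puts \<open>y\<close> into \<open>I + x y\<close>, so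
  \<open>(1 - r x) y\<close> is in \<open>I\<close>, and with it a power of \<open>1 - r x\<close>.
  Thus \<open>x\<close> is a unit modulo \<open>I\<close>, and so is its power lying in
  \<open>A\<close>.\<close>

lemma comaximal_if_not_tail:
  assumes I: "ideal I R" and A: "ideal A R" and y: "y \<in> carrier R" "y \<notin> I"
    and max: "\<And>K. ideal K R \<Longrightarrow> I \<subset> K \<Longrightarrow> y \<in> K" and x: "x \<in> tail 1" "x \<otimes> y \<notin> I"
    and rad: "\<And>x. x \<in> tail 1 \<Longrightarrow> \<exists>j::nat. x [^] j \<in> A"
  shows "\<exists>i\<in>I. \<exists>a\<in>A. i \<oplus> a = \<one>"
proof -
  have xc: "x \<in> carrier R" using tail_carr[OF x(1)] .
  have xy: "x \<otimes> y \<in> carrier R" using xc y by simp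
  have "y \<in> adjoin I (x \<otimes> y)"
    using max[OF adjoin_ideal[OF I xy] adjoin_strict[OF I xy x(2)]] .
  then obtain i r where ir: "i \<in> I" "r \<in> carrier R" "y = i \<oplus> r \<otimes> (x \<otimes> y)" by (rule adjoinE)
  have ic: "i \<in> carrier R" using ideal_carr[OF I ir(1)] .
  have "(\<one> \<ominus> r \<otimes> x) \<otimes> y = y \<ominus> r \<otimes> (x \<otimes> y)" using ir(2) xc y(1) by algebra
  also have "\<dots> = (i \<oplus> r \<otimes> (x \<otimes> y)) \<ominus> r \<otimes> (x \<otimes> y)" using ir(3) by simp
  also have "\<dots> = i" using ic ir(2) xc y(1) by algebra
  finally have "(\<one> \<ominus> r \<otimes> x) \<otimes> y \<in> I" using ir(1) by simp
  moreover have rx: "r \<otimes> x \<in> carrier R" using ir(2) xc by simp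
  ultimately obtain k :: nat where k: "(\<one> \<ominus> r \<otimes> x) [^] k \<in> I"
    using pow_mem_if_maximal_avoiding[OF I y max, of "\<one> \<ominus> r \<otimes> x"] by auto
  obtain w where w: "w \<in> carrier R" "(\<one> \<ominus> r \<otimes> x) [^] k = \<one> \<ominus> (r \<otimes> x) \<otimes> w" using one_minus_pow_eq[OF rx] by blast
  obtain j :: nat where j: "x [^] j \<in> A" using rad x(1) by blast
  define b where "b = ((r \<otimes> x) \<otimes> w) [^] j"
  have bc: "b \<in> carrier R" using rx w(1) by (simp add: b_def)
  have "\<one> \<ominus> b \<in> I" unfolding b_def using one_minus_pow_mem[OF I, of "(r \<otimes> x) \<otimes> w" j] rx w k by simp
  moreover have "b \<in> A"
  proof -
    have "b = (r \<otimes> w) [^] j \<otimes> x [^] j" using ir(2) xc w(1) by (simp add: b_def nat_pow_distrib m_ac)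
    then show ?thesis using ideal.I_l_closed[OF A j, of "(r \<otimes> w) [^] j"] ir(2) w(1) by simp
  qed
  moreover have "(\<one> \<ominus> b) \<oplus> b = \<one>" using bc by algebra
  ultimately show ?thesis by blast
qed

end

theorem theorem4p3:
  fixes R :: "('a, 'b) ring_scheme" and G :: "nat \<Rightarrow> 'a set" and p :: nat and \<aa> :: "'a set"
  assumes "fg_graded_algebra R G"
    and "ring_char (R\<lparr>carrier := G 0\<rparr>) = p" and "p > 0"
    and "gorenstein_ring R"
    and "krull_dim R \<ge> 2"
    and "homogeneous_ideal R G \<aa>" and "primary_to R \<aa> (irrelevant_ideal R G)"
  shows "test_ideal_tau R p \<aa> = test_ideal_T R p \<aa>"
proof -
  interpret cring R using assms(1) by (simp add: fg_graded_algebra_def)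
  interpret noetherian_ring R using assms(4) by (simp add: gorenstein_ring_def)
  interpret graded_ring R G
    by (rule graded_ring.intro[OF noetherian_cring.intro[OF noetherian_ring_axioms cring_axioms]
          graded_ring_axioms.intro]) (use assms(1) in \<open>simp_all add: fg_graded_algebra_def\<close>)
  note p = ring_char_base_field[OF assms(2,3)]
  have A: "ideal \<aa> R" using assms(7) by (simp add: primary_to_def primary_ideal_def)
  have rad: "\<exists>j::nat. x [^]\<^bsub>R\<^esub> j \<in> \<aa>" if "x \<in> tail 1" for x
    using assms(7) that irrelevant_ideal_eq by (auto simp: primary_to_def radical_def)
  obtain K where K: "absorbs_tail \<aa> K" using absorbs_tail_primary[OF A rad] by blast
  show ?thesis
  proof
    have "ideal_colon R I (tc_right R p \<aa> I) \<subseteq> ideal_colon R I (tc_left R p \<aa> I)" if "ideal I R" for I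
      using subsetD[OF tc_left_subset_tc_right[OF A that]] by (auto simp: ideal_colon_def)
    then show "test_ideal_tau R p \<aa> \<subseteq> test_ideal_T R p \<aa>"
      unfolding test_ideal_tau_def test_ideal_T_def by (intro INF_mono) auto
    show "test_ideal_T R p \<aa> \<subseteq> test_ideal_tau R p \<aa>"
    proof
      fix c assume c: "c \<in> test_ideal_T R p \<aa>"
      have T: "c \<otimes>\<^bsub>R\<^esub> x \<in> I" if "ideal I R" "x \<in> tc_left R p \<aa> I" for x I
        using c that unfolding test_ideal_T_def ideal_colon_def by blast
      have cc: "c \<in> carrier R" using c oneideal unfolding test_ideal_T_def ideal_colon_def by blast
      have "c \<otimes>\<^bsub>R\<^esub> z \<in> I" if I: "ideal I R" and z: "z \<in> tc_right R p \<aa> I" for I z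
      proof (rule ccontr)
        assume "c \<otimes>\<^bsub>R\<^esub> z \<notin> I"
        have zc: "z \<in> carrier R" using z by (simp add: tc_right_def)
        define y where "y = c \<otimes>\<^bsub>R\<^esub> z"
        have yc: "y \<in> carrier R" using cc zc by (simp add: y_def)
        \<comment> \<open>Enlarging \<open>I\<close> keeps \<open>z\<close> in the closure, as
          \<open>tc_right\<close> is monotone, and makes the residue of \<open>y\<close> lie in
          every nonzero ideal of \<open>R/I'\<close>.\<close>
        obtain I' where I': "ideal I' R" "I \<subseteq> I'" "y \<notin> I'"
          and max: "\<And>K. ideal K R \<Longrightarrow> I' \<subset> K \<Longrightarrow> y \<in> K"
        proof (rule noetherian_maximal[OF I, of "\<lambda>I. y \<notin> I"])
          show "y \<notin> I" using \<open>c \<otimes>\<^bsub>R\<^esub> z \<notin> I\<close> by (simp add: y_def)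
        qed (use that in blast)
        have z': "z \<in> tc_right R p \<aa> I'" using tc_right_mono[OF I'(2,1)] z by blast
        show False
        \<comment> \<open>This decides whether the maximal ideal \<open>I' : y\<close> is
          \<open>R_+\<close>.\<close>
        proof (cases "\<forall>x\<in>tail 1. x \<otimes>\<^bsub>R\<^esub> y \<in> I'")
          case False
          then obtain x where x: "x \<in> tail 1" "x \<otimes>\<^bsub>R\<^esub> y \<notin> I'" by blast
          obtain i a where ia: "i \<in> I'" "a \<in> \<aa>" "i \<oplus>\<^bsub>R\<^esub> a = \<one>\<^bsub>R\<^esub>"
            using comaximal_if_not_tail[OF I'(1) A yc I'(3) max x rad] by blast
          have "z \<in> tc_left R p \<aa> I'" using tc_right_subset_tc_left_comaximal[OF A I'(1) ia] z' by blast
          then show False using T[OF I'(1)] I'(3) by (simp add: y_def)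
        next
          case True
          have rad': "\<exists>j::nat. x [^]\<^bsub>R\<^esub> j \<in> I'" if "x \<in> tail 1" for x
            using pow_mem_if_maximal_avoiding[OF I'(1) yc I'(3) max, of x] True that tail_carr by blast
          obtain H B u where H: "H \<subseteq> (\<Union>k\<in>{..B}. G k)" and u: "u \<in> tail (B + K)"
            "\<And>i. i \<in> I' \<Longrightarrow> u \<otimes>\<^bsub>R\<^esub> i \<in> Idl\<^bsub>R\<^esub> H" "u \<otimes>\<^bsub>R\<^esub> y \<notin> Idl\<^bsub>R\<^esub> H"
            using gorenstein_high_order_embedding[OF assms(4,5) I'(1) yc I'(3) _ rad', of K] True by blast
          have Hc: "H \<subseteq> carrier R" using H G_carr by blast
          \<comment> \<open>\<open>u z\<close> is in the smaller closure of \<open>Idl H\<close>, so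
            \<open>c\<close> carries it into \<open>Idl H\<close>; but
            \<open>c (u z) = u y\<close>.\<close>
          have "c \<otimes>\<^bsub>R\<^esub> (u \<otimes>\<^bsub>R\<^esub> z) \<in> Idl\<^bsub>R\<^esub> H"
            using T[OF genideal_ideal[OF Hc]] mult_tc_right_subset_tc_left[OF p A K I'(1) H u(1,2) z'] by blast
          moreover have "c \<otimes>\<^bsub>R\<^esub> (u \<otimes>\<^bsub>R\<^esub> z) = u \<otimes>\<^bsub>R\<^esub> y"
            unfolding y_def by (rule m_lcomm[OF cc tail_carr[OF u(1)] zc])
          ultimately show False using u(3) by simp
        qed
      qed
      then show "c \<in> test_ideal_tau R p \<aa>"
        using cc unfolding test_ideal_tau_def ideal_colon_def by blast
    qed
  qed
qed

end
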